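(* Let $n\ge2$, let $I\subset\mathbb{R}$ be an interval with $|I|=1$, and let $1\le p<n$. Then $$W^1L^p(I^n)\hookrightarrow\mathcal{R}(L^{p(n-1)/(n-p),p},L^\infty)\hookrightarrow L^{pn/(n-p),p}(I^n),$$ and the second embedding is strict, i.e. $\mathcal{R}(L^{p(n-1)/(n-p),p},L^\infty)\ne L^{pn/(n-p),p}(I^n)$.
   Context: Rearrangements: for a measurable real function $f$ on $I^m$ ($m\ge1$, $|I|=1$), $\lambda_f(t)=|\{x:|f(x)|>t\}|$ and $f^*(t)=\inf\{s\ge 0:\lambda_f(s)\le t\}$. Lorentz spaces: for $p=q=1$, or $p=q=\infty$, or $1<p<\infty$ and $1\le q\le\infty$, $L^{p,q}(I^m)$ is the space of measurable $f$ with $\|f\|_{L^{p,q}(I^m)}=\|t^{1/p-1/q}f^*(t)\|_{L^q(0,1)}<\infty$. Sobolev space: $W^1L^p(I^n)=\{u\in L^p(I^n):|\nabla u|\in L^p(I^n)\}$ ($\nabla u$ the distributional gradient, $|\cdot|$ Euclidean length), with norm $\|u\|_{L^p(I^n)}+\||\nabla u|\|_{L^p(I^n)}$. Mixed norm spaces: for $x\in I^n$ and $k\in\{1,\dots,n\}$ let $\widehat{x}_k\in I^{n-1}$ be $x$ with its $k$th coordinate removed. For rearrangement invariant Banach function spaces $X(I^{n-1})$, $Y(I)$, let $\psi_k(f,Y)(\widehat{x}_k)=\|f(\widehat{x}_k,\cdot)\|_{Y(I)}$ (norm in the $k$th variable), $\|f\|_{\mathcal{R}_k(X,Y)}=\|\psi_k(f,Y)\|_{X(I^{n-1})}$,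 $\mathcal{R}_k(X,Y)=\{f:\|f\|_{\mathcal{R}_k(X,Y)}<\infty\}$, and $\mathcal{R}(X,Y)=\bigcap_{k=1}^n\mathcal{R}_k(X,Y)$ with norm $\|f\|_{\mathcal{R}(X,Y)}=\sum_{k=1}^n\|f\|_{\mathcal{R}_k(X,Y)}$. In $\mathcal{R}(L^{p(n-1)/(n-p),p},L^\infty)$ the first space is taken on $I^{n-1}$ and $L^\infty$ on $I$. $A\hookrightarrow B$ denotes a continuous embedding: $A\subset B$ and $\|f\|_B\le C\|f\|_A$ for all $f\in A$. *)

theory Defs
  imports "HOL-Analysis.Analysis" "HOL-Probability.Essential_Supremum"
begin

text \<open>
  Points of \<open>\<real>\<^sup>n\<close> are extensional functions \<open>nat \<Rightarrow> real\<close> on \<open>{..<n}\<close>. Removing the \<open>k\<close>th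
  coordinate yields a point over the index set \<open>{..<n} - {k}\<close>, and \<open>y(k := t)\<close> reinserts it.
  Functions are not identified when they agree almost everywhere; all the spaces below are
  closed under such changes.
\<close>

text \<open>Lebesgue measure on the cube with side \<open>I\<close> and coordinates indexed by the finite set \<open>S\<close>,
  as the completion of the product measure.\<close>
definition cube :: "nat set \<Rightarrow> real set \<Rightarrow> (nat \<Rightarrow> real) measure" where
  "cube S I = completion (PiM S (\<lambda>_. restrict_space lborel I))"

section \<open>Function norms\<close>

text \<open>Norms act on \<open>[0,\<infinity>]\<close>-valued functions, since the partial norms \<open>\<psi>\<^sub>k\<close> may be infinite.
  A real function \<open>f\<close> enters as \<open>|f|\<close>.\<close>

definition eabs :: "('a \<Rightarrow> real) \<Rightarrow> 'a \<Rightarrow> ennreal" where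
  "eabs f = (\<lambda>x. ennreal \<bar>f x\<bar>)"

text \<open>Only used with exponents \<open>a > 0\<close>.\<close>
definition epow :: "ennreal \<Rightarrow> real \<Rightarrow> ennreal" where
  "epow x a = (if x = \<infinity> then \<infinity> else ennreal (enn2real x powr a))"

text \<open>Exponents range over \<open>[1,\<infinity>]\<close>; this is \<open>1/p\<close> with \<open>1/\<infinity> = 0\<close>.\<close>
definition recip :: "ennreal \<Rightarrow> real" where
  "recip p = enn2real (inverse p)"

definition Lp_norm :: "ennreal \<Rightarrow> 'a measure \<Rightarrow> ('a \<Rightarrow> ennreal) \<Rightarrow> ennreal" where
  "Lp_norm p M f =
     (if p = \<infinity> then esssup M f
      else epow (\<integral>\<^sup>+x. epow (f x) (enn2real p) \<partial>M) (recip p))"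

definition distr_fun :: "'a measure \<Rightarrow> ('a \<Rightarrow> ennreal) \<Rightarrow> real \<Rightarrow> ennreal" where
  "distr_fun M f t = emeasure M {x \<in> space M. f x > ennreal t}"

text \<open>The infimum is taken in \<open>[0,\<infinity>]\<close>, so that it is \<open>\<infinity>\<close> for the empty set.\<close>
definition rearrangement :: "'a measure \<Rightarrow> ('a \<Rightarrow> ennreal) \<Rightarrow> real \<Rightarrow> ennreal" where
  "rearrangement M f t = Inf {ennreal s | s. 0 \<le> s \<and> distr_fun M f s \<le> ennreal t}"

definition lorentz_norm :: "ennreal \<Rightarrow> ennreal \<Rightarrow> 'a measure \<Rightarrow> ('a \<Rightarrow> ennreal) \<Rightarrow> ennreal" where
  "lorentz_norm p q M f =
     Lp_norm q (lebesgue_on {0<..<1})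
       (\<lambda>t. ennreal (t powr (recip p - recip q)) * rearrangement M f t)"

definition Lp_space :: "ennreal \<Rightarrow> 'a measure \<Rightarrow> ('a \<Rightarrow> real) set" where
  "Lp_space p M = {f \<in> borel_measurable M. Lp_norm p M (eabs f) < \<infinity>}"

definition lorentz_space :: "ennreal \<Rightarrow> ennreal \<Rightarrow> 'a measure \<Rightarrow> ('a \<Rightarrow> real) set" where
  "lorentz_space p q M = {f \<in> borel_measurable M. lorentz_norm p q M (eabs f) < \<infinity>}"

section \<open>Mixed norm spaces\<close>

text \<open>\<open>X\<close> and \<open>Y\<close> are function norms depending on the underlying measure space: \<open>X\<close> is used
  over the \<open>n\<close> cubes \<open>cube ({..<n} - {k}) I\<close> and \<open>Y\<close> over \<open>I\<close>.\<close>

type_synonym 'a fnorm = "'a measure \<Rightarrow> ('a \<Rightarrow> ennreal) \<Rightarrow> ennreal"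

definition psi :: "real set \<Rightarrow> real fnorm \<Rightarrow> nat \<Rightarrow> ((nat \<Rightarrow> real) \<Rightarrow> real) \<Rightarrow> (nat \<Rightarrow> real) \<Rightarrow> ennreal" where
  "psi I Y k f y = Y (lebesgue_on I) (eabs (\<lambda>t. f (y(k := t))))"

definition mixed_norm_k ::
  "nat \<Rightarrow> real set \<Rightarrow> nat \<Rightarrow> (nat \<Rightarrow> real) fnorm \<Rightarrow> real fnorm \<Rightarrow> ((nat \<Rightarrow> real) \<Rightarrow> real) \<Rightarrow> ennreal" where
  "mixed_norm_k n I k X Y f = X (cube ({..<n} - {k}) I) (psi I Y k f)"

definition mixed_space_k ::
  "nat \<Rightarrow> real set \<Rightarrow> nat \<Rightarrow> (nat \<Rightarrow> real) fnorm \<Rightarrow> real fnorm \<Rightarrow> ((nat \<Rightarrow> real) \<Rightarrow> real) set" where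
  "mixed_space_k n I k X Y =
     {f \<in> borel_measurable (cube {..<n} I). mixed_norm_k n I k X Y f < \<infinity>}"

definition mixed_norm ::
  "nat \<Rightarrow> real set \<Rightarrow> (nat \<Rightarrow> real) fnorm \<Rightarrow> real fnorm \<Rightarrow> ((nat \<Rightarrow> real) \<Rightarrow> real) \<Rightarrow> ennreal" where
  "mixed_norm n I X Y f = (\<Sum>k<n. mixed_norm_k n I k X Y f)"

definition mixed_space ::
  "nat \<Rightarrow> real set \<Rightarrow> (nat \<Rightarrow> real) fnorm \<Rightarrow> real fnorm \<Rightarrow> ((nat \<Rightarrow> real) \<Rightarrow> real) set" where
  "mixed_space n I X Y = (\<Inter>k\<in>{..<n}. mixed_space_k n I k X Y)"

section \<open>Distributional gradient and Sobolev space\<close>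

abbreviation euclid :: "nat \<Rightarrow> (nat \<Rightarrow> real) set" where
  "euclid n \<equiv> PiE {..<n} (\<lambda>_. UNIV)"

abbreviation open_cube :: "nat \<Rightarrow> real set \<Rightarrow> (nat \<Rightarrow> real) set" where
  "open_cube n I \<equiv> PiE {..<n} (\<lambda>_. interior I)"

definition partial :: "nat \<Rightarrow> ((nat \<Rightarrow> real) \<Rightarrow> real) \<Rightarrow> (nat \<Rightarrow> real) \<Rightarrow> real" where
  "partial i f x = deriv (\<lambda>t. f (x(i := t))) (x i)"

text \<open>\<open>Ck n m f\<close>: \<open>f\<close> is of class \<open>C\<^sup>m\<close> on \<open>\<real>\<^sup>n\<close>. Continuity refers to the product topology on
  \<open>nat \<Rightarrow> real\<close>, which induces the Euclidean one on \<open>euclid n\<close>.\<close>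
primrec Ck :: "nat \<Rightarrow> nat \<Rightarrow> ((nat \<Rightarrow> real) \<Rightarrow> real) \<Rightarrow> bool" where
  "Ck n 0 f \<longleftrightarrow> continuous_on (euclid n) f"
| "Ck n (Suc m) f \<longleftrightarrow> continuous_on (euclid n) f \<and>
     (\<forall>i<n. (\<forall>x\<in>euclid n. (\<lambda>t. f (x(i := t))) differentiable (at (x i))) \<and> Ck n m (partial i f))"

text \<open>\<open>C\<^sub>c\<^sup>\<infinity>\<close> functions on the interior of \<open>I\<^sup>n\<close>, extended by zero.\<close>
definition test_fun :: "nat \<Rightarrow> real set \<Rightarrow> ((nat \<Rightarrow> real) \<Rightarrow> real) \<Rightarrow> bool" where
  "test_fun n I \<phi> \<longleftrightarrow> (\<forall>m. Ck n m \<phi>) \<and>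
     (\<exists>K. compact K \<and> K \<subseteq> open_cube n I \<and> (\<forall>x \<in> euclid n - K. \<phi> x = 0))"

definition loc_integrable :: "nat \<Rightarrow> real set \<Rightarrow> ((nat \<Rightarrow> real) \<Rightarrow> real) \<Rightarrow> bool" where
  "loc_integrable n I f \<longleftrightarrow> f \<in> borel_measurable (cube {..<n} I) \<and>
     (\<forall>K. compact K \<and> K \<subseteq> open_cube n I \<longrightarrow> set_integrable (cube {..<n} I) K f)"

definition is_gradient ::
  "nat \<Rightarrow> real set \<Rightarrow> ((nat \<Rightarrow> real) \<Rightarrow> real) \<Rightarrow> (nat \<Rightarrow> (nat \<Rightarrow> real) \<Rightarrow> real) \<Rightarrow> bool" where
  "is_gradient n I u G \<longleftrightarrow> loc_integrable n I u \<and>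
     (\<forall>i<n. loc_integrable n I (G i) \<and>
       (\<forall>\<phi>. test_fun n I \<phi> \<longrightarrow>
         (\<integral>x. u x * partial i \<phi> x \<partial>cube {..<n} I) = - (\<integral>x. G i x * \<phi> x \<partial>cube {..<n} I)))"

text \<open>The distributional gradient is unique up to null sets, so the choice is immaterial.\<close>
definition gradient ::
  "nat \<Rightarrow> real set \<Rightarrow> ((nat \<Rightarrow> real) \<Rightarrow> real) \<Rightarrow> nat \<Rightarrow> (nat \<Rightarrow> real) \<Rightarrow> real" where
  "gradient n I u = (SOME G. is_gradient n I u G)"

definition gradient_length ::
  "nat \<Rightarrow> real set \<Rightarrow> ((nat \<Rightarrow> real) \<Rightarrow> real) \<Rightarrow> (nat \<Rightarrow> real) \<Rightarrow> real" where
  "gradient_length n I u x = L2_set (\<lambda>i. gradient n I u i x) {..<n}"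

definition sobolev_space :: "nat \<Rightarrow> real set \<Rightarrow> ennreal \<Rightarrow> ((nat \<Rightarrow> real) \<Rightarrow> real) set" where
  "sobolev_space n I p =
     {u \<in> Lp_space p (cube {..<n} I). (\<exists>G. is_gradient n I u G) \<and>
        gradient_length n I u \<in> Lp_space p (cube {..<n} I)}"

definition sobolev_norm :: "nat \<Rightarrow> real set \<Rightarrow> ennreal \<Rightarrow> ((nat \<Rightarrow> real) \<Rightarrow> real) \<Rightarrow> ennreal" where
  "sobolev_norm n I p u =
     Lp_norm p (cube {..<n} I) (eabs u) + Lp_norm p (cube {..<n} I) (eabs (gradient_length n I u))"

section \<open>Continuous embeddings\<close>

definition embeds :: "'f set \<Rightarrow> ('f \<Rightarrow> ennreal) \<Rightarrow> 'f set \<Rightarrow> ('f \<Rightarrow> ennreal) \<Rightarrow> bool" where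
  "embeds A NA B NB \<longleftrightarrow> A \<subseteq> B \<and> (\<exists>C::real. \<forall>f\<in>A. NB f \<le> ennreal C * NA f)"

end

theory Submission
  imports Defs "HOL-Probability.Probability"
begin

text \<open>
  Both embeddings are statements about distribution functions. For a function \<open>f\<close> with distribution
  function \<open>\<lambda>\<close>, the \<open>p\<close>th power of the norm of \<open>L\<^sup>r\<^sup>,\<^sup>p\<close> is \<open>r \<integral> s\<^sup>p\<^sup>-\<^sup>1 \<lambda>(s)\<^sup>p\<^sup>/\<^sup>r ds\<close>
  (\<open>lorentz_norm_distribution\<close>). Write \<open>\<psi>\<^sub>k f\<close> for the essential supremum of \<open>\<bar>f\<bar>\<close> along the lines in
  direction \<open>k\<close>. The set \<open>{\<psi>\<^sub>k f > s}\<close> is the shadow of \<open>{\<bar>f\<bar> > s}\<close> in direction \<open>k\<close>, so the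
  Loomis-Whitney inequality bounds the \<open>(n - 1)\<close>st power of the measure of \<open>{\<bar>f\<bar> > s}\<close> by the product
  of the measures of the \<open>n\<close> shadows (\<open>superlevel_measure_le_shadows\<close>). Integrated over \<open>s\<close>, this is
  the second embedding. It is strict because a function of one coordinate with a weak power singularity
  lies in the Lorentz space, whereas its supremum along that coordinate is infinite on every line.

  The first embedding is proved by truncation. A function \<open>u\<close> with an integrable distributional gradient
  is absolutely continuous on almost every line (\<open>AE_line_antiderivative\<close>). If \<open>\<bar>u\<bar>\<close> exceeds \<open>2a\<close> somewhere
  on such a line, then either \<open>\<bar>u\<bar> > a\<close> on the whole line, or \<open>\<bar>u\<bar>\<close> has to climb from \<open>a\<close> to \<open>2a\<close>, and
  \<open>\<bar>\<nabla>u\<bar>\<close> has integral at least \<open>a\<close> over the part of the line where \<open>a < \<bar>u\<bar> < 2a\<close>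
  (\<open>level_le_slice_integral\<close>). Integrating over the lines bounds the measure of \<open>{\<psi>\<^sub>k u > 2a}\<close> by
  integrals over \<open>{\<bar>u\<bar> > a}\<close>. Young's inequality with a free parameter and the Loomis-Whitney inequality
  turn this, for the levels \<open>a = 2\<^sup>j N\<close>, into a recursion between the shadows of consecutive levels
  (\<open>dyadic_recursion_bound\<close>). The error terms of the recursion have a bounded sum since the shells
  \<open>{a < \<bar>u\<bar> < 2a}\<close> are disjoint, and the resulting sum over \<open>j\<close> is the dyadic form of the Lorentz norm
  of \<open>\<psi>\<^sub>k u\<close>, with second exponent \<open>p\<close>.

  Absolute continuity on lines needs only test functions that are products of functions of one
  variable. If \<open>w\<close> is \<open>u\<close> minus the integral of its \<open>k\<close>th partial derivative along the lines, then testing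
  with a factor in direction \<open>k\<close> whose derivative approximates a multiple of the difference of two
  normalised indicators shows that \<open>w\<close> and its mean along direction \<open>k\<close> have the same integral over every box.
  Hence \<open>w\<close> is almost everywhere constant along almost every line.
\<close>

section \<open>Products of probability spaces and the Loomis-Whitney inequality\<close>

lemma powr_inverse_power:
  assumes "0 \<le> (x::real)" "0 < m"
  shows "(x powr (1 / real m)) ^ m = x"
  using assms by (cases "x = 0") (auto simp: powr_power)

text \<open>Hoelder's inequality for the \<open>m\<close> functions \<open>h\<^sub>i\<close> with all exponents equal to \<open>m\<close>, applied to
  \<open>F \<le> c\<^sup>1\<^sup>/\<^sup>m (\<Prod> h\<^sub>i)\<^sup>1\<^sup>/\<^sup>m\<close>. After each \<open>h\<^sub>i\<close> is divided by its integral, it is the inequality between the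
  geometric and the arithmetic mean, integrated.\<close>
lemma integral_power_le_prod:
  fixes h :: "'i \<Rightarrow> 'a \<Rightarrow> real" and F :: "'a \<Rightarrow> real"
  assumes fin: "finite S" "S \<noteq> {}"
    and h: "\<And>i. i \<in> S \<Longrightarrow> integrable M (h i)" "\<And>i x. i \<in> S \<Longrightarrow> 0 \<le> h i x"
    and F: "integrable M F" "\<And>x. x \<in> space M \<Longrightarrow> 0 \<le> F x"
    and c: "0 \<le> c"
    and le: "\<And>x. x \<in> space M \<Longrightarrow> F x ^ card S \<le> c * (\<Prod>i\<in>S. h i x)"
  shows "(\<integral>x. F x \<partial>M) ^ card S \<le> c * (\<Prod>i\<in>S. \<integral>x. h i x \<partial>M)"
proof (cases "\<forall>i\<in>S. (\<integral>x. h i x \<partial>M) > 0")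
  case True
  define m where "m = card S"
  have m: "0 < m" using fin by (simp add: m_def card_gt_0_iff)
  define H where "H i = (\<integral>x. h i x \<partial>M)" for i
  have H: "H i > 0" if "i \<in> S" for i using True that by (simp add: H_def)
  define G where "G = (c * (\<Prod>i\<in>S. H i)) powr (1 / m)"
  have G0: "0 \<le> G" by (simp add: G_def)
  have PH: "0 < (\<Prod>i\<in>S. H i)" using H by (simp add: prod_pos)
  have Gm: "G ^ m = c * (\<Prod>i\<in>S. H i)"
    using powr_inverse_power[of "c * (\<Prod>i\<in>S. H i)" m] c PH m by (simp add: G_def)
  have pt: "F x \<le> G * (\<Sum>i\<in>S. h i x / H i / m)" if x: "x \<in> space M" for x
  proof -
    have am: "(\<Prod>i\<in>S. h i x / H i) powr (1 / m) \<le> (\<Sum>i\<in>S. h i x / H i / m)"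
      using arith_geom_mean[OF fin, of "\<lambda>i. h i x / H i"] H h(2) by (simp add: m_def less_imp_le)
    have pr: "0 \<le> (\<Prod>i\<in>S. h i x / H i)" using H h(2) by (intro prod_nonneg) (simp add: less_imp_le)
    have "((\<Prod>i\<in>S. h i x / H i) powr (1 / m)) ^ m = (\<Prod>i\<in>S. h i x / H i)"
      by (rule powr_inverse_power[OF pr m])
    then have "(G * (\<Prod>i\<in>S. h i x / H i) powr (1 / m)) ^ m = c * (\<Prod>i\<in>S. h i x)"
      using PH by (simp add: power_mult_distrib Gm prod_dividef)
    then have "F x ^ m \<le> (G * (\<Prod>i\<in>S. h i x / H i) powr (1 / m)) ^ m"
      using le[OF x] by (simp add: m_def)
    then have "F x \<le> G * (\<Prod>i\<in>S. h i x / H i) powr (1 / m)"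
      using G0 m by (subst (asm) power_mono_iff) (use F(2)[OF x] in auto)
    also have "\<dots> \<le> G * (\<Sum>i\<in>S. h i x / H i / m)"
      using am G0 by (rule mult_left_mono)
    finally show ?thesis .
  qed
  have int: "integrable M (\<lambda>x. G * (\<Sum>i\<in>S. h i x / H i / m))"
    using h(1) by (intro integrable_mult_right Bochner_Integration.integrable_sum) auto
  have "(\<integral>x. F x \<partial>M) \<le> (\<integral>x. G * (\<Sum>i\<in>S. h i x / H i / m) \<partial>M)"
    using pt by (intro integral_mono F(1) int)
  also have "\<dots> = G * (\<Sum>i\<in>S. (\<integral>x. h i x \<partial>M) / H i / m)"
    using h(1) by (subst integral_mult_right_zero, subst Bochner_Integration.integral_sum) auto
  also have "\<dots> = G * (\<Sum>i\<in>S. 1 / m)"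
  proof -
    have "(\<Sum>i\<in>S. (\<integral>x. h i x \<partial>M) / H i / m) = (\<Sum>i\<in>S. 1 / m)"
      unfolding H_def[symmetric]
    proof (rule sum.cong)
      fix i assume "i \<in> S"
      then show "H i / H i / real m = 1 / real m" using H[of i] by simp
    qed simp
    then show ?thesis by simp
  qed
  also have "\<dots> = G" using m by (simp add: m_def)
  finally have "(\<integral>x. F x \<partial>M) \<le> G" .
  moreover have "0 \<le> (\<integral>x. F x \<partial>M)" using F(2) by (rule Bochner_Integration.integral_nonneg)
  ultimately have "(\<integral>x. F x \<partial>M) ^ m \<le> G ^ m" by (intro power_mono)
  then show ?thesis using Gm unfolding m_def H_def by simp
next
  case False
  then obtain i where i: "i \<in> S" "(\<integral>x. h i x \<partial>M) \<le> 0" by auto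
  moreover have "0 \<le> (\<integral>x. h i x \<partial>M)" using h(2)[OF i(1)] by simp
  ultimately have i0: "(\<integral>x. h i x \<partial>M) = 0" by simp
  then have "AE x in M. h i x = 0"
    using integral_nonneg_eq_0_iff_AE[OF h(1)[OF i(1)]] h(2)[OF i(1)] by simp
  then have "AE x in M. F x = 0"
  proof (rule AE_mp, intro AE_I2 impI)
    fix x assume x: "x \<in> space M" and "h i x = 0"
    then have "(\<Prod>i\<in>S. h i x) = 0" using i(1) fin by (auto simp: prod_zero_iff)
    then have "F x ^ card S \<le> 0" using le[OF x] by simp
    then have "\<not> 0 < F x" using zero_less_power[of "F x" "card S"] by linarith
    then show "F x = 0" using F(2)[OF x] by simp
  qed
  then have "(\<integral>x. F x \<partial>M) = (\<integral>x. 0 \<partial>M)" using F(1) by (intro integral_cong_AE) auto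
  moreover have "card S \<noteq> 0" using fin by simp
  ultimately have "(\<integral>x. F x \<partial>M) ^ card S = 0" by simp
  moreover have "(\<Prod>i\<in>S. \<integral>x. h i x \<partial>M) = 0" using i(1) i0 fin by (auto simp: prod_zero_iff)
  ultimately show ?thesis by (simp only: mult_zero_right)
qed

locale prob_side = prob_space M for M :: "'a measure"
begin

sublocale product_sigma_finite "\<lambda>_::nat. M"
  by standard

abbreviation P :: "nat set \<Rightarrow> (nat \<Rightarrow> 'a) measure" where
  "P S \<equiv> PiM S (\<lambda>_. M)"

lemma prob_P: "prob_space (P S)"
  by (intro prob_space_PiM) (rule prob_space_axioms)

lemma measurable_slice:
  assumes f: "f \<in> P S \<rightarrow>\<^sub>M N" and k: "k \<in> S"
  shows "(\<lambda>(y, t). f (y(k := t))) \<in> P (S - {k}) \<Otimes>\<^sub>M M \<rightarrow>\<^sub>M N"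
proof -
  have "(\<lambda>(y, t). y(k := t)) \<in> P (S - {k}) \<Otimes>\<^sub>M M \<rightarrow>\<^sub>M P (insert k (S - {k}))"
    by (rule measurable_add_dim)
  then have "(\<lambda>z. f ((\<lambda>(y, t). y(k := t)) z)) \<in> P (S - {k}) \<Otimes>\<^sub>M M \<rightarrow>\<^sub>M N"
    by (rule measurable_compose) (use f k in \<open>simp add: insert_absorb\<close>)
  then show ?thesis by (simp add: case_prod_beta)
qed

lemma nn_integral_slice:
  assumes "finite S" "k \<in> S" "f \<in> borel_measurable (P S)"
  shows "(\<integral>\<^sup>+x. f x \<partial>P S) = (\<integral>\<^sup>+y. \<integral>\<^sup>+t. f (y(k := t)) \<partial>M \<partial>P (S - {k}))"
    and "(\<integral>\<^sup>+x. f x \<partial>P S) = (\<integral>\<^sup>+t. \<integral>\<^sup>+y. f (y(k := t)) \<partial>P (S - {k}) \<partial>M)"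
  using product_nn_integral_insert[of "S - {k}" k f] product_nn_integral_insert_rev[of "S - {k}" k f] assms
  by (simp_all add: insert_absorb)

lemma upd_in_space:
  assumes "k \<in> S" "y \<in> space (P (S - {k}))" "t \<in> space M"
  shows "y(k := t) \<in> space (P S)"
  using assms by (auto simp: space_PiM PiE_iff extensional_def)

lemma AE_slice:
  assumes S: "finite S" "k \<in> S" and ae: "AE x in P S. Q x"
  shows "AE y in P (S - {k}). AE t in M. Q (y(k := t))"
proof -
  obtain N where N: "{x \<in> space (P S). \<not> Q x} \<subseteq> N" "N \<in> sets (P S)" "emeasure (P S) N = 0"
    using ae by (auto elim: AE_E)
  have meas: "(\<lambda>(y, t). indicator N (y(k := t)) :: ennreal) \<in> borel_measurable (P (S - {k}) \<Otimes>\<^sub>M M)"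
    using N(2) by (intro measurable_slice[OF _ S(2)]) auto
  have "0 = (\<integral>\<^sup>+x. indicator N x \<partial>P S)" using N by simp
  also have "\<dots> = (\<integral>\<^sup>+y. \<integral>\<^sup>+t. indicator N (y(k := t)) \<partial>M \<partial>P (S - {k}))"
    using N(2) by (intro nn_integral_slice S) auto
  finally have "(\<integral>\<^sup>+y. \<integral>\<^sup>+t. indicator N (y(k := t)) \<partial>M \<partial>P (S - {k})) = 0" by simp
  then have "AE y in P (S - {k}). (\<integral>\<^sup>+t. indicator N (y(k := t)) \<partial>M) = 0"
    using meas by (subst (asm) nn_integral_0_iff_AE) (auto intro!: borel_measurable_nn_integral)
  moreover have "AE y in P (S - {k}). (\<integral>\<^sup>+t. indicator N (y(k := t)) \<partial>M) = 0 \<longrightarrow> (AE t in M. Q (y(k := t)))"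
  proof (rule AE_I2, rule impI)
    fix y assume y: "y \<in> space (P (S - {k}))" and "(\<integral>\<^sup>+t. indicator N (y(k := t)) \<partial>M) = 0"
    moreover have "(\<lambda>t. indicator N (y(k := t)) :: ennreal) \<in> borel_measurable M"
      using measurable_compose[OF measurable_Pair1'[OF y] meas] by simp
    ultimately have "AE t in M. (indicator N (y(k := t)) :: ennreal) = 0"
      by (subst (asm) nn_integral_0_iff_AE) auto
    then show "AE t in M. Q (y(k := t))"
    proof (rule AE_mp, intro AE_I2 impI)
      fix t assume "t \<in> space M" "(indicator N (y(k := t)) :: ennreal) = 0"
      then show "Q (y(k := t))"
        using N(1) upd_in_space[OF S(2) y] by (auto simp: indicator_def split: if_splits)
    qed
  qed
  ultimately show ?thesis by (rule AE_mp)
qed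

text \<open>By induction on the number of coordinates. For a new coordinate \<open>k\<close>, each slice of \<open>A\<close> at height \<open>t\<close>
  lies in \<open>B k\<close>, and the induction hypothesis bounds it by the slices of the other \<open>B j\<close>; the product
  of the two bounds is integrated over \<open>t\<close> by Hoelder's inequality. The case \<open>A = {}\<close> is
  excluded only because of \<open>0 ^ 0 = 1\<close> when \<open>S\<close> is a singleton.\<close>
lemma loomis_whitney:
  assumes "finite S" "S \<noteq> {}"
    and "A \<in> sets (P S)" "\<And>k. k \<in> S \<Longrightarrow> B k \<in> sets (P (S - {k}))"
    and "\<And>x k. x \<in> A \<Longrightarrow> k \<in> S \<Longrightarrow> x(k := undefined) \<in> B k"
    and "A \<noteq> {}"
  shows "measure (P S) A ^ (card S - 1) \<le> (\<Prod>k\<in>S. measure (P (S - {k})) (B k))"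
  using assms
proof (induction S arbitrary: A B rule: finite_ne_induct)
  case (singleton k)
  obtain x where x: "x \<in> A" using singleton by auto
  with singleton.prems(1) have "x \<in> space (P {k})" by (meson sets.sets_into_space subsetD)
  then have "x(k := undefined) = (\<lambda>_. undefined)" by (auto simp: space_PiM PiE_iff extensional_def)
  with singleton.prems(3)[OF x] have "(\<lambda>_. undefined) \<in> B k" by simp
  moreover have "B k \<in> {{}, {\<lambda>_. undefined}}"
    using singleton.prems(2)[of k] by (simp add: sets_PiM_empty)
  ultimately have "B k = {\<lambda>_. undefined}" by auto
  then have "measure (P {}) (B k) = 1" by (simp add: measure_def)
  then show ?case by simp
next
  case (insert k S)
  note fin = \<open>finite S\<close> and kS = \<open>k \<notin> S\<close>
  have cS: "card S \<noteq> 0" using fin \<open>S \<noteq> {}\<close> by simp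
  have Sk: "insert k S - {k} = S" using kS by auto
  have Sj: "insert k S - {j} = insert k (S - {j})" if "j \<in> S" for j using kS that by auto
  interpret PS: prob_space "P T" for T by (rule prob_P)
  define At where "At t = {y \<in> space (P S). y(k := t) \<in> A}" for t
  define Bt where "Bt j t = {y \<in> space (P (S - {j})). y(k := t) \<in> B j}" for j t
  have slice_sets: "{y \<in> space (P T). y(k := t) \<in> C} \<in> sets (P T)"
    and slice_meas: "(\<lambda>t. emeasure (P T) {y \<in> space (P T). y(k := t) \<in> C}) \<in> borel_measurable M"
    and slice_int: "emeasure (P (insert k T)) C = (\<integral>\<^sup>+t. emeasure (P T) {y \<in> space (P T). y(k := t) \<in> C} \<partial>M)"
    if T: "finite T" "k \<notin> T" "C \<in> sets (P (insert k T))" "t \<in> space M" for T C t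
  proof -
    have Tk: "insert k T - {k} = T" using T by auto
    have m: "(\<lambda>(y, t). indicator C (y(k := t)) :: ennreal) \<in> borel_measurable (P T \<Otimes>\<^sub>M M)"
      using measurable_slice[of "indicator C :: _ \<Rightarrow> ennreal" "insert k T" borel k] T(3) Tk by simp
    have st: "{y \<in> space (P T). y(k := t) \<in> C} \<in> sets (P T)" if t: "t \<in> space M" for t
    proof -
      have "(\<lambda>y. y(k := t)) \<in> P T \<rightarrow>\<^sub>M P (insert k T)"
        using measurable_compose[OF measurable_Pair2'[OF t] measurable_add_dim[of k T "\<lambda>_. M"]] by simp
      from measurable_sets[OF this T(3)] show ?thesis
        by (simp add: vimage_def Int_def conj_commute)
    qed
    show "{y \<in> space (P T). y(k := t) \<in> C} \<in> sets (P T)" using st T(4) .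
    have eq: "emeasure (P T) {y \<in> space (P T). y(k := t) \<in> C} = (\<integral>\<^sup>+y. indicator C (y(k := t)) \<partial>P T)"
      if "t \<in> space M" for t
    proof -
      have "(\<integral>\<^sup>+y. indicator C (y(k := t)) \<partial>P T)
          = (\<integral>\<^sup>+y. indicator {y \<in> space (P T). y(k := t) \<in> C} y \<partial>P T)"
        by (intro nn_integral_cong) (auto simp: indicator_def)
      then show ?thesis using st[OF that] by simp
    qed
    have "(\<lambda>t. \<integral>\<^sup>+y. indicator C (y(k := t)) \<partial>P T) \<in> borel_measurable M"
      by (intro PS.borel_measurable_nn_integral) (use measurable_pair_swap[OF m] in simp)
    then show "(\<lambda>t. emeasure (P T) {y \<in> space (P T). y(k := t) \<in> C}) \<in> borel_measurable M"
      by (subst measurable_cong[OF eq])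
    have "emeasure (P (insert k T)) C = (\<integral>\<^sup>+x. indicator C x \<partial>P (insert k T))" using T(3) by simp
    also have "\<dots> = (\<integral>\<^sup>+t. \<integral>\<^sup>+y. indicator C (y(k := t)) \<partial>P T \<partial>M)"
      using nn_integral_slice(2)[of "insert k T" k "indicator C"] T Tk by simp
    also have "\<dots> = (\<integral>\<^sup>+t. emeasure (P T) {y \<in> space (P T). y(k := t) \<in> C} \<partial>M)"
      by (intro nn_integral_cong) (simp add: eq)
    finally show "emeasure (P (insert k T)) C = (\<integral>\<^sup>+t. emeasure (P T) {y \<in> space (P T). y(k := t) \<in> C} \<partial>M)" .
  qed
  have slice_m: "integrable M (\<lambda>t. measure (P T) {y \<in> space (P T). y(k := t) \<in> C})
      \<and> measure (P (insert k T)) C = (\<integral>t. measure (P T) {y \<in> space (P T). y(k := t) \<in> C} \<partial>M)"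
    if T: "finite T" "k \<notin> T" "C \<in> sets (P (insert k T))" for T C
  proof -
    obtain t0 where t0: "t0 \<in> space M" using not_empty by auto
    have m: "(\<lambda>t. measure (P T) {y \<in> space (P T). y(k := t) \<in> C}) \<in> borel_measurable M"
      using slice_meas[OF T t0] by (simp add: measure_def)
    then have i: "integrable M (\<lambda>t. measure (P T) {y \<in> space (P T). y(k := t) \<in> C})"
      by (intro integrable_const_bound[where B=1]) auto
    have "ennreal (measure (P (insert k T)) C) = (\<integral>\<^sup>+t. ennreal (measure (P T) {y \<in> space (P T). y(k := t) \<in> C}) \<partial>M)"
      using slice_int[OF T t0] by (simp add: PS.emeasure_eq_measure)
    also have "\<dots> = ennreal (\<integral>t. measure (P T) {y \<in> space (P T). y(k := t) \<in> C} \<partial>M)"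
      using i by (intro nn_integral_eq_integral) auto
    finally show ?thesis using i by (simp add: integral_nonneg_AE)
  qed
  have A: "A \<in> sets (P (insert k S))" by fact
  have Bk: "B k \<in> sets (P S)" using insert.prems(2)[of k] Sk by simp
  have Bj: "B j \<in> sets (P (insert k (S - {j})))" if "j \<in> S" for j
    using insert.prems(2)[of j] Sj[OF that] that by simp
  have key: "measure (P S) (At t) ^ card S \<le> measure (P S) (B k) * (\<Prod>j\<in>S. measure (P (S - {j})) (Bt j t))"
    if t: "t \<in> space M" for t
  proof (cases "At t = {}")
    case True
    then show ?thesis using cS by (simp add: prod_nonneg power_0_left)
  next
    case False
    have sA: "At t \<in> sets (P S)" unfolding At_def using slice_sets[OF fin kS A t] .
    have sB: "Bt j t \<in> sets (P (S - {j}))" if "j \<in> S" for j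
      unfolding Bt_def using slice_sets[OF _ _ Bj[OF that] t] fin kS by simp
    have mem: "y(j := undefined) \<in> Bt j t" if y: "y \<in> At t" and j: "j \<in> S" for y j
    proof -
      have "y \<in> space (P S)" and "y(k := t) \<in> A" using y by (auto simp: At_def)
      moreover from this(2) have "(y(k := t))(j := undefined) \<in> B j" by (rule insert.prems(3)) (simp add: j)
      moreover have "(y(k := t))(j := undefined) = (y(j := undefined))(k := t)"
        using j kS by (intro fun_upd_twist) auto
      ultimately show ?thesis
        using j by (auto simp: Bt_def space_PiM PiE_iff extensional_def)
    qed
    have "At t \<subseteq> B k"
    proof
      fix y assume y: "y \<in> At t"
      then have "y \<in> space (P S)" and "y(k := t) \<in> A" by (auto simp: At_def)
      moreover from this(2) have "(y(k := t))(k := undefined) \<in> B k" by (rule insert.prems(3)) simp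
      moreover have "y(k := undefined) = y"
        using \<open>y \<in> space (P S)\<close> kS by (auto simp: space_PiM PiE_iff extensional_def)
      ultimately show "y \<in> B k" by simp
    qed
    then have 1: "measure (P S) (At t) \<le> measure (P S) (B k)" using Bk by (intro PS.finite_measure_mono)
    have 2: "measure (P S) (At t) ^ (card S - 1) \<le> (\<Prod>j\<in>S. measure (P (S - {j})) (Bt j t))"
      by (rule insert.IH[OF sA sB mem False])
    have "measure (P S) (At t) ^ card S = measure (P S) (At t) * measure (P S) (At t) ^ (card S - 1)"
      using cS by (simp add: power_eq_if)
    also have "\<dots> \<le> measure (P S) (B k) * (\<Prod>j\<in>S. measure (P (S - {j})) (Bt j t))"
      by (intro mult_mono 1 2) auto
    finally show ?thesis .
  qed
  have iA: "integrable M (\<lambda>t. measure (P S) (At t))"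
    and mA: "measure (P (insert k S)) A = (\<integral>t. measure (P S) (At t) \<partial>M)"
    using slice_m[OF fin kS A] by (auto simp: At_def)
  have iB: "integrable M (\<lambda>t. measure (P (S - {j})) (Bt j t))"
    and mB: "measure (P (insert k S - {j})) (B j) = (\<integral>t. measure (P (S - {j})) (Bt j t) \<partial>M)" if "j \<in> S" for j
    using slice_m[OF _ _ Bj[OF that]] fin kS Sj[OF that] by (auto simp: Bt_def)
  have "(\<integral>t. measure (P S) (At t) \<partial>M) ^ card S
      \<le> measure (P S) (B k) * (\<Prod>j\<in>S. \<integral>t. measure (P (S - {j})) (Bt j t) \<partial>M)"
    by (rule integral_power_le_prod[OF fin \<open>S \<noteq> {}\<close> iB _ iA _ _ key]) auto
  also have "(\<Prod>j\<in>S. \<integral>t. measure (P (S - {j})) (Bt j t) \<partial>M) = (\<Prod>j\<in>S. measure (P (insert k S - {j})) (B j))"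
    using mB by (intro prod.cong) auto
  also have "measure (P S) (B k) * \<dots> = (\<Prod>j\<in>insert k S. measure (P (insert k S - {j})) (B j))"
    using fin kS Sk by simp
  finally show ?case using mA fin kS by simp
qed

end

section \<open>Lorentz norms and distribution functions\<close>

lemma epow_zero [simp]: "epow 0 a = 0"
  by (simp add: epow_def)

lemma epow_top [simp]: "epow \<infinity> a = \<infinity>" "epow top a = top"
  by (simp_all add: epow_def)

lemma epow_ennreal: "0 \<le> x \<Longrightarrow> epow (ennreal x) a = ennreal (x powr a)"
  by (simp add: epow_def)

lemma measurable_epow [measurable]: "(\<lambda>x. epow x a) \<in> borel_measurable borel"
  unfolding epow_def by measurable

lemma epow_mono:
  assumes "x \<le> y" "0 \<le> a" shows "epow x a \<le> epow y a"
proof (cases y)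
  case (real r)
  then obtain q where "x = ennreal q" "0 \<le> q"
    using assms(1) by (cases x) (auto simp: top_unique)
  with real assms show ?thesis by (simp add: epow_ennreal powr_mono2)
qed (auto simp: epow_def)

lemma epow_mult:
  assumes "0 \<le> c" "0 < a" shows "epow (ennreal c * x) a = ennreal (c powr a) * epow x a"
proof (cases x)
  case (real r)
  then show ?thesis using assms
    by (simp add: epow_ennreal ennreal_mult[symmetric] powr_mult)
next
  case top
  then show ?thesis using assms
    by (cases "c = 0") (auto simp: ennreal_mult_top)
qed

lemma epow_epow:
  assumes "0 < a" shows "epow (epow x a) (1 / a) = x"
  using assms by (cases x) (auto simp: epow_ennreal powr_powr)

lemma epow_epow':
  assumes "0 < a" shows "epow (epow x (1 / a)) a = x"
  using epow_epow[of "1 / a" x] assms by simp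

lemma recip_ennreal: "0 < r \<Longrightarrow> recip (ennreal r) = 1 / r"
  by (simp add: recip_def inverse_ennreal field_simps)

lemma Lp_norm_ennreal:
  "0 < p \<Longrightarrow> Lp_norm (ennreal p) M f = epow (\<integral>\<^sup>+x. epow (f x) p \<partial>M) (1 / p)"
  by (simp add: Lp_norm_def recip_ennreal)

lemma nn_integral_powr_from_0:
  assumes "0 < a" "0 \<le> L"
  shows "(\<integral>\<^sup>+t. ennreal (a * t powr (a - 1)) * indicator {0<..<L} t \<partial>lborel) = ennreal (L powr a)"
proof -
  have "((\<lambda>t. a * t powr (a - 1)) has_integral a * (L powr (a - 1 + 1) / (a - 1 + 1))) {0..L}"
    by (intro has_integral_mult_right has_integral_powr_from_0) (use assms in auto)
  then have "(\<integral>\<^sup>+t. ennreal (a * t powr (a - 1)) * indicator {0..L} t \<partial>lborel) = ennreal (L powr a)"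
    using assms by (subst nn_integral_has_integral_lebesgue') auto
  moreover have "(\<integral>\<^sup>+t. ennreal (a * t powr (a - 1)) * indicator {0<..<L} t \<partial>lborel)
      = (\<integral>\<^sup>+t. ennreal (a * t powr (a - 1)) * indicator {0..L} t \<partial>lborel)"
  proof (rule nn_integral_cong_AE)
    have "AE t in lborel. t \<noteq> 0" "AE t in lborel. t \<noteq> L" by (rule AE_lborel_singleton)+
    then show "AE t in lborel. ennreal (a * t powr (a - 1)) * indicator {0<..<L} t
        = ennreal (a * t powr (a - 1)) * indicator {0..L} t"
      by eventually_elim (auto simp: indicator_def)
  qed
  ultimately show ?thesis by simp
qed

text \<open>The layer cake formula for a single value; it also holds for \<open>x = \<infinity>\<close>, which is what makes the
  distribution formula below valid for functions with infinite values.\<close>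
lemma epow_eq_nn_integral:
  assumes "0 < a"
  shows "epow x a = (\<integral>\<^sup>+s. ennreal (a * s powr (a - 1)) * indicator {s. 0 < s \<and> ennreal s < x} s \<partial>lborel)"
proof (cases x)
  case (real r)
  have "{s. 0 < s \<and> ennreal s < x} = {0<..<r}" using real by (auto simp: ennreal_less_iff)
  then show ?thesis using nn_integral_powr_from_0[OF assms real(1)] real by (simp add: epow_ennreal)
next
  case top
  have *: "{s. 0 < s \<and> ennreal s < x} = {0<..}" using top by auto
  have ge: "ennreal n \<le> (\<integral>\<^sup>+s. ennreal (a * s powr (a - 1)) * indicator {0<..} s \<partial>lborel)" for n :: nat
  proof -
    define L where "L = real n powr (1 / a)"
    have "ennreal n = ennreal (L powr a)" using assms by (simp add: L_def powr_powr)
    also have "\<dots> = (\<integral>\<^sup>+s. ennreal (a * s powr (a - 1)) * indicator {0<..<L} s \<partial>lborel)"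
      using assms by (simp add: nn_integral_powr_from_0 L_def)
    also have "\<dots> \<le> (\<integral>\<^sup>+s. ennreal (a * s powr (a - 1)) * indicator {0<..} s \<partial>lborel)"
      by (intro nn_integral_mono) (auto simp: indicator_def)
    finally show ?thesis .
  qed
  have "(\<integral>\<^sup>+s. ennreal (a * s powr (a - 1)) * indicator {0<..} s \<partial>lborel) = top"
  proof (rule ccontr)
    assume "(\<integral>\<^sup>+s. ennreal (a * s powr (a - 1)) * indicator {0<..} s \<partial>lborel) \<noteq> top"
    then obtain r where r: "0 \<le> r" "(\<integral>\<^sup>+s. ennreal (a * s powr (a - 1)) * indicator {0<..} s \<partial>lborel) = ennreal r"
      by (cases "\<integral>\<^sup>+s. ennreal (a * s powr (a - 1)) * indicator {0<..} s \<partial>lborel") auto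
    obtain n where "r < real n" using reals_Archimedean2 by blast
    moreover have "ennreal n \<le> ennreal r" using ge[of n] r by simp
    ultimately show False using r by simp
  qed
  then show ?thesis using top unfolding * by simp
qed

lemma distr_fun_antimono:
  assumes "f \<in> borel_measurable M" "s \<le> t" shows "distr_fun M f t \<le> distr_fun M f s"
  unfolding distr_fun_def using assms(1) ennreal_leI[OF assms(2)]
  by (intro emeasure_mono) (auto intro: le_less_trans)

lemma (in finite_measure) measurable_distr_fun:
  assumes "f \<in> borel_measurable M" shows "distr_fun M f \<in> borel_measurable borel"
proof -
  have "mono (\<lambda>s. - measure M {x \<in> space M. f x > ennreal s})"
    using assms
    by (intro monoI le_imp_neg_le finite_measure_mono) (auto intro: le_less_trans ennreal_leI)
  then have "(\<lambda>s. - measure M {x \<in> space M. f x > ennreal s}) \<in> borel_measurable borel"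
    by (rule borel_measurable_mono)
  then have "(\<lambda>s. ennreal (- (- measure M {x \<in> space M. f x > ennreal s}))) \<in> borel_measurable borel"
    by measurable
  then show ?thesis by (simp add: distr_fun_def[abs_def] emeasure_eq_measure)
qed

text \<open>Superlevel sets of the rearrangement are intervals with the lengths of the superlevel sets of \<open>f\<close>. The
  strict inequality on the left needs right continuity of the distribution function.\<close>
lemma (in finite_measure) less_rearrangement_iff:
  assumes f: "f \<in> borel_measurable M" and s: "0 \<le> s"
  shows "ennreal s < rearrangement M f t \<longleftrightarrow> ennreal t < distr_fun M f s"
proof
  assume "ennreal s < rearrangement M f t"
  then show "ennreal t < distr_fun M f s"
  proof (rule contrapos_pp)
    assume "\<not> ennreal t < distr_fun M f s"
    then have "ennreal s \<in> {ennreal s | s. 0 \<le> s \<and> distr_fun M f s \<le> ennreal t}" using s by auto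
    then have "rearrangement M f t \<le> ennreal s" unfolding rearrangement_def by (rule Inf_lower)
    then show "\<not> ennreal s < rearrangement M f t" by simp
  qed
next
  assume t: "ennreal t < distr_fun M f s"
  have "(\<lambda>i. distr_fun M f (s + inverse (Suc i))) \<longlonglongrightarrow> emeasure M (\<Union>i. {x \<in> space M. f x > ennreal (s + inverse (Suc i))})"
    unfolding distr_fun_def
  proof (rule Lim_emeasure_incseq)
    show "range (\<lambda>i. {x \<in> space M. f x > ennreal (s + inverse (Suc i))}) \<subseteq> sets M"
      using f by auto
    show "incseq (\<lambda>i. {x \<in> space M. f x > ennreal (s + inverse (Suc i))})"
    proof (rule incseq_SucI, rule subsetI)
      fix i x assume "x \<in> {x \<in> space M. f x > ennreal (s + inverse (Suc i))}"
      moreover have "ennreal (s + inverse (Suc (Suc i))) \<le> ennreal (s + inverse (Suc i))"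
        by (intro ennreal_leI) (simp add: field_simps)
      ultimately show "x \<in> {x \<in> space M. f x > ennreal (s + inverse (Suc (Suc i)))}"
        by auto
    qed
  qed
  also have "(\<Union>i. {x \<in> space M. f x > ennreal (s + inverse (Suc i))}) = {x \<in> space M. f x > ennreal s}"
  proof (intro antisym subsetI)
    fix x assume "x \<in> {x \<in> space M. f x > ennreal s}"
    then have x: "x \<in> space M" "ennreal s < f x" by auto
    obtain r where r: "ennreal s < ennreal r" "ennreal r < f x" "0 \<le> r"
    proof -
      obtain y where y: "ennreal s < y" "y < f x" using dense[OF x(2)] by blast
      then have "y \<noteq> top" by auto
      then show ?thesis using y that[of "enn2real y"] by (simp add: less_top)
    qed
    then have "s < r" using s by (simp add: ennreal_less_iff)
    then obtain i where "inverse (Suc i) < r - s" using reals_Archimedean[of "r - s"] by auto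
    then have "ennreal (s + inverse (Suc i)) \<le> ennreal r" by (intro ennreal_leI) simp
    then have "ennreal (s + inverse (Suc i)) < f x" using r(2) by (rule le_less_trans)
    then show "x \<in> (\<Union>i. {x \<in> space M. f x > ennreal (s + inverse (Suc i))})" using x(1) by blast
  next
    fix x assume "x \<in> (\<Union>i. {x \<in> space M. f x > ennreal (s + inverse (Suc i))})"
    then obtain i where "x \<in> space M" "f x > ennreal (s + inverse (Suc i))" by auto
    moreover have "ennreal s \<le> ennreal (s + inverse (Suc i))" by (intro ennreal_leI) simp
    ultimately show "x \<in> {x \<in> space M. f x > ennreal s}" by auto
  qed
  finally have "(\<lambda>i. distr_fun M f (s + inverse (Suc i))) \<longlonglongrightarrow> distr_fun M f s"
    by (simp add: distr_fun_def)
  then have "eventually (\<lambda>i. ennreal t < distr_fun M f (s + inverse (Suc i))) sequentially"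
    using t by (rule order_tendstoD)
  then obtain i where i: "ennreal t < distr_fun M f (s + inverse (Suc i))"
    by (auto simp: eventually_sequentially)
  define s' where "s' = s + inverse (Suc i)"
  have s': "s < s'" by (simp add: s'_def)
  have "ennreal s' \<le> rearrangement M f t"
    unfolding rearrangement_def
  proof (rule Inf_greatest, clarify)
    fix r :: real assume r: "0 \<le> r" "distr_fun M f r \<le> ennreal t"
    have "\<not> r \<le> s'" using distr_fun_antimono[OF f, of r s'] r i unfolding s'_def by auto
    then show "ennreal s' \<le> ennreal r" by (intro ennreal_leI) simp
  qed
  moreover have "ennreal s < ennreal s'" using s s' by (simp add: ennreal_less_iff)
  ultimately show "ennreal s < rearrangement M f t" by simp
qed

lemma nn_integral_unit_interval:
  "(\<integral>\<^sup>+t. h t \<partial>lebesgue_on {0<..<1::real}) = (\<integral>\<^sup>+t. h t * indicator {0<..<1} t \<partial>lborel)"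
  by (simp add: nn_integral_restrict_space nn_integral_completion)

lemma lorentz_norm_eq:
  assumes p: "0 < p" and r: "0 < r"
  shows "lorentz_norm (ennreal r) (ennreal p) M f
    = epow (\<integral>\<^sup>+t. ennreal (t powr (p / r - 1)) * epow (rearrangement M f t) p * indicator {0<..<1} t \<partial>lborel) (1 / p)"
proof -
  have "epow (ennreal (t powr (1 / r - 1 / p)) * y) p = ennreal (t powr (p / r - 1)) * epow y p" for t y
  proof -
    have "(1 / r - 1 / p) * p = p / r - 1" using p by (simp add: field_simps)
    then show ?thesis using p by (simp add: epow_mult powr_powr)
  qed
  then show ?thesis
    using p r by (simp add: lorentz_norm_def Lp_norm_ennreal recip_ennreal nn_integral_unit_interval)
qed

text \<open>Both sides are integrals of \<open>t\<^sup>p\<^sup>/\<^sup>r\<^sup>-\<^sup>1 s\<^sup>p\<^sup>-\<^sup>1\<close> over the region between the axes and the graph of the rearrangement,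
  which is also the graph of the distribution function, so Tonelli's theorem exchanges them. A total
  mass of at most \<open>1\<close> keeps the region inside the strip \<open>t < 1\<close>.\<close>
lemma (in prob_space) lorentz_norm_distribution:
  assumes f: "f \<in> borel_measurable M" and p: "0 < p" and r: "0 < r"
  shows "lorentz_norm (ennreal r) (ennreal p) M f
    = epow (\<integral>\<^sup>+s. ennreal (r * s powr (p - 1)) * epow (distr_fun M f s) (p / r) * indicator {0<..} s \<partial>lborel) (1 / p)"
proof -
  define \<sigma> where "\<sigma> = p / r"
  have \<sigma>: "0 < \<sigma>" using p r by (simp add: \<sigma>_def)
  \<comment> \<open>the region below the graph of the distribution function, inside the strip\<close>
  define E where "E = {z :: real \<times> real. 0 < snd z \<and> snd z < 1 \<and> 0 < fst z \<and> ennreal (snd z) < distr_fun M f (fst z)}"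
  note [measurable] = measurable_distr_fun[OF f]
  have E [measurable]: "E \<in> sets (borel \<Otimes>\<^sub>M borel)"
  proof -
    have "{z \<in> space (borel \<Otimes>\<^sub>M borel). 0 < snd z \<and> snd z < 1 \<and> 0 < fst z \<and> ennreal (snd z) < distr_fun M f (fst z)}
        \<in> sets (borel \<Otimes>\<^sub>M borel)" by measurable
    then show ?thesis by (simp add: E_def space_pair_measure)
  qed
  define k where "k s t = ennreal (t powr (\<sigma> - 1)) * ennreal (p * s powr (p - 1)) * indicator E (s, t)" for s t
  have k: "case_prod k \<in> borel_measurable (lborel \<Otimes>\<^sub>M lborel)"
    unfolding k_def by measurable
  have left: "ennreal (t powr (\<sigma> - 1)) * epow (rearrangement M f t) p * indicator {0<..<1} t
      = (\<integral>\<^sup>+s. k s t \<partial>lborel)" for t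
  proof (cases "0 < t \<and> t < 1")
    case True
    have "(\<integral>\<^sup>+s. k s t \<partial>lborel) = (\<integral>\<^sup>+s. ennreal (t powr (\<sigma> - 1)) *
        (ennreal (p * s powr (p - 1)) * indicator {s. 0 < s \<and> ennreal s < rearrangement M f t} s) \<partial>lborel)"
      using True unfolding k_def E_def
      by (intro nn_integral_cong) (auto simp: indicator_def mult.assoc less_rearrangement_iff[OF f])
    also have "\<dots> = ennreal (t powr (\<sigma> - 1)) * epow (rearrangement M f t) p"
      unfolding epow_eq_nn_integral[OF p] by (rule nn_integral_cmult) measurable
    finally show ?thesis using True by simp
  next
    case False
    then have "k s t = 0" for s by (auto simp: k_def E_def)
    then show ?thesis using False by auto
  qed
  have right: "(\<integral>\<^sup>+t. k s t \<partial>lborel)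
      = ennreal (r * s powr (p - 1)) * epow (distr_fun M f s) \<sigma> * indicator {0<..} s" for s
  proof (cases "0 < s")
    case True
    define l where "l = measure M {x \<in> space M. f x > ennreal s}"
    have l: "distr_fun M f s = ennreal l" "0 \<le> l" "l \<le> 1"
      by (simp_all add: l_def distr_fun_def emeasure_eq_measure)
    have "(\<integral>\<^sup>+t. k s t \<partial>lborel) = (\<integral>\<^sup>+t. ennreal (r * s powr (p - 1)) *
        (ennreal (\<sigma> * t powr (\<sigma> - 1)) * indicator {0<..<l} t) \<partial>lborel)"
    proof (rule nn_integral_cong)
      fix t
      have "indicator E (s, t) = (indicator {0<..<l} t :: ennreal)"
        using True l by (auto simp: E_def indicator_def ennreal_less_iff)
      moreover have "ennreal (t powr (\<sigma> - 1)) * ennreal (p * s powr (p - 1))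
          = ennreal (r * s powr (p - 1)) * ennreal (\<sigma> * t powr (\<sigma> - 1))"
        using p r \<sigma> by (simp add: ennreal_mult[symmetric] \<sigma>_def mult_ac)
      ultimately show "k s t = ennreal (r * s powr (p - 1)) * (ennreal (\<sigma> * t powr (\<sigma> - 1)) * indicator {0<..<l} t)"
        by (simp add: k_def mult.assoc)
    qed
    also have "\<dots> = ennreal (r * s powr (p - 1)) * ennreal (l powr \<sigma>)"
      by (simp add: nn_integral_cmult nn_integral_powr_from_0 \<sigma> l)
    finally show ?thesis using True l by (simp add: epow_ennreal)
  next
    case False
    then have "k s t = 0" for t by (auto simp: k_def E_def)
    then show ?thesis using False by simp
  qed
  have "(\<integral>\<^sup>+t. \<integral>\<^sup>+s. k s t \<partial>lborel \<partial>lborel) = (\<integral>\<^sup>+s. \<integral>\<^sup>+t. k s t \<partial>lborel \<partial>lborel)"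
    by (rule lborel_pair.Fubini'[OF k])
  then show ?thesis
    unfolding lorentz_norm_eq[OF p r] left[symmetric] right[symmetric, unfolded \<sigma>_def] \<sigma>_def[symmetric]
    by (simp add: left right)
qed

section \<open>Smooth functions of one variable with compact support\<close>

definition smooth :: "(real \<Rightarrow> real) \<Rightarrow> bool" where
  "smooth f \<longleftrightarrow> (\<forall>m t. (deriv ^^ m) f differentiable (at t))"

lemma smooth_deriv: "smooth f \<Longrightarrow> smooth (deriv f)"
  unfolding smooth_def by (metis funpow_Suc_right comp_apply)

lemma smooth_has_deriv: "smooth f \<Longrightarrow> (f has_real_derivative deriv f t) (at t)"
  unfolding smooth_def using DERIV_deriv_iff_real_differentiable by (metis funpow_0)

lemma smooth_continuous: "smooth f \<Longrightarrow> isCont f t"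
  using smooth_has_deriv DERIV_isCont by blast

text \<open>A set of functions in which every member has a derivative consists of smooth functions. This avoids
  explicit formulas for higher derivatives.\<close>
lemma smooth_coinduct:
  assumes "f \<in> F" and step: "\<And>g. g \<in> F \<Longrightarrow> \<exists>g'\<in>F. \<forall>t. (g has_real_derivative g' t) (at t)"
  shows "smooth f"
proof -
  have "(deriv ^^ m) f \<in> F" for m
  proof (induction m)
    case 0 show ?case using assms(1) by simp
  next
    case (Suc m)
    obtain g' where g': "g' \<in> F" "\<And>t. ((deriv ^^ m) f has_real_derivative g' t) (at t)"
      using step[OF Suc] by auto
    then have "deriv ((deriv ^^ m) f) = g'" by (auto intro: DERIV_imp_deriv)
    then show ?case using g'(1) by simp
  qed
  then show ?thesis unfolding smooth_def using step real_differentiable_def by metis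
qed

lemma smooth_antiderivative:
  assumes "smooth f" "\<And>t. (F has_real_derivative f t) (at t)"
  shows "smooth F"
proof (rule smooth_coinduct)
  show "F \<in> insert F (range (\<lambda>m. (deriv ^^ m) f))" by simp
  fix g assume "g \<in> insert F (range (\<lambda>m. (deriv ^^ m) f))"
  then consider "g = F" | m where "g = (deriv ^^ m) f" by auto
  then show "\<exists>g'\<in>insert F (range (\<lambda>m. (deriv ^^ m) f)). \<forall>t. (g has_real_derivative g' t) (at t)"
  proof cases
    case 1
    have "f \<in> range (\<lambda>m. (deriv ^^ m) f)" by (rule range_eqI[of _ _ 0]) simp
    then show ?thesis using 1 assms(2) by blast
  next
    case (2 m)
    have "(g has_real_derivative (deriv ^^ Suc m) f t) (at t)" for t
      using assms(1) 2 by (simp add: smooth_def DERIV_deriv_iff_real_differentiable)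
    then show ?thesis by blast
  qed
qed

text \<open>The functions \<open>t\<^sup>-\<^sup>k exp (-\<mu>/t)\<close>, extended by \<open>0\<close> to \<open>t \<le> 0\<close>. The powers of \<open>t\<close> are included
  so that the linear span of the family is closed under differentiation.\<close>
definition flat_exp :: "real \<Rightarrow> nat \<Rightarrow> real \<Rightarrow> real" where
  "flat_exp \<mu> k t = (if t > 0 then exp (- \<mu> / t) / t ^ k else 0)"

lemma tendsto_flat_exp_0:
  assumes "0 < \<mu>" shows "(flat_exp \<mu> k \<longlongrightarrow> 0) (at 0)"
proof -
  have lim: "((\<lambda>t. exp (- \<mu> / t) / t ^ k) \<longlongrightarrow> 0) (at_right 0)"
  proof -
    have "filterlim (\<lambda>t. \<mu> / t) at_top (at_right (0::real))"
      using assms by real_asymp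
    from filterlim_compose[OF tendsto_power_div_exp_0 this, of k]
    have "((\<lambda>t. (\<mu> / t) ^ k / exp (\<mu> / t)) \<longlongrightarrow> 0) (at_right 0)" .
    from tendsto_mult_left[OF this, of "1 / \<mu> ^ k"]
    have "((\<lambda>t. 1 / \<mu> ^ k * ((\<mu> / t) ^ k / exp (\<mu> / t))) \<longlongrightarrow> 0) (at_right 0)"
      by simp
    moreover have "(\<lambda>t. 1 / \<mu> ^ k * ((\<mu> / t) ^ k / exp (\<mu> / t))) = (\<lambda>t. exp (- \<mu> / t) / t ^ k)"
      using assms by (auto simp: fun_eq_iff power_divide exp_minus field_simps)
    ultimately show ?thesis by simp
  qed
  have "(flat_exp \<mu> k \<longlongrightarrow> 0) (at_right 0)"
    by (rule Lim_transform_eventually[OF lim])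
      (auto simp: flat_exp_def eventually_at_right_field intro: exI[of _ 1])
  moreover have "(flat_exp \<mu> k \<longlongrightarrow> 0) (at_left 0)"
    by (rule Lim_transform_eventually[OF tendsto_const])
      (auto simp: flat_exp_def eventually_at_left_field intro: exI[of _ "-1"])
  ultimately show ?thesis by (simp add: filterlim_split_at)
qed

lemma has_real_derivative_flat_exp:
  assumes "0 < \<mu>"
  shows "(flat_exp \<mu> k has_real_derivative \<mu> * flat_exp \<mu> (k + 2) t - k * flat_exp \<mu> (k + 1) t) (at t)"
proof (cases t "0 :: real" rule: linorder_cases)
  case less
  have "((\<lambda>_. 0) has_real_derivative 0) (at t)" by simp
  then have "(flat_exp \<mu> k has_real_derivative 0) (at t)"
    by (rule DERIV_cong_ev[OF refl _ refl, THEN iffD1, rotated])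
      (use less in \<open>auto simp: flat_exp_def eventually_nhds intro!: exI[of _ "{..<0}"]\<close>)
  then show ?thesis using less by (simp add: flat_exp_def)
next
  case equal
  have "((\<lambda>h. (flat_exp \<mu> k (0 + h) - flat_exp \<mu> k 0) / h) \<longlongrightarrow> 0) (at 0)"
    by (rule Lim_transform_eventually[OF tendsto_flat_exp_0[OF assms, of "k + 1"]])
      (auto simp: flat_exp_def eventually_at intro!: exI[of _ 1])
  then have "(flat_exp \<mu> k has_real_derivative 0) (at 0)" by (simp add: DERIV_def)
  then show ?thesis using equal by (simp add: flat_exp_def)
next
  case greater
  have "((\<lambda>t. exp (- \<mu> / t) * inverse (t ^ k)) has_real_derivative
      (exp (- \<mu> / t) * (\<mu> / t ^ 2)) * inverse (t ^ k) + exp (- \<mu> / t) * (- (inverse (t ^ k) * (real k * t ^ (k - Suc 0)) * inverse (t ^ k)))) (at t)"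
    using greater by (auto intro!: derivative_eq_intros simp: power2_eq_square)
  moreover have "(exp (- \<mu> / t) * (\<mu> / t ^ 2)) * inverse (t ^ k) + exp (- \<mu> / t) * (- (inverse (t ^ k) * (real k * t ^ (k - Suc 0)) * inverse (t ^ k)))
      = \<mu> * flat_exp \<mu> (k + 2) t - k * flat_exp \<mu> (k + 1) t"
    using greater by (cases k) (auto simp: flat_exp_def field_simps power2_eq_square)
  ultimately have "((\<lambda>t. exp (- \<mu> / t) * inverse (t ^ k)) has_real_derivative
      \<mu> * flat_exp \<mu> (k + 2) t - k * flat_exp \<mu> (k + 1) t) (at t)" by simp
  then show ?thesis
    by (rule DERIV_cong_ev[OF refl _ refl, THEN iffD1, rotated])
      (use greater in \<open>auto simp: flat_exp_def eventually_nhds field_simps intro!: exI[of _ "{0<..}"]\<close>)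
qed

text \<open>The algebra generated by the \<open>flat_exp\<close> functions, shifted and reflected. It is closed under
  differentiation, hence smooth by coinduction.\<close>
inductive_set bump_algebra :: "real \<Rightarrow> (real \<Rightarrow> real) set" for \<mu> where
  const: "(\<lambda>_. a) \<in> bump_algebra \<mu>"
| flat: "(\<lambda>t. flat_exp \<mu> k (s * t + a)) \<in> bump_algebra \<mu>"
| add: "f \<in> bump_algebra \<mu> \<Longrightarrow> g \<in> bump_algebra \<mu> \<Longrightarrow> (\<lambda>t. f t + g t) \<in> bump_algebra \<mu>"
| mult: "f \<in> bump_algebra \<mu> \<Longrightarrow> g \<in> bump_algebra \<mu> \<Longrightarrow> (\<lambda>t. f t * g t) \<in> bump_algebra \<mu>"

lemma smooth_bump_algebra:
  assumes "0 < \<mu>" "f \<in> bump_algebra \<mu>" shows "smooth f"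
  using assms(2)
proof (rule smooth_coinduct)
  fix g assume "g \<in> bump_algebra \<mu>"
  then show "\<exists>g'\<in>bump_algebra \<mu>. \<forall>t. (g has_real_derivative g' t) (at t)"
  proof induction
    case (const a)
    show ?case by (rule bexI[of _ "\<lambda>_. 0"]) (auto intro: bump_algebra.const)
  next
    case (flat k s a)
    let ?g = "\<lambda>t. (\<mu> * flat_exp \<mu> (k + 2) (s * t + a) + (- real k) * flat_exp \<mu> (k + 1) (s * t + a)) * s"
    have "?g \<in> bump_algebra \<mu>" by (intro bump_algebra.intros)
    moreover have "((\<lambda>t. flat_exp \<mu> k (s * t + a)) has_real_derivative ?g t) (at t)" for t
    proof -
      have "((\<lambda>t. s * t + a) has_real_derivative s) (at t)" by (auto intro!: derivative_eq_intros)
      from DERIV_chain2[OF has_real_derivative_flat_exp[OF assms(1)] this]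
      show ?thesis by simp
    qed
    ultimately show ?case by (intro bexI[of _ ?g] allI)
  next
    case (add f g)
    then obtain f' g' where "f' \<in> bump_algebra \<mu>" "g' \<in> bump_algebra \<mu>"
      and d: "\<And>t. (f has_real_derivative f' t) (at t)" "\<And>t. (g has_real_derivative g' t) (at t)" by blast
    then have "(\<lambda>t. f' t + g' t) \<in> bump_algebra \<mu>" by (intro bump_algebra.intros)
    then show ?case by (rule bexI[rotated]) (auto intro: DERIV_add d)
  next
    case (mult f g)
    then obtain f' g' where "f' \<in> bump_algebra \<mu>" "g' \<in> bump_algebra \<mu>"
      and d: "\<And>t. (f has_real_derivative f' t) (at t)" "\<And>t. (g has_real_derivative g' t) (at t)" by blast
    then have "(\<lambda>t. f' t * g t + g' t * f t) \<in> bump_algebra \<mu>" using mult by (intro bump_algebra.intros)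
    then show ?case by (rule bexI[rotated]) (auto intro: DERIV_mult d)
  qed
qed

text \<open>A bump supported in \<open>{a..b}\<close>; it vanishes identically if \<open>b \<le> a\<close>, so that no case distinction
  on the end points is needed later. It tends to \<open>1\<close> inside as \<open>\<mu>\<close> tends to \<open>0\<close>.\<close>
definition bump :: "real \<Rightarrow> real \<Rightarrow> real \<Rightarrow> real \<Rightarrow> real" where
  "bump \<mu> a b t = flat_exp \<mu> 0 (t - a) * flat_exp \<mu> 0 (b - t)"

lemma bump_in_algebra: "bump \<mu> a b \<in> bump_algebra \<mu>"
proof -
  have "(\<lambda>t. flat_exp \<mu> 0 (1 * t + - a) * flat_exp \<mu> 0 (- 1 * t + b)) \<in> bump_algebra \<mu>"
    by (intro bump_algebra.intros)
  then show ?thesis by (simp add: bump_def[abs_def])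
qed

lemma bump_bounds: "0 < \<mu> \<Longrightarrow> 0 \<le> bump \<mu> a b t" "0 < \<mu> \<Longrightarrow> bump \<mu> a b t \<le> 1"
  by (auto simp: bump_def flat_exp_def intro!: mult_le_one)

lemma bump_eq_0: "\<not> (a < t \<and> t < b) \<Longrightarrow> bump \<mu> a b t = 0"
  by (auto simp: bump_def flat_exp_def)

text \<open>These increase with \<open>m\<close> to the indicator of \<open>{c<..<min b (c + 1)}\<close>, since both the exponent and the
  distance to the end points shrink.\<close>
definition cutoff :: "real \<Rightarrow> real \<Rightarrow> nat \<Rightarrow> real \<Rightarrow> real" where
  "cutoff c b m = bump (inverse (Suc m)) (c + inverse (Suc m)) (min b (c + 1 - inverse (Suc m)))"

lemma tendsto_cutoff:
  assumes t: "c < t" "t < c + 1"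
  shows "(\<lambda>m. cutoff c b m t) \<longlonglongrightarrow> indicator {..<b} t"
proof (cases "t < b")
  case False
  then have "cutoff c b m t = 0" for m
    unfolding cutoff_def by (intro bump_eq_0) auto
  then show ?thesis using False by simp
next
  case True
  define e where "e m = inverse (real (Suc m))" for m
  have e: "e \<longlonglongrightarrow> 0" unfolding e_def by (rule LIMSEQ_inverse_real_of_nat)
  have flat: "(\<lambda>m. flat_exp (e m) 0 (x m)) \<longlonglongrightarrow> 1" if x: "x \<longlonglongrightarrow> l" "0 < l" for x l
  proof (rule Lim_transform_eventually)
    show "eventually (\<lambda>m. exp (- e m / x m) = flat_exp (e m) 0 (x m)) sequentially"
      using order_tendstoD(1)[OF x] by eventually_elim (simp add: flat_exp_def)
    have "(\<lambda>m. exp (- e m / x m)) \<longlonglongrightarrow> exp (- 0 / l)"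
      using x e by (intro tendsto_intros) auto
    then show "(\<lambda>m. exp (- e m / x m)) \<longlonglongrightarrow> 1" by simp
  qed
  have "(\<lambda>m. t - (c + e m)) \<longlonglongrightarrow> t - (c + 0)" by (intro tendsto_intros e)
  then have "(\<lambda>m. flat_exp (e m) 0 (t - (c + e m))) \<longlonglongrightarrow> 1"
    by (rule flat) (use t in simp)
  moreover have "(\<lambda>m. min b (c + 1 - e m) - t) \<longlonglongrightarrow> min b (c + 1 - 0) - t" by (intro tendsto_intros e)
  then have "(\<lambda>m. flat_exp (e m) 0 (min b (c + 1 - e m) - t)) \<longlonglongrightarrow> 1"
    by (rule flat) (use t True in simp)
  ultimately have "(\<lambda>m. flat_exp (e m) 0 (t - (c + e m)) * flat_exp (e m) 0 (min b (c + 1 - e m) - t)) \<longlonglongrightarrow> 1 * 1"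
    by (rule tendsto_mult)
  then show ?thesis using True by (simp add: cutoff_def bump_def e_def)
qed

text \<open>The one-dimensional test functions on \<open>{c<..<c + 1}\<close>, with a distance \<open>d\<close> from the end points in place
  of a compact support.\<close>
definition tests :: "real \<Rightarrow> (real \<Rightarrow> real) set" where
  "tests c = {\<theta>. smooth \<theta> \<and> (\<exists>d>0. \<forall>t. \<not> (c + d \<le> t \<and> t \<le> c + 1 - d) \<longrightarrow> \<theta> t = 0)}"

lemma cutoff_in_tests: "cutoff c b m \<in> tests c"
proof -
  have "smooth (cutoff c b m)"
    unfolding cutoff_def by (rule smooth_bump_algebra[OF _ bump_in_algebra]) simp
  moreover have "cutoff c b m t = 0" if "\<not> (c + inverse (Suc m) \<le> t \<and> t \<le> c + 1 - inverse (Suc m))" for t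
    unfolding cutoff_def using that by (intro bump_eq_0) auto
  ultimately show ?thesis unfolding tests_def by (auto intro!: exI[of _ "inverse (real (Suc m))"])
qed

lemma smooth_cutoff_combination: "smooth (\<lambda>t. p * cutoff c b m t - q * cutoff c b' m t)"
proof -
  have "(\<lambda>t. p * cutoff c b m t + (- q) * cutoff c b' m t) \<in> bump_algebra (inverse (Suc m))"
    unfolding cutoff_def by (intro bump_algebra.intros bump_in_algebra)
  from smooth_bump_algebra[OF _ this] show ?thesis by simp
qed

lemma cutoff_bounds: "0 \<le> cutoff c b m t" "cutoff c b m t \<le> 1"
  unfolding cutoff_def by (auto intro: bump_bounds)

lemma tests_measurable: "\<theta> \<in> tests c \<Longrightarrow> \<theta> \<in> borel_measurable borel"
  by (intro borel_measurable_continuous_onI continuous_at_imp_continuous_on)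
    (auto simp: tests_def smooth_continuous)

section \<open>Absolute continuity on lines\<close>

lemma integrable_mult_bounded:
  fixes f h :: "'a \<Rightarrow> real"
  assumes "integrable N f" "h \<in> borel_measurable N" "\<And>x. x \<in> space N \<Longrightarrow> \<bar>h x\<bar> \<le> D"
  shows "integrable N (\<lambda>x. f x * h x)"
proof (rule Bochner_Integration.integrable_bound)
  show "integrable N (\<lambda>x. f x * D)" using assms(1) by simp
  show "(\<lambda>x. f x * h x) \<in> borel_measurable N" using assms(1,2) by measurable
  have "\<bar>f x * h x\<bar> \<le> \<bar>f x * D\<bar>" if "x \<in> space N" for x
    unfolding abs_mult using assms(3)[OF that] by (intro mult_left_mono) auto
  then show "AE x in N. norm (f x * h x) \<le> norm (f x * D)" by auto
qed

text \<open>The side is given up to its end points, which may or may not belong to it.\<close>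
locale unit_side =
  fixes I :: "real set" and c :: real
  assumes interior_side: "{c<..<c + 1} \<subseteq> I" and side_closed: "I \<subseteq> {c..c + 1}"
begin

abbreviation J :: "real measure" where "J \<equiv> restrict_space lborel I"

lemma side_borel: "I \<in> sets borel"
proof -
  have "I = {c<..<c + 1} \<union> (I \<inter> {c, c + 1})" using interior_side side_closed by auto
  moreover have "I \<inter> {c, c + 1} \<in> sets borel" by (intro borel_closed finite_imp_closed) simp
  ultimately show ?thesis by (metis borel_open open_greaterThanLessThan sets.Un)
qed

lemma side_inter: "I \<inter> space lborel \<in> sets lborel"
  using side_borel by simp

text \<open>End points are null, so almost everywhere statements do not depend on the kind of the interval.\<close>
lemma AE_side_iff: "(AE t in J. Q t) \<longleftrightarrow> (AE t in lborel. c < t \<and> t < c + 1 \<longrightarrow> Q t)"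
proof -
  have "AE t in lborel. (t \<in> I \<longrightarrow> Q t) \<longleftrightarrow> (c < t \<and> t < c + 1 \<longrightarrow> Q t)"
  proof -
    have "AE t in lborel. t \<noteq> c" "AE t in lborel. t \<noteq> c + 1" by (rule AE_lborel_singleton)+
    then show ?thesis
      by eventually_elim (use interior_side side_closed in force)
  qed
  then show ?thesis
    unfolding AE_restrict_space_iff[OF side_inter] by (rule eventually_cong)
qed

lemma AE_side_interior: "AE t in J. c < t \<and> t < c + 1"
  by (simp add: AE_side_iff)

lemma nn_integral_side: "(\<integral>\<^sup>+t. f t \<partial>J) = (\<integral>\<^sup>+t. f t * indicator {c<..<c + 1} t \<partial>lborel)"
proof -
  have "AE t in lborel. f t * indicator I t = f t * indicator {c<..<c + 1} t"
  proof -
    have "AE t in lborel. t \<noteq> c" "AE t in lborel. t \<noteq> c + 1" by (rule AE_lborel_singleton)+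
    then show ?thesis
      by eventually_elim (use interior_side side_closed in \<open>force simp: indicator_def\<close>)
  qed
  then show ?thesis
    by (simp add: nn_integral_restrict_space[OF side_inter] cong: nn_integral_cong_AE)
qed

lemma emeasure_side: "emeasure lborel I = 1"
proof -
  have "emeasure lborel I = (\<integral>\<^sup>+t. 1 \<partial>J)"
    using side_borel by (simp add: emeasure_restrict_space)
  also have "\<dots> = (\<integral>\<^sup>+t. indicator {c<..<c + 1} t \<partial>lborel)" by (subst nn_integral_side) simp
  finally show ?thesis by simp
qed

sublocale prob_side J
proof -
  have "prob_space J"
    by (rule prob_spaceI) (use side_borel emeasure_side in \<open>simp add: emeasure_restrict_space\<close>)
  then show "prob_side J" by (simp add: prob_side_def)
qed

lemma borel_measurable_side: "f \<in> borel_measurable borel \<Longrightarrow> f \<in> borel_measurable J"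
  by (simp add: measurable_restrict_space1)

lemma integral_side: "(\<integral>t. f t \<partial>J) = (\<integral>t. indicator I t * f t \<partial>lborel)" for f :: "real \<Rightarrow> real"
  by (simp add: integral_restrict_space[OF side_inter])

lemma measurable_id_side: "(\<lambda>t. t) \<in> borel_measurable J"
  by (rule borel_measurable_side) simp

lemma integrable_segment:
  assumes g: "integrable J g" and X: "X \<in> sets borel"
  shows "integrable J (\<lambda>t. indicator X t * g t :: real)"
proof -
  have "integrable J (\<lambda>t. g t * indicator X t)"
    by (rule integrable_mult_bounded[OF g borel_measurable_side, where D = 1]) (use X in \<open>auto simp: indicator_def\<close>)
  then show ?thesis by (simp add: mult.commute)
qed

text \<open>Integration by parts for the primitive \<open>\<integral> {..<t} \<zeta>\<close>, by Fubini's theorem. There is no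
  boundary term at the right end because \<open>\<zeta>\<close> has mean zero.\<close>
lemma integral_lower_segments_by_parts:
  fixes \<gamma> \<zeta> :: "real \<Rightarrow> real"
  assumes \<gamma>: "integrable J \<gamma>" and \<zeta>: "\<zeta> \<in> borel_measurable borel" "\<And>s. \<bar>\<zeta> s\<bar> \<le> C"
    and mean: "(\<integral>s. \<zeta> s \<partial>J) = 0"
  shows "(\<integral>t. \<gamma> t * (\<integral>s. indicator {..<t} s * \<zeta> s \<partial>J) \<partial>J)
    = - (\<integral>s. \<zeta> s * (\<integral>t. indicator {..s} t * \<gamma> t \<partial>J) \<partial>J)"
proof -
  interpret JJ: pair_sigma_finite J J by unfold_locales
  note [measurable] = borel_measurable_side[OF \<zeta>(1)]
  have m\<gamma> [measurable]: "\<gamma> \<in> borel_measurable J" using \<gamma> by auto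
  note [measurable] = measurable_id_side
  define F where "F t s = \<gamma> t * ((if s < t then 1 else 0) * \<zeta> s)" for t s
  have mF [measurable]: "case_prod F \<in> borel_measurable (J \<Otimes>\<^sub>M J)"
    unfolding F_def by measurable
  have i\<zeta>: "integrable J (\<lambda>s. h s * \<zeta> s)" if h: "h \<in> borel_measurable J" "\<And>s. \<bar>h s\<bar> \<le> D" for h D
  proof (rule integrable_const_bound[where B = "D * C"])
    show "(\<lambda>s. h s * \<zeta> s) \<in> borel_measurable J" using h(1) by measurable
    show "AE s in J. norm (h s * \<zeta> s) \<le> D * C"
      using h(2) \<zeta>(2) order_trans[OF abs_ge_zero h(2)]
      by (auto simp: abs_mult intro!: mult_mono)
  qed
  have Fb: "\<bar>F t s\<bar> \<le> \<bar>\<gamma> t\<bar> * C" for t s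
    using \<zeta>(2)[of s] order_trans[OF abs_ge_zero \<zeta>(2)[of s]] by (auto simp: F_def abs_mult intro!: mult_left_mono)
  have iF: "integrable (J \<Otimes>\<^sub>M J) (case_prod F)"
  proof (rule JJ.Fubini_integrable)
    show "integrable J (\<lambda>x. LINT y|J. norm (case_prod F (x, y)))"
    proof (rule Bochner_Integration.integrable_bound[where f = "\<lambda>t. \<bar>\<gamma> t\<bar> * C"])
      show "integrable J (\<lambda>t. \<bar>\<gamma> t\<bar> * C)" using \<gamma> by simp
      show "AE x in J. norm (LINT y|J. norm (case_prod F (x, y))) \<le> norm (\<bar>\<gamma> x\<bar> * C)"
      proof (rule AE_I2)
        fix x
        have "(LINT y|J. norm (F x y)) \<le> (LINT y|J. \<bar>\<gamma> x\<bar> * C)"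
          by (rule integral_mono') (use Fb order_trans[OF abs_ge_zero Fb] in auto)
        then show "norm (LINT y|J. norm (case_prod F (x, y))) \<le> norm (\<bar>\<gamma> x\<bar> * C)"
          by (simp add: prob_space)
      qed
    qed measurable
    show "AE x in J. integrable J (\<lambda>y. case_prod F (x, y))"
    proof (rule AE_I2)
      fix x
      have "integrable J (\<lambda>s. \<gamma> x * ((if s < x then 1 else 0) * \<zeta> s))"
        by (intro integrable_mult_right i\<zeta>[of _ 1]) auto
      then show "integrable J (\<lambda>y. case_prod F (x, y))" by (simp add: F_def)
    qed
  qed measurable
  define B where "B s = (\<integral>t. indicator {..s} t * \<gamma> t \<partial>J)" for s
  have i\<gamma>: "integrable J (\<lambda>t. indicator X t * \<gamma> t)" if "X \<in> sets borel" for X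
    by (rule integrable_segment[OF \<gamma> that])
  have Bb: "\<bar>B s\<bar> \<le> (\<integral>t. \<bar>\<gamma> t\<bar> \<partial>J)" for s
  proof -
    have "\<bar>B s\<bar> \<le> (\<integral>t. \<bar>indicator {..s} t * \<gamma> t\<bar> \<partial>J)" unfolding B_def by (rule integral_abs_bound)
    also have "\<dots> \<le> (\<integral>t. \<bar>\<gamma> t\<bar> \<partial>J)"
      using \<gamma> by (intro integral_mono integrable_abs i\<gamma>) (auto simp: indicator_def)
    finally show ?thesis .
  qed
  have mB [measurable]: "B \<in> borel_measurable J"
  proof -
    have "(\<lambda>s. \<integral>t. (if t \<le> s then 1 else 0) * \<gamma> t \<partial>J) \<in> borel_measurable J" by measurable
    then show ?thesis by (simp add: B_def[abs_def] indicator_def of_bool_def)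
  qed
  have "(\<integral>t. \<gamma> t * (\<integral>s. indicator {..<t} s * \<zeta> s \<partial>J) \<partial>J) = (\<integral>t. (\<integral>s. F t s \<partial>J) \<partial>J)"
    unfolding F_def by (intro Bochner_Integration.integral_cong) (auto simp: indicator_def of_bool_def)
  also have "\<dots> = (\<integral>s. (\<integral>t. F t s \<partial>J) \<partial>J)"
    by (rule JJ.Fubini_integral[OF iF, symmetric])
  also have "\<dots> = (\<integral>s. (\<integral>t. \<gamma> t \<partial>J) * \<zeta> s - B s * \<zeta> s \<partial>J)"
  proof (rule Bochner_Integration.integral_cong)
    fix s
    have "(\<integral>t. F t s \<partial>J) = (\<integral>t. \<zeta> s * (\<gamma> t - indicator {..s} t * \<gamma> t) \<partial>J)"
      unfolding F_def by (intro Bochner_Integration.integral_cong) (auto simp: indicator_def)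
    also have "\<dots> = \<zeta> s * ((\<integral>t. \<gamma> t \<partial>J) - B s)"
      unfolding B_def by (subst integral_mult_right_zero) (simp add: Bochner_Integration.integral_diff[OF \<gamma> i\<gamma>])
    finally show "(\<integral>t. F t s \<partial>J) = (\<integral>t. \<gamma> t \<partial>J) * \<zeta> s - B s * \<zeta> s" by (simp add: algebra_simps)
  qed simp
  also have "\<dots> = - (\<integral>s. B s * \<zeta> s \<partial>J)"
    using i\<zeta>[of "\<lambda>_. \<integral>t. \<gamma> t \<partial>J" "\<bar>\<integral>t. \<gamma> t \<partial>J\<bar>"] i\<zeta>[of B, OF mB Bb] mean
    by (subst Bochner_Integration.integral_diff) auto
  finally show ?thesis by (simp add: B_def mult.commute)
qed

lemma integral_side_tests:
  assumes "\<theta> \<in> tests c" "X \<in> sets borel"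
  shows "(\<integral>t. indicator X t * \<theta> t \<partial>J) = (\<integral>t. indicator X t * \<theta> t \<partial>lborel)"
proof -
  obtain d where d: "d > 0" "\<And>t. \<not> (c + d \<le> t \<and> t \<le> c + 1 - d) \<Longrightarrow> \<theta> t = 0"
    using assms(1) by (auto simp: tests_def)
  have "indicator I t * \<theta> t = \<theta> t" for t
    using d(1) d(2)[of t] subsetD[OF interior_side, of t]
    by (cases "c + d \<le> t \<and> t \<le> c + 1 - d") (auto simp: indicator_def)
  then have "indicator I t * (indicator X t * \<theta> t) = indicator X t * \<theta> t" for t
    by (metis mult.left_commute)
  then show ?thesis by (simp only: integral_side)
qed

text \<open>The derivatives of test functions are exactly the test functions of mean zero: the primitive that
  vanishes on the left also vanishes on the right.\<close>
lemma tests_antiderivative: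
  assumes \<zeta>: "\<zeta> \<in> tests c" and mean: "(\<integral>s. \<zeta> s \<partial>J) = 0"
  obtains \<eta> where "\<eta> \<in> tests c" "deriv \<eta> = \<zeta>" "\<And>t. \<eta> t = (\<integral>s. indicator {..<t} s * \<zeta> s \<partial>J)"
proof -
  have sm: "smooth \<zeta>" using \<zeta> by (simp add: tests_def)
  obtain d where d: "d > 0" "\<And>t. \<not> (c + d \<le> t \<and> t \<le> c + 1 - d) \<Longrightarrow> \<zeta> t = 0"
    using \<zeta> by (auto simp: tests_def)
  obtain F where F: "\<And>t. (F has_real_derivative \<zeta> t) (at t)"
    using einterval_antiderivative[of "-\<infinity>" "\<infinity>" \<zeta>] smooth_continuous[OF sm]
    by (auto simp: has_real_derivative_iff_has_vector_derivative)
  define \<eta> where "\<eta> t = F t - F c" for t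
  have der: "(\<eta> has_real_derivative \<zeta> t) (at t)" for t
    unfolding \<eta>_def by (auto intro!: derivative_eq_intros F)
  have \<eta>_eq: "\<eta> t = (\<integral>s. indicator {..<t} s * \<zeta> s \<partial>J)" for t
  proof (cases "c \<le> t")
    case True
    have "\<eta> t = (\<integral>s. \<zeta> s * indicator {c..t} s \<partial>lborel)"
      unfolding \<eta>_def using integral_FTC_Icc_real[OF True F] smooth_continuous[OF sm] by simp
    also have "\<dots> = (\<integral>s. indicator {..<t} s * \<zeta> s \<partial>lborel)"
    proof (rule integral_cong_AE)
      have [measurable]: "\<zeta> \<in> borel_measurable borel"
        by (intro borel_measurable_continuous_onI continuous_at_imp_continuous_on) (use smooth_continuous[OF sm] in auto)
      show "(\<lambda>s. \<zeta> s * indicator {c..t} s) \<in> borel_measurable lborel" by measurable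
      show "(\<lambda>s. indicator {..<t} s * \<zeta> s) \<in> borel_measurable lborel" by measurable
      have "AE s in lborel. s \<noteq> t" by (rule AE_lborel_singleton)
      then show "AE s in lborel. \<zeta> s * indicator {c..t} s = indicator {..<t} s * \<zeta> s"
        by eventually_elim (use d in \<open>auto simp: indicator_def\<close>)
    qed
    finally show ?thesis by (simp add: integral_side_tests[OF \<zeta>])
  next
    case False
    have "F c - F t = (\<integral>s. \<zeta> s * indicator {t..c} s \<partial>lborel)"
      using integral_FTC_Icc_real[of t c F \<zeta>] False F smooth_continuous[OF sm] by simp
    also have "\<dots> = (\<integral>s. 0 \<partial>(lborel :: real measure))"
      by (intro Bochner_Integration.integral_cong) (use d in \<open>auto simp: indicator_def\<close>)
    finally have "\<eta> t = 0" by (simp add: \<eta>_def)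
    moreover have "(\<integral>s. indicator {..<t} s * \<zeta> s \<partial>J) = (\<integral>s. 0 \<partial>J)"
      by (intro Bochner_Integration.integral_cong) (use d False in \<open>auto simp: indicator_def\<close>)
    ultimately show ?thesis by simp
  qed
  have "\<eta> t = 0" if t: "\<not> (c + d \<le> t \<and> t \<le> c + 1 - d)" for t
  proof (cases "t < c + d")
    case True
    then have "(\<integral>s. indicator {..<t} s * \<zeta> s \<partial>J) = (\<integral>s. 0 \<partial>J)"
      by (intro Bochner_Integration.integral_cong) (use d in \<open>auto simp: indicator_def\<close>)
    then show ?thesis by (simp add: \<eta>_eq)
  next
    case False
    then have "(\<integral>s. indicator {..<t} s * \<zeta> s \<partial>J) = (\<integral>s. \<zeta> s \<partial>J)"
      using t by (intro Bochner_Integration.integral_cong) (use d in \<open>auto simp: indicator_def\<close>)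
    then show ?thesis using mean by (simp add: \<eta>_eq)
  qed
  moreover have "smooth \<eta>" by (rule smooth_antiderivative[OF sm der])
  ultimately have "\<eta> \<in> tests c" using d(1) by (auto simp: tests_def)
  moreover have "deriv \<eta> = \<zeta>" using der by (auto intro: DERIV_imp_deriv)
  ultimately show thesis using \<eta>_eq that by blast
qed

end

text \<open>Two points of \<open>I\<close> are at distance at most \<open>1\<close>, because the segment between them lies in \<open>I\<close>; so \<open>I\<close> is
  bounded and lies between its infimum and supremum, whose distance is the measure of \<open>I\<close>.\<close>
lemma unit_interval_obtain:
  assumes I: "is_interval I" and m: "emeasure lborel I = 1"
  obtains c where "unit_side I c"
proof -
  have meas: "I \<in> sets lborel"
    using I by (simp add: real_interval_borel_measurable)
  have ne: "I \<noteq> {}" using m by auto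
  have sub: "{x..y} \<subseteq> I" if "x \<in> I" "y \<in> I" for x y
    using I that unfolding is_interval_1 by (meson atLeastAtMost_iff subsetI)
  have len: "y - x \<le> 1" if "x \<in> I" "y \<in> I" for x y
  proof (cases "x \<le> y")
    case True
    have "ennreal (y - x) = emeasure lborel {x..y}" using True by simp
    also have "\<dots> \<le> 1" using emeasure_mono[OF sub[OF that] meas] m by simp
    finally show ?thesis by simp
  qed simp
  obtain x0 where x0: "x0 \<in> I" using ne by auto
  have ba: "bdd_above I" using len[OF x0] by (intro bdd_aboveI[of _ "x0 + 1"]) (force simp: algebra_simps)
  have bb: "bdd_below I" using len[OF _ x0] by (intro bdd_belowI[of _ "x0 - 1"]) (force simp: algebra_simps)
  define c where "c = Inf I"
  define d where "d = Sup I"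
  have up: "I \<subseteq> {c..d}" using ba bb by (auto simp: c_def d_def intro: cInf_lower cSup_upper)
  have low: "{c<..<d} \<subseteq> I"
  proof
    fix t assume t: "t \<in> {c<..<d}"
    obtain x where "x \<in> I" "x < t" using t cInf_less_iff[OF ne bb, of t] by (auto simp: c_def)
    moreover obtain y where "y \<in> I" "t < y" using t less_cSup_iff[OF ne ba, of t] by (auto simp: d_def)
    ultimately show "t \<in> I" using sub[of x y] by auto
  qed
  have cd: "c \<le> d" using up x0 by auto
  have "ennreal (d - c) = emeasure lborel {c<..<d}" using cd by simp
  also have "\<dots> \<le> 1" using emeasure_mono[OF low meas] m by simp
  finally have "d - c \<le> 1" by simp
  moreover have "1 \<le> emeasure lborel {c..d}" using emeasure_mono[OF up, of lborel] m by simp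
  then have "ennreal 1 \<le> ennreal (d - c)" using cd by simp
  then have "1 \<le> d - c" using cd by (subst (asm) ennreal_le_iff) auto
  ultimately have "d = c + 1" by simp
  then have "unit_side I c" using up low by unfold_locales auto
  then show thesis by (rule that)
qed

text \<open>The sets over which \<open>f\<close> has integral zero form a Dynkin system that contains an intersection-stable
  generator. So it contains all measurable sets, in particular the two on which \<open>f\<close> is positive and negative.\<close>
lemma AE_zero_if_integral_zero_on_generator:
  fixes f :: "'a \<Rightarrow> real"
  assumes f: "integrable N f"
    and G: "Int_stable G" "G \<subseteq> Pow (space N)" "sets N = sigma_sets (space N) G" "space N \<in> G"
    and zero: "\<And>X. X \<in> G \<Longrightarrow> (\<integral>x. indicator X x * f x \<partial>N) = 0"
  shows "AE x in N. f x = 0"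
proof -
  have int: "integrable N (\<lambda>x. indicator X x * f x)" if "X \<in> sets N" for X
    using integrable_mult_indicator[OF that f] by simp
  have all: "(\<integral>x. indicator X x * f x \<partial>N) = 0" if "X \<in> sigma_sets (space N) G" for X
    using G(1,2) that
  proof (induction rule: sigma_sets_induct_disjoint)
    case (basic X) then show ?case by (rule zero)
  next
    case empty then show ?case by simp
  next
    case (compl X)
    have X: "X \<in> sets N" using compl G(3) by simp
    have "(\<integral>x. indicator (space N - X) x * f x \<partial>N)
        = (\<integral>x. indicator (space N) x * f x - indicator X x * f x \<partial>N)"
      using sets.sets_into_space[OF X] by (intro Bochner_Integration.integral_cong) (auto simp: indicator_def)
    also have "\<dots> = 0"
      using zero[OF G(4)] compl by (subst Bochner_Integration.integral_diff) (auto intro: int X)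
    finally show ?case .
  next
    case (union A)
    have A: "A i \<in> sets N" for i using union.hyps(2) G(3) by auto
    have "(LINT x:(\<Union>i. A i)|N. f x) = (\<Sum>i. LINT x:A i|N. f x)"
    proof (rule lebesgue_integral_countable_add)
      show "A i \<inter> A j = {}" if "i \<noteq> j" for i j
        using union.hyps(1) that by (auto simp: disjoint_family_on_def)
      show "set_integrable N (\<Union>i. A i) f"
        unfolding set_integrable_def by (intro integrable_mult_indicator f sets.countable_UN) (use A in auto)
    qed (rule A)
    also have "\<dots> = 0" using union.IH by (simp add: set_lebesgue_integral_def)
    finally show ?case by (simp add: set_lebesgue_integral_def)
  qed
  have m [measurable]: "f \<in> borel_measurable N" using f by auto
  have "AE x in N. indicator {x \<in> space N. 0 < f x} x * f x = 0"
  proof -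
    have "{x \<in> space N. 0 < f x} \<in> sets N" by measurable
    then have "(\<integral>x. indicator {x \<in> space N. 0 < f x} x * f x \<partial>N) = 0"
      and "integrable N (\<lambda>x. indicator {x \<in> space N. 0 < f x} x * f x)"
      using all[folded G(3)] int by auto
    then show ?thesis
      by (subst (asm) integral_nonneg_eq_0_iff_AE) (auto simp: indicator_def)
  qed
  moreover have "AE x in N. indicator {x \<in> space N. f x < 0} x * - f x = 0"
  proof -
    have "(\<integral>x. indicator {x \<in> space N. f x < 0} x * - f x \<partial>N) = 0"
      using all[folded G(3), of "{x \<in> space N. f x < 0}"] by simp
    moreover have "integrable N (\<lambda>x. indicator {x \<in> space N. f x < 0} x * - f x)"
      using int[of "{x \<in> space N. f x < 0}"] by simp
    ultimately show ?thesis
      by (subst (asm) integral_nonneg_eq_0_iff_AE) (auto simp: indicator_def)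
  qed
  ultimately show ?thesis
    using AE_space by eventually_elim (auto simp: indicator_def split: if_splits)
qed

context unit_side
begin

text \<open>The primitive of \<open>g\<close> in the first variable, based at the left end point of the side.\<close>
definition lower_integral :: "(real \<times> 'y \<Rightarrow> real) \<Rightarrow> real \<times> 'y \<Rightarrow> real" where
  "lower_integral g z = (\<integral>s. indicator {..fst z} s * g (s, snd z) \<partial>J)"

text \<open>The primitive is bounded by the integral of \<open>\<bar>g\<bar>\<close> along the line. The bound is taken in \<open>[0,\<infinity>]\<close> since
  lines on which \<open>g\<close> is not integrable may exist.\<close>
lemma integrable_lower_integral:
  assumes N: "prob_space N" and g: "integrable (J \<Otimes>\<^sub>M N) g"
  shows "integrable (J \<Otimes>\<^sub>M N) (lower_integral g)"
proof -
  interpret N: prob_space N by fact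
  interpret JN: pair_sigma_finite J N by unfold_locales
  have [measurable]: "g \<in> borel_measurable (J \<Otimes>\<^sub>M N)" using g by auto
  note [measurable] = measurable_id_side
  have "(\<lambda>z. \<integral>s. (if s \<le> fst z then 1 else 0) * g (s, snd z) \<partial>J) \<in> borel_measurable (J \<Otimes>\<^sub>M N)"
    by measurable
  then have m: "lower_integral g \<in> borel_measurable (J \<Otimes>\<^sub>M N)"
    by (simp add: lower_integral_def[abs_def] indicator_def of_bool_def)
  have bound: "ennreal (norm (lower_integral g z)) \<le> (\<integral>\<^sup>+s. ennreal (norm (g (s, snd z))) \<partial>J)" for z
  proof (cases "integrable J (\<lambda>s. indicator {..fst z} s * g (s, snd z))")
    case True
    then have "ennreal (norm (lower_integral g z)) \<le> (\<integral>\<^sup>+s. ennreal (norm (indicator {..fst z} s * g (s, snd z))) \<partial>J)"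
      unfolding lower_integral_def by (rule integral_norm_bound_ennreal)
    also have "\<dots> \<le> (\<integral>\<^sup>+s. ennreal (norm (g (s, snd z))) \<partial>J)"
      by (intro nn_integral_mono) (auto simp: indicator_def)
    finally show ?thesis .
  next
    case False
    then show ?thesis by (simp add: lower_integral_def not_integrable_integral_eq)
  qed
  have "(\<integral>\<^sup>+z. ennreal (norm (lower_integral g z)) \<partial>(J \<Otimes>\<^sub>M N))
      \<le> (\<integral>\<^sup>+z. (\<integral>\<^sup>+s. ennreal (norm (g (s, snd z))) \<partial>J) \<partial>(J \<Otimes>\<^sub>M N))"
    by (intro nn_integral_mono bound)
  also have "\<dots> = (\<integral>\<^sup>+t. \<integral>\<^sup>+y. (\<integral>\<^sup>+s. ennreal (norm (g (s, y))) \<partial>J) \<partial>N \<partial>J)"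
    by (subst N.nn_integral_fst[symmetric]) simp_all
  also have "\<dots> = (\<integral>\<^sup>+y. (\<integral>\<^sup>+s. ennreal (norm (g (s, y))) \<partial>J) \<partial>N)"
    using emeasure_space_1 by simp
  also have "\<dots> = (\<integral>\<^sup>+z. ennreal (norm (g z)) \<partial>(J \<Otimes>\<^sub>M N))"
    using JN.nn_integral_snd[of "\<lambda>z. ennreal (norm (g z))"] by simp
  also have "\<dots> < \<infinity>" using g by (simp add: integrable_iff_bounded)
  finally show ?thesis using m by (simp add: integrable_iff_bounded)
qed

text \<open>The formula in one variable, on almost every line, integrated over the base points.\<close>
lemma integral_lower_integral_by_parts:
  assumes N: "prob_space N" and g: "integrable (J \<Otimes>\<^sub>M N) g"
    and \<zeta>: "\<zeta> \<in> borel_measurable borel" "\<And>s. \<bar>\<zeta> s\<bar> \<le> C" "(\<integral>s. \<zeta> s \<partial>J) = 0"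
    and \<Phi>: "\<Phi> \<in> borel_measurable N" "\<And>y. \<bar>\<Phi> y\<bar> \<le> 1"
    and \<eta>: "\<And>t. \<eta> t = (\<integral>s. indicator {..<t} s * \<zeta> s \<partial>J)"
  shows "(\<integral>z. g z * (\<eta> (fst z) * \<Phi> (snd z)) \<partial>(J \<Otimes>\<^sub>M N))
    = - (\<integral>z. lower_integral g z * (\<zeta> (fst z) * \<Phi> (snd z)) \<partial>(J \<Otimes>\<^sub>M N))"
proof -
  interpret N: prob_space N by fact
  interpret JN: pair_sigma_finite J N by unfold_locales
  note [measurable] = borel_measurable_side[OF \<zeta>(1)] \<Phi>(1) measurable_id_side
  have C0: "0 \<le> C" using order_trans[OF abs_ge_zero \<zeta>(2)] .
  have "(\<lambda>t. \<integral>s. (if s < t then 1 else 0) * \<zeta> s \<partial>J) \<in> borel_measurable J"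
    by measurable
  then have m\<eta> [measurable]: "\<eta> \<in> borel_measurable J"
    by (simp add: \<eta>[abs_def] indicator_def of_bool_def)
  have \<eta>C: "\<bar>\<eta> t\<bar> \<le> C" for t
  proof -
    have "\<bar>\<eta> t\<bar> \<le> (\<integral>s. \<bar>indicator {..<t} s * \<zeta> s\<bar> \<partial>J)" unfolding \<eta> by (rule integral_abs_bound)
    also have "\<dots> \<le> (\<integral>s. C \<partial>J)"
      by (rule integral_mono') (use \<zeta>(2) C0 in \<open>auto simp: indicator_def\<close>)
    finally show ?thesis by (simp add: prob_space)
  qed
  have b: "\<bar>h (fst z) * \<Phi> (snd z)\<bar> \<le> C" if "\<And>t. \<bar>h t\<bar> \<le> C" for h z
  proof -
    have "\<bar>h (fst z)\<bar> * \<bar>\<Phi> (snd z)\<bar> \<le> C * 1" by (intro mult_mono that \<Phi>(2) C0) auto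
    then show ?thesis by (simp add: abs_mult)
  qed
  have i1: "integrable (J \<Otimes>\<^sub>M N) (\<lambda>z. g z * (\<eta> (fst z) * \<Phi> (snd z)))"
    by (rule integrable_mult_bounded[OF g _ b]) (use \<eta>C in auto)
  have i2: "integrable (J \<Otimes>\<^sub>M N) (\<lambda>z. lower_integral g z * (\<zeta> (fst z) * \<Phi> (snd z)))"
    by (rule integrable_mult_bounded[OF integrable_lower_integral[OF N g] _ b]) (use \<zeta>(2) in auto)
  have gy: "AE y in N. integrable J (\<lambda>s. g (s, y))"
    using JN.AE_integrable_snd[of "\<lambda>s y. g (s, y)"] g by simp
  have "(\<integral>z. g z * (\<eta> (fst z) * \<Phi> (snd z)) \<partial>(J \<Otimes>\<^sub>M N)) = (\<integral>y. (\<integral>t. g (t, y) * (\<eta> t * \<Phi> y) \<partial>J) \<partial>N)"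
    using JN.integral_snd[of "\<lambda>t y. g (t, y) * (\<eta> t * \<Phi> y)"] i1 by (simp add: case_prod_beta')
  also have "\<dots> = (\<integral>y. - (\<integral>t. lower_integral g (t, y) * (\<zeta> t * \<Phi> y) \<partial>J) \<partial>N)"
  proof (rule integral_cong_AE)
    show "(\<lambda>y. \<integral>t. g (t, y) * (\<eta> t * \<Phi> y) \<partial>J) \<in> borel_measurable N"
      using JN.integrable_snd[of "\<lambda>t y. g (t, y) * (\<eta> t * \<Phi> y)"] i1 by (simp add: case_prod_beta')
    show "(\<lambda>y. - (\<integral>t. lower_integral g (t, y) * (\<zeta> t * \<Phi> y) \<partial>J)) \<in> borel_measurable N"
      using JN.integrable_snd[of "\<lambda>t y. lower_integral g (t, y) * (\<zeta> t * \<Phi> y)"] i2 by (simp add: case_prod_beta')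
    show "AE y in N. (\<integral>t. g (t, y) * (\<eta> t * \<Phi> y) \<partial>J) = - (\<integral>t. lower_integral g (t, y) * (\<zeta> t * \<Phi> y) \<partial>J)"
      using gy
    proof eventually_elim
      case (elim y)
      from integral_lower_segments_by_parts[OF elim \<zeta>]
      have "(\<integral>t. g (t, y) * \<eta> t \<partial>J) * \<Phi> y = - (\<integral>t. \<zeta> t * lower_integral g (t, y) \<partial>J) * \<Phi> y"
        by (simp add: \<eta> lower_integral_def)
      moreover have "(\<integral>t. g (t, y) * \<eta> t \<partial>J) * \<Phi> y = (\<integral>t. g (t, y) * (\<eta> t * \<Phi> y) \<partial>J)"
        by (subst integral_mult_left_zero[symmetric]) (simp add: mult.assoc)
      moreover have "(\<integral>t. \<zeta> t * lower_integral g (t, y) \<partial>J) * \<Phi> y = (\<integral>t. lower_integral g (t, y) * (\<zeta> t * \<Phi> y) \<partial>J)"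
        by (subst integral_mult_left_zero[symmetric]) (simp add: mult_ac)
      ultimately show ?case by simp
    qed
  qed
  also have "\<dots> = - (\<integral>z. lower_integral g z * (\<zeta> (fst z) * \<Phi> (snd z)) \<partial>(J \<Otimes>\<^sub>M N))"
    using JN.integral_snd[of "\<lambda>t y. lower_integral g (t, y) * (\<zeta> t * \<Phi> y)"] i2 by (simp add: case_prod_beta')
  finally show ?thesis .
qed

lemma distr_upd:
  assumes "k \<in> S"
  shows "distr (J \<Otimes>\<^sub>M P (S - {k})) (P S) (\<lambda>z. (snd z)(k := fst z)) = P S"
  using distr_pair_PiM_eq_PiM[of "S - {k}" "\<lambda>_. J" k] assms prob_space_axioms
  by (simp add: insert_absorb case_prod_beta')

lemma measurable_upd:
  assumes "k \<in> S" shows "(\<lambda>z. (snd z)(k := fst z)) \<in> J \<Otimes>\<^sub>M P (S - {k}) \<rightarrow>\<^sub>M P S"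
proof -
  have "(\<lambda>(y, t). y(k := t)) \<in> P (S - {k}) \<Otimes>\<^sub>M J \<rightarrow>\<^sub>M P (insert k (S - {k}))"
    by (rule measurable_add_dim)
  from measurable_pair_swap[OF this] show ?thesis
    using assms by (simp add: insert_absorb case_prod_beta')
qed

lemma measurable_drop:
  assumes "k \<in> S" shows "(\<lambda>x. x(k := undefined)) \<in> P S \<rightarrow>\<^sub>M P (S - {k})"
proof -
  have "(\<lambda>x. restrict x (S - {k})) \<in> P S \<rightarrow>\<^sub>M P (S - {k})" by (rule measurable_restrict_subset) auto
  moreover have "restrict x (S - {k}) = x(k := undefined)" if "x \<in> space (P S)" for x
    using that by (auto simp: space_PiM PiE_iff extensional_def restrict_def fun_eq_iff)
  ultimately show ?thesis by (rule measurable_cong[THEN iffD1, rotated])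
qed

lemma integral_upd:
  fixes f :: "(nat \<Rightarrow> real) \<Rightarrow> real"
  assumes "k \<in> S" "f \<in> borel_measurable (P S)"
  shows "(\<integral>x. f x \<partial>P S) = (\<integral>z. f ((snd z)(k := fst z)) \<partial>(J \<Otimes>\<^sub>M P (S - {k})))"
  using integral_distr[OF measurable_upd[OF assms(1)] assms(2)] distr_upd[OF assms(1)] by simp

lemma integrable_upd_iff:
  fixes f :: "(nat \<Rightarrow> real) \<Rightarrow> real"
  assumes "k \<in> S" "f \<in> borel_measurable (P S)"
  shows "integrable (P S) f \<longleftrightarrow> integrable (J \<Otimes>\<^sub>M P (S - {k})) (\<lambda>z. f ((snd z)(k := fst z)))"
  using integrable_distr_eq[OF measurable_upd[OF assms(1)] assms(2)] distr_upd[OF assms(1)] by simp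

text \<open>Lower boxes suffice as a generator, so only one end point of each interval has to be approximated by
  cut-off functions.\<close>
lemma sets_cube_generator:
  assumes fin: "finite S"
  shows "sets (P S) = sigma_sets (space (P S)) (range (\<lambda>b. PiE S (\<lambda>i. {..<b i} \<inter> I)))" (is "_ = sigma_sets ?\<Omega> ?G")
proof
  have sp: "?\<Omega> = PiE S (\<lambda>_. I)" by (simp add: space_PiM space_restrict_space)
  have G: "?G \<subseteq> Pow ?\<Omega>" unfolding sp by (auto intro!: PiE_mono)
  show "sigma_sets ?\<Omega> ?G \<subseteq> sets (P S)"
  proof (rule sets.sigma_sets_subset, clarify)
    fix b :: "nat \<Rightarrow> real"
    show "PiE S (\<lambda>i. {..<b i} \<inter> I) \<in> sets (P S)"
      using fin side_borel by (intro sets_PiM_I_finite) (auto simp: sets_restrict_space)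
  qed
  define T where "T = sigma ?\<Omega> ?G"
  have T: "space T = ?\<Omega>" "sets T = sigma_sets ?\<Omega> ?G" using G by (simp_all add: T_def)
  have comp: "(\<lambda>x. x i) \<in> T \<rightarrow>\<^sub>M J" if i: "i \<in> S" for i
  proof (rule measurable_restrict_space2)
    show "(\<lambda>x. x i) \<in> space T \<rightarrow> I" using i by (auto simp: T sp)
    have "(\<lambda>x. x i) \<in> borel_measurable T"
    proof (rule borel_measurableI_less)
      fix r :: real
      have "{x \<in> space T. x i < r} = PiE S (\<lambda>j. {..<(if j = i then r else c + 2)} \<inter> I)"
      proof (intro antisym subsetI)
        fix x assume x: "x \<in> {x \<in> space T. x i < r}"
        then have "x j \<in> I" if "j \<in> S" for j using that by (auto simp: T sp PiE_iff)
        then have "x j < c + 2" if "j \<in> S" for j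
          using that subsetD[OF side_closed, of "x j"] by force
        then show "x \<in> PiE S (\<lambda>j. {..<(if j = i then r else c + 2)} \<inter> I)"
          using x by (auto simp: T sp PiE_iff)
      qed (use i in \<open>auto simp: T sp PiE_iff split: if_splits\<close>)
      also have "\<dots> \<in> ?G" by (rule rangeI)
      finally show "{x \<in> space T. x i < r} \<in> sets T" by (auto simp: T)
    qed
    then show "(\<lambda>x. x i) \<in> T \<rightarrow>\<^sub>M lborel" by simp
  qed
  have "(\<lambda>x. x) \<in> T \<rightarrow>\<^sub>M P S"
    by (rule measurable_PiM_single') (use comp in \<open>auto simp: T space_PiM\<close>)
  from measurable_sets[OF this] show "sets (P S) \<subseteq> sigma_sets ?\<Omega> ?G"
    using sets.sets_into_space[of _ "P S"] by (fastforce simp: T Int_absorb2)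
qed

text \<open>The hypothesis says that \<open>w\<close> has distributional derivative zero in direction \<open>k\<close>. It is applied to the
  mean-zero combination of a cut-off of \<open>{..<b k}\<close> and a cut-off of the whole side, and to cut-offs of
  \<open>{..<b i}\<close> in the other directions; dominated convergence replaces the cut-offs by indicators.\<close>
lemma weak_derivative_on_boxes:
  fixes b :: "nat \<Rightarrow> real" and S :: "nat set" and k :: nat
  defines "N \<equiv> P (S - {k})"
  assumes S: "finite S" "k \<in> S" and w: "integrable (J \<Otimes>\<^sub>M N) w"
    and orth: "\<And>\<zeta> \<theta>. \<zeta> \<in> tests c \<Longrightarrow> (\<integral>s. \<zeta> s \<partial>J) = 0 \<Longrightarrow> (\<And>i. i \<in> S - {k} \<Longrightarrow> \<theta> i \<in> tests c \<and> (\<forall>t. \<bar>\<theta> i t\<bar> \<le> 1)) \<Longrightarrow>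
      (\<integral>z. w z * (\<zeta> (fst z) * (\<Prod>i\<in>S - {k}. \<theta> i (snd z i))) \<partial>(J \<Otimes>\<^sub>M N)) = 0"
  shows "(\<integral>z. w z * ((indicator {..<b k} (fst z) - (\<integral>t. indicator {..<b k} t \<partial>J))
      * (\<Prod>i\<in>S - {k}. indicator {..<b i} (snd z i))) \<partial>(J \<Otimes>\<^sub>M N)) = 0"
proof -
  interpret N: prob_space N unfolding N_def by (rule prob_P)
  interpret JN: pair_sigma_finite J N by unfold_locales
  define L where "L m a = (\<integral>t. cutoff c a m t \<partial>J)" for m a
  \<comment> \<open>mean zero by construction, and L m (c + 2) tends to 1\<close>
  define \<zeta> where "\<zeta> m t = L m (c + 2) * cutoff c (b k) m t - L m (b k) * cutoff c (c + 2) m t" for m t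
  define \<Phi> where "\<Phi> m y = (\<Prod>i\<in>S - {k}. cutoff c (b i) m (y i))" for m and y :: "nat \<Rightarrow> real"
  have cm [measurable]: "cutoff c a m \<in> borel_measurable J" for a m
    by (rule borel_measurable_side[OF tests_measurable[OF cutoff_in_tests]])
  have ci: "integrable J (cutoff c a m)" for a m
    by (rule integrable_const_bound[where B = 1]) (use cutoff_bounds in auto)
  have L01: "0 \<le> L m a" "L m a \<le> 1" for m a
  proof -
    show "0 \<le> L m a" unfolding L_def by (intro Bochner_Integration.integral_nonneg cutoff_bounds)
    have "L m a \<le> (\<integral>t. 1 \<partial>J)" unfolding L_def by (intro integral_mono ci cutoff_bounds) simp
    then show "L m a \<le> 1" by (simp add: prob_space)
  qed
  have Llim: "(\<lambda>m. L m a) \<longlonglongrightarrow> (\<integral>t. indicator {..<a} t \<partial>J)" for a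
    unfolding L_def
  proof (rule integral_dominated_convergence[where w = "\<lambda>_. 1"])
    show "AE t in J. (\<lambda>m. cutoff c a m t) \<longlonglongrightarrow> indicator {..<a} t"
      using AE_side_interior by eventually_elim (simp add: tendsto_cutoff)
    show "AE t in J. norm (cutoff c a m t) \<le> 1" for m using cutoff_bounds by simp
  qed (auto intro!: borel_measurable_side)
  have L1: "(\<integral>t. indicator {..<c + 2} t \<partial>J) = (1 :: real)"
  proof -
    have "(\<integral>t. indicator {..<c + 2} t \<partial>J) = (\<integral>t. (1 :: real) \<partial>J)"
      using side_closed by (intro Bochner_Integration.integral_cong) (force simp: space_restrict_space indicator_def)+
    then show ?thesis by (simp add: prob_space)
  qed
  have \<zeta>t: "\<zeta> m \<in> tests c" for m
  proof -
    have "smooth (\<zeta> m)" unfolding \<zeta>_def[abs_def] by (rule smooth_cutoff_combination)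
    moreover have "\<zeta> m t = 0" if "\<not> (c + inverse (Suc m) \<le> t \<and> t \<le> c + 1 - inverse (Suc m))" for t
      unfolding \<zeta>_def cutoff_def using that by (subst (1 2) bump_eq_0) auto
    ultimately show ?thesis unfolding tests_def by (auto intro!: exI[of _ "inverse (real (Suc m))"])
  qed
  have mean: "(\<integral>s. \<zeta> m s \<partial>J) = 0" for m
    unfolding \<zeta>_def by (subst Bochner_Integration.integral_diff) (auto simp: ci L_def)
  have \<zeta>b: "\<bar>\<zeta> m t\<bar> \<le> 1" for m t
  proof -
    have "0 \<le> L m (c + 2) * cutoff c (b k) m t" "L m (c + 2) * cutoff c (b k) m t \<le> 1"
      "0 \<le> L m (b k) * cutoff c (c + 2) m t" "L m (b k) * cutoff c (c + 2) m t \<le> 1"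
      using L01 cutoff_bounds by (auto intro!: mult_nonneg_nonneg mult_le_one)
    then show ?thesis by (simp add: \<zeta>_def)
  qed
  have \<Phi>b: "\<bar>\<Phi> m y\<bar> \<le> 1" for m y
    unfolding \<Phi>_def using cutoff_bounds
    by (subst abs_of_nonneg) (auto intro!: prod_nonneg prod_le_1)
  have comp [measurable]: "(\<lambda>y. y i) \<in> N \<rightarrow>\<^sub>M J" if "i \<in> S - {k}" for i
    unfolding N_def using that by (rule measurable_component_singleton)
  have \<Phi>m [measurable]: "\<Phi> m \<in> borel_measurable (N)" for m
    unfolding \<Phi>_def by (intro borel_measurable_prod measurable_compose[OF comp cm])
  have ind [measurable]: "(indicator {..<a} :: real \<Rightarrow> real) \<in> borel_measurable J" for a
    by (rule borel_measurable_side) simp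
  have Qm [measurable]: "(\<lambda>y. \<Prod>i\<in>S - {k}. indicator {..<b i} (y i) :: real) \<in> borel_measurable (N)"
    by (intro borel_measurable_prod measurable_compose[OF comp ind])
  have zero: "(\<integral>z. w z * (\<zeta> m (fst z) * \<Phi> m (snd z)) \<partial>(J \<Otimes>\<^sub>M N)) = 0" for m
    unfolding \<Phi>_def using cutoff_in_tests cutoff_bounds by (intro orth \<zeta>t mean) auto
  have [measurable]: "w \<in> borel_measurable (J \<Otimes>\<^sub>M N)" using w by auto
  have \<zeta>m [measurable]: "\<zeta> m \<in> borel_measurable J" for m
    by (rule borel_measurable_side[OF tests_measurable[OF \<zeta>t]])
  have interior: "AE z in J \<Otimes>\<^sub>M N. (c < fst z \<and> fst z < c + 1) \<and> (\<forall>i\<in>S - {k}. c < snd z i \<and> snd z i < c + 1)"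
  proof (rule JN.AE_pair_measure)
    have [measurable]: "finite (S - {k})" using S by simp
    have c2 [measurable]: "(\<lambda>z. snd z i) \<in> borel_measurable (J \<Otimes>\<^sub>M N)" if "i \<in> S - {k}" for i
      using measurable_compose[OF measurable_snd comp[OF that]] by (rule measurable_compose[OF _ measurable_id_side])
    have c1 [measurable]: "fst \<in> borel_measurable (J \<Otimes>\<^sub>M N)"
      by (rule measurable_compose[OF measurable_fst measurable_id_side])
    have "Measurable.pred (J \<Otimes>\<^sub>M N) (\<lambda>z. c < snd z i \<and> snd z i < c + 1)" if "i \<in> S - {k}" for i
      using c2[OF that] by measurable
    then show "{z \<in> space (J \<Otimes>\<^sub>M N). (c < fst z \<and> fst z < c + 1) \<and> (\<forall>i\<in>S - {k}. c < snd z i \<and> snd z i < c + 1)} \<in> sets (J \<Otimes>\<^sub>M N)"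
      by (intro sets.sets_Collect_conj sets.sets_Collect_finite_All) (use S in \<open>auto simp: pred_def\<close>)
    have "AE y in N. \<forall>i\<in>S - {k}. c < y i \<and> y i < c + 1"
      unfolding N_def using S
      by (intro AE_finite_allI AE_PiM_component[OF prob_space_axioms _ AE_side_interior]) auto
    then show "AE t in J. AE y in N. (c < fst (t, y) \<and> fst (t, y) < c + 1) \<and> (\<forall>i\<in>S - {k}. c < snd (t, y) i \<and> snd (t, y) i < c + 1)"
      using AE_side_interior by (auto elim!: eventually_mono)
  qed
  have "(\<lambda>m. \<integral>z. w z * (\<zeta> m (fst z) * \<Phi> m (snd z)) \<partial>(J \<Otimes>\<^sub>M N))
      \<longlonglongrightarrow> (\<integral>z. w z * ((indicator {..<b k} (fst z) - (\<integral>t. indicator {..<b k} t \<partial>J))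
      * (\<Prod>i\<in>S - {k}. indicator {..<b i} (snd z i))) \<partial>(J \<Otimes>\<^sub>M N))"
  proof (rule integral_dominated_convergence[where w = "\<lambda>z. \<bar>w z\<bar>"])
    show "integrable (J \<Otimes>\<^sub>M N) (\<lambda>z. \<bar>w z\<bar>)" using w by simp
    show "AE z in J \<Otimes>\<^sub>M N. norm (w z * (\<zeta> m (fst z) * \<Phi> m (snd z))) \<le> \<bar>w z\<bar>" for m
    proof (rule AE_I2)
      fix z
      have "\<bar>\<zeta> m (fst z)\<bar> * \<bar>\<Phi> m (snd z)\<bar> \<le> 1 * 1" by (intro mult_mono \<zeta>b \<Phi>b) auto
      then have "\<bar>w z\<bar> * (\<bar>\<zeta> m (fst z)\<bar> * \<bar>\<Phi> m (snd z)\<bar>) \<le> \<bar>w z\<bar> * 1" by (intro mult_left_mono) auto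
      then show "norm (w z * (\<zeta> m (fst z) * \<Phi> m (snd z))) \<le> \<bar>w z\<bar>" by (simp add: abs_mult)
    qed
    show "AE z in J \<Otimes>\<^sub>M N. (\<lambda>m. w z * (\<zeta> m (fst z) * \<Phi> m (snd z)))
        \<longlonglongrightarrow> w z * ((indicator {..<b k} (fst z) - (\<integral>t. indicator {..<b k} t \<partial>J))
      * (\<Prod>i\<in>S - {k}. indicator {..<b i} (snd z i)))"
      using interior
    proof eventually_elim
      case (elim z)
      have "(\<lambda>m. \<zeta> m (fst z)) \<longlonglongrightarrow> 1 * indicator {..<b k} (fst z) - (\<integral>t. indicator {..<b k} t \<partial>J) * indicator {..<c + 2} (fst z)"
        unfolding \<zeta>_def using elim Llim[of "c + 2"] L1
        by (intro tendsto_intros Llim tendsto_cutoff) auto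
      moreover have "indicator {..<c + 2} (fst z) = (1 :: real)" using elim by (simp add: indicator_def)
      moreover have "(\<lambda>m. \<Phi> m (snd z)) \<longlonglongrightarrow> (\<Prod>i\<in>S - {k}. indicator {..<b i} (snd z i))"
        unfolding \<Phi>_def using elim by (intro tendsto_prod tendsto_cutoff) auto
      ultimately show ?case by (intro tendsto_intros) auto
    qed
  qed measurable
  then show ?thesis unfolding zero by (simp add: LIMSEQ_const_iff)
qed

text \<open>On almost every line in direction \<open>k\<close>, a function with integrable weak partial derivative \<open>g\<close> is, up
  to a constant, the primitive of \<open>g\<close>. The difference \<open>w\<close> of \<open>u\<close> and the primitive has weak derivative zero.
  By the lemma above the integral of \<open>w\<close> over a box is that of its mean \<open>\<kappa>\<close> along direction \<open>k\<close>, so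
  \<open>w = \<kappa>\<close> almost everywhere.\<close>
lemma AE_line_antiderivative:
  fixes u g :: "(nat \<Rightarrow> real) \<Rightarrow> real"
  assumes S: "finite S" "k \<in> S" and u: "integrable (P S) u" and g: "integrable (P S) g"
    and weak: "\<And>\<eta> \<theta>. \<eta> \<in> tests c \<Longrightarrow> (\<And>i. i \<in> S - {k} \<Longrightarrow> \<theta> i \<in> tests c) \<Longrightarrow>
      (\<integral>x. u x * (deriv \<eta> (x k) * (\<Prod>i\<in>S - {k}. \<theta> i (x i))) \<partial>P S)
      = - (\<integral>x. g x * (\<eta> (x k) * (\<Prod>i\<in>S - {k}. \<theta> i (x i))) \<partial>P S)"
  shows "AE y in P (S - {k}). integrable J (\<lambda>s. g (y(k := s))) \<and>
    (\<exists>\<kappa>. AE t in J. u (y(k := t)) = \<kappa> + (\<integral>s. indicator {..t} s * g (y(k := s)) \<partial>J))"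
proof -
  let ?N = "P (S - {k})"
  interpret N: prob_space ?N by (rule prob_P)
  interpret JN: pair_sigma_finite J ?N by unfold_locales
  define U where "U z = u ((snd z)(k := fst z))" for z
  define V where "V z = g ((snd z)(k := fst z))" for z
  have U: "integrable (J \<Otimes>\<^sub>M ?N) U" and V: "integrable (J \<Otimes>\<^sub>M ?N) V"
    using u g integrable_upd_iff[OF S(2), of u] integrable_upd_iff[OF S(2), of g]
    by (auto simp: U_def[abs_def] V_def[abs_def])
  define w where "w z = U z - lower_integral V z" for z
  have \<Gamma>: "integrable (J \<Otimes>\<^sub>M ?N) (lower_integral V)" by (rule integrable_lower_integral[OF prob_P V])
  have w: "integrable (J \<Otimes>\<^sub>M ?N) w" unfolding w_def using U \<Gamma> by simp
  have comp: "(\<lambda>y. y i) \<in> P T \<rightarrow>\<^sub>M J" if "i \<in> T" for i T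
    using that by (rule measurable_component_singleton)
  have orth: "(\<integral>z. w z * (\<zeta> (fst z) * (\<Prod>i\<in>S - {k}. \<theta> i (snd z i))) \<partial>(J \<Otimes>\<^sub>M ?N)) = 0"
    if \<zeta>: "\<zeta> \<in> tests c" and mean: "(\<integral>s. \<zeta> s \<partial>J) = 0"
      and \<theta>: "\<And>i. i \<in> S - {k} \<Longrightarrow> \<theta> i \<in> tests c \<and> (\<forall>t. \<bar>\<theta> i t\<bar> \<le> 1)" for \<zeta> \<theta>
  proof -
    obtain \<eta> where \<eta>: "\<eta> \<in> tests c" "deriv \<eta> = \<zeta>" "\<And>t. \<eta> t = (\<integral>s. indicator {..<t} s * \<zeta> s \<partial>J)"
      by (rule tests_antiderivative[OF \<zeta> mean]) blast
    define \<Phi> where "\<Phi> y = (\<Prod>i\<in>S - {k}. \<theta> i (y i))" for y :: "nat \<Rightarrow> real"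
    have sm: "f \<in> borel_measurable J" if "f \<in> tests c" for f
      by (intro borel_measurable_side tests_measurable[OF that])
    have \<Phi>m: "\<Phi> \<in> borel_measurable ?N"
      unfolding \<Phi>_def using \<theta> by (intro borel_measurable_prod measurable_compose[OF comp sm]) auto
    have \<Phi>m': "\<Phi> \<in> borel_measurable (P S)"
      unfolding \<Phi>_def using \<theta> by (intro borel_measurable_prod measurable_compose[OF comp sm]) auto
    have \<Phi>b: "\<bar>\<Phi> y\<bar> \<le> 1" for y
      unfolding \<Phi>_def abs_prod using \<theta> by (intro prod_le_1) auto
    obtain C where C: "\<And>s. \<bar>\<zeta> s\<bar> \<le> C"
    proof -
      obtain d where d: "d > 0" "\<And>t. \<not> (c + d \<le> t \<and> t \<le> c + 1 - d) \<Longrightarrow> \<zeta> t = 0"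
        using \<zeta> by (auto simp: tests_def)
      have "continuous_on {c..c + 1} \<zeta>"
        using \<zeta> by (intro continuous_at_imp_continuous_on) (auto simp: tests_def smooth_continuous)
      then have "bounded (\<zeta> ` {c..c + 1})" by (intro compact_imp_bounded compact_continuous_image) auto
      then obtain C where C: "0 < C" "\<And>s. s \<in> {c..c + 1} \<Longrightarrow> \<bar>\<zeta> s\<bar> \<le> C"
        by (auto simp: bounded_pos)
      have "\<bar>\<zeta> s\<bar> \<le> C" for s
        using C d by (cases "s \<in> {c..c + 1}") auto
      then show thesis by (rule that)
    qed
    have upd: "\<Phi> (y(k := t)) = \<Phi> y" for y t
      unfolding \<Phi>_def by (intro prod.cong) auto
    have mk: "(\<lambda>x. f (x k)) \<in> borel_measurable (P S)" if "f \<in> tests c" for f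
      using measurable_compose[OF comp[OF S(2)] sm[OF that]] .
    have *: "(\<integral>x. u x * (\<zeta> (x k) * \<Phi> x) \<partial>P S) = - (\<integral>x. g x * (\<eta> (x k) * \<Phi> x) \<partial>P S)"
      using weak[OF \<eta>(1), of \<theta>] \<theta> by (simp add: \<eta>(2) \<Phi>_def)
    have "(\<integral>z. U z * (\<zeta> (fst z) * \<Phi> (snd z)) \<partial>(J \<Otimes>\<^sub>M ?N)) = (\<integral>x. u x * (\<zeta> (x k) * \<Phi> x) \<partial>P S)"
      using mk[OF \<zeta>] \<Phi>m' u by (subst integral_upd[OF S(2)]) (auto simp: U_def upd)
    also note *
    also have "(\<integral>x. g x * (\<eta> (x k) * \<Phi> x) \<partial>P S) = (\<integral>z. V z * (\<eta> (fst z) * \<Phi> (snd z)) \<partial>(J \<Otimes>\<^sub>M ?N))"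
      using mk[OF \<eta>(1)] \<Phi>m' g by (subst integral_upd[OF S(2)]) (auto simp: V_def upd)
    also have "\<dots> = - (\<integral>z. lower_integral V z * (\<zeta> (fst z) * \<Phi> (snd z)) \<partial>(J \<Otimes>\<^sub>M ?N))"
      by (rule integral_lower_integral_by_parts[OF prob_P V tests_measurable[OF \<zeta>] C mean \<Phi>m \<Phi>b \<eta>(3)])
    finally have eq: "(\<integral>z. U z * (\<zeta> (fst z) * \<Phi> (snd z)) \<partial>(J \<Otimes>\<^sub>M ?N))
      = (\<integral>z. lower_integral V z * (\<zeta> (fst z) * \<Phi> (snd z)) \<partial>(J \<Otimes>\<^sub>M ?N))" by simp
    have b: "\<bar>\<zeta> (fst z) * \<Phi> (snd z)\<bar> \<le> C" for z
      using mult_mono[OF C[of "fst z"] \<Phi>b[of "snd z"]] order_trans[OF abs_ge_zero C] by (auto simp: abs_mult)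
    have [measurable]: "\<zeta> \<in> borel_measurable J" "\<Phi> \<in> borel_measurable ?N" by (rule sm[OF \<zeta>], rule \<Phi>m)
    have "(\<integral>z. w z * (\<zeta> (fst z) * \<Phi> (snd z)) \<partial>(J \<Otimes>\<^sub>M ?N)) = 0"
      unfolding w_def left_diff_distrib
      using eq by (subst Bochner_Integration.integral_diff) (auto intro!: integrable_mult_bounded U \<Gamma> b)
    then show ?thesis by (simp add: \<Phi>_def)
  qed
  define \<kappa> where "\<kappa> y = (\<integral>t. w (t, y) \<partial>J)" for y
  have \<kappa>: "integrable ?N \<kappa>"
    using JN.integrable_snd[of "\<lambda>t y. w (t, y)"] w by (simp add: \<kappa>_def[abs_def])
  have \<kappa>': "integrable (J \<Otimes>\<^sub>M ?N) (\<lambda>z. \<kappa> (snd z))"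
  proof -
    have [measurable]: "\<kappa> \<in> borel_measurable ?N" using \<kappa> by auto
    have "(\<integral>\<^sup>+z. ennreal (norm (\<kappa> (snd z))) \<partial>(J \<Otimes>\<^sub>M ?N)) = (\<integral>\<^sup>+y. ennreal (norm (\<kappa> y)) \<partial>?N)"
      by (subst N.nn_integral_fst[symmetric]) (simp_all add: emeasure_space_1)
    then show ?thesis using \<kappa> by (simp add: integrable_iff_bounded)
  qed
  \<comment> \<open>w - \<kappa>, transported back to the cube\<close>
  define f where "f x = w (x k, x(k := undefined)) - \<kappa> (x(k := undefined))" for x
  have f_upd: "f (y(k := t)) = w (t, y) - \<kappa> y" if "y \<in> space ?N" for y t
  proof -
    have "y(k := undefined) = y" using that by (auto simp: space_PiM PiE_iff extensional_def)
    then show ?thesis by (simp add: f_def)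
  qed
  have split_k: "(\<lambda>x. (x k, x(k := undefined))) \<in> P S \<rightarrow>\<^sub>M J \<Otimes>\<^sub>M ?N"
    by (rule measurable_Pair[OF comp[OF S(2)] measurable_drop[OF S(2)]])
  have fm: "f \<in> borel_measurable (P S)"
  proof -
    have "(\<lambda>z. w z - \<kappa> (snd z)) \<in> borel_measurable (J \<Otimes>\<^sub>M ?N)" using w \<kappa>' by auto
    from measurable_compose[OF split_k this] show ?thesis by (simp add: f_def[abs_def])
  qed
  have fpair: "f ((snd z)(k := fst z)) = w z - \<kappa> (snd z)" if "z \<in> space (J \<Otimes>\<^sub>M ?N)" for z
    using that f_upd[of "snd z" "fst z"] by (auto simp: space_pair_measure)
  have fi: "integrable (P S) f"
  proof (subst integrable_upd_iff[OF S(2) fm])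
    have "integrable (J \<Otimes>\<^sub>M ?N) (\<lambda>z. w z - \<kappa> (snd z))" using w \<kappa>' by simp
    then show "integrable (J \<Otimes>\<^sub>M ?N) (\<lambda>z. f ((snd z)(k := fst z)))"
      by (rule Bochner_Integration.integrable_cong[THEN iffD1, rotated -1]) (auto simp: fpair)
  qed
  have box: "(\<integral>x. indicator (PiE S (\<lambda>i. {..<b i} \<inter> I)) x * f x \<partial>P S) = 0" for b
  proof -
    let ?B = "PiE S (\<lambda>i. {..<b i} \<inter> I)"
    define l where "l = (\<integral>t. indicator {..<b k} t \<partial>J :: real)"
    define \<Phi> where "\<Phi> y = (\<Prod>i\<in>S - {k}. indicator {..<b i} (y i) :: real)" for y :: "nat \<Rightarrow> real"
    have ind [measurable]: "(indicator {..<a} :: real \<Rightarrow> real) \<in> borel_measurable J" for a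
      by (rule borel_measurable_side) simp
    have \<Phi>m [measurable]: "\<Phi> \<in> borel_measurable ?N"
      unfolding \<Phi>_def by (intro borel_measurable_prod measurable_compose[OF comp ind])
    have \<Phi>b: "\<bar>\<Phi> y\<bar> \<le> 1" for y
      unfolding \<Phi>_def by (subst abs_of_nonneg) (auto intro!: prod_nonneg prod_le_1 simp: indicator_def)
    have bm: "(\<lambda>z. indicator {..<b k} (fst z) * \<Phi> (snd z)) \<in> borel_measurable (J \<Otimes>\<^sub>M ?N)"
      by measurable
    have bb: "\<bar>indicator {..<b k} (fst z) * \<Phi> (snd z)\<bar> \<le> 1" for z
      using \<Phi>b by (auto simp: abs_mult indicator_def)
    have sB: "?B \<in> sets (P S)"
      using S(1) side_borel by (intro sets_PiM_I_finite) (auto simp: sets_restrict_space)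
    have "(\<integral>x. indicator ?B x * f x \<partial>P S) = (\<integral>z. indicator ?B ((snd z)(k := fst z)) * f ((snd z)(k := fst z)) \<partial>(J \<Otimes>\<^sub>M ?N))"
      using fm sB by (intro integral_upd S(2)) auto
    also have "\<dots> = (\<integral>z. w z * (indicator {..<b k} (fst z) * \<Phi> (snd z)) - \<kappa> (snd z) * (indicator {..<b k} (fst z) * \<Phi> (snd z)) \<partial>(J \<Otimes>\<^sub>M ?N))"
    proof (rule Bochner_Integration.integral_cong)
      fix z assume z: "z \<in> space (J \<Otimes>\<^sub>M ?N)"
      obtain t y where ty: "z = (t, y)" "t \<in> I" "y \<in> PiE (S - {k}) (\<lambda>_. I)"
        using z by (cases z) (auto simp: space_pair_measure space_PiM space_restrict_space)
      have "y(k := t) \<in> ?B \<longleftrightarrow> t < b k \<and> (\<forall>i\<in>S - {k}. y i < b i)"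
        using ty S(2) by (auto simp: PiE_iff extensional_def)
      then have "indicator ?B (y(k := t)) = (indicator {..<b k} t * \<Phi> y :: real)"
        using S(1) by (auto simp: \<Phi>_def indicator_def prod_zero_iff)
      then show "indicator ?B ((snd z)(k := fst z)) * f ((snd z)(k := fst z))
          = w z * (indicator {..<b k} (fst z) * \<Phi> (snd z)) - \<kappa> (snd z) * (indicator {..<b k} (fst z) * \<Phi> (snd z))"
        unfolding fpair[OF z] using ty by (simp add: left_diff_distrib right_diff_distrib mult_ac)
    qed simp
    also have "\<dots> = (\<integral>z. w z * (indicator {..<b k} (fst z) * \<Phi> (snd z)) \<partial>(J \<Otimes>\<^sub>M ?N))
        - (\<integral>z. \<kappa> (snd z) * (indicator {..<b k} (fst z) * \<Phi> (snd z)) \<partial>(J \<Otimes>\<^sub>M ?N))"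
      by (rule Bochner_Integration.integral_diff[OF integrable_mult_bounded[OF w bm bb] integrable_mult_bounded[OF \<kappa>' bm bb]])
    also have "(\<integral>z. \<kappa> (snd z) * (indicator {..<b k} (fst z) * \<Phi> (snd z)) \<partial>(J \<Otimes>\<^sub>M ?N)) = l * (\<integral>y. \<kappa> y * \<Phi> y \<partial>?N)"
    proof -
      have i: "integrable (J \<Otimes>\<^sub>M ?N) (\<lambda>z. \<kappa> (snd z) * (indicator {..<b k} (fst z) * \<Phi> (snd z)))"
        by (rule integrable_mult_bounded[OF \<kappa>' bm bb])
      have "(\<integral>z. \<kappa> (snd z) * (indicator {..<b k} (fst z) * \<Phi> (snd z)) \<partial>(J \<Otimes>\<^sub>M ?N))
        = (\<integral>y. (\<integral>t. \<kappa> y * (indicator {..<b k} t * \<Phi> y) \<partial>J) \<partial>?N)"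
        using JN.integral_snd[of "\<lambda>t y. \<kappa> y * (indicator {..<b k} t * \<Phi> y)"] i by (simp add: case_prod_beta')
      also have "\<dots> = (\<integral>y. l * (\<kappa> y * \<Phi> y) \<partial>?N)"
      proof (rule Bochner_Integration.integral_cong)
        fix y
        have "(\<integral>t. \<kappa> y * (indicator {..<b k} t * \<Phi> y) \<partial>J) = (\<integral>t. indicator {..<b k} t * (\<kappa> y * \<Phi> y) \<partial>J)"
          by (simp only: mult_ac)
        also have "\<dots> = l * (\<kappa> y * \<Phi> y)" unfolding l_def by (rule integral_mult_left_zero)
        finally show "(\<integral>t. \<kappa> y * (indicator {..<b k} t * \<Phi> y) \<partial>J) = l * (\<kappa> y * \<Phi> y)" .
      qed simp
      finally show ?thesis by simp
    qed
    also have "(\<integral>y. \<kappa> y * \<Phi> y \<partial>?N) = (\<integral>z. w z * \<Phi> (snd z) \<partial>(J \<Otimes>\<^sub>M ?N))"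
    proof -
      have i: "integrable (J \<Otimes>\<^sub>M ?N) (\<lambda>z. w z * \<Phi> (snd z))"
        by (rule integrable_mult_bounded[OF w, where D = 1]) (use \<Phi>b in auto)
      then have "(\<integral>z. w z * \<Phi> (snd z) \<partial>(J \<Otimes>\<^sub>M ?N)) = (\<integral>y. (\<integral>t. w (t, y) * \<Phi> y \<partial>J) \<partial>?N)"
        using JN.integral_snd[of "\<lambda>t y. w (t, y) * \<Phi> y"] by (simp add: case_prod_beta')
      then show ?thesis by (simp add: \<kappa>_def)
    qed
    also have "(\<integral>z. w z * (indicator {..<b k} (fst z) * \<Phi> (snd z)) \<partial>(J \<Otimes>\<^sub>M ?N)) - l * (\<integral>z. w z * \<Phi> (snd z) \<partial>(J \<Otimes>\<^sub>M ?N))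
      = (\<integral>z. w z * ((indicator {..<b k} (fst z) - l) * \<Phi> (snd z)) \<partial>(J \<Otimes>\<^sub>M ?N))"
    proof -
      have "integrable (J \<Otimes>\<^sub>M ?N) (\<lambda>z. w z * (indicator {..<b k} (fst z) * \<Phi> (snd z)))"
        by (rule integrable_mult_bounded[OF w bm bb])
      moreover have "integrable (J \<Otimes>\<^sub>M ?N) (\<lambda>z. w z * \<Phi> (snd z))"
        by (rule integrable_mult_bounded[OF w, where D = 1]) (use \<Phi>b in auto)
      moreover have "(\<lambda>z. w z * ((indicator {..<b k} (fst z) - l) * \<Phi> (snd z)))
        = (\<lambda>z. w z * (indicator {..<b k} (fst z) * \<Phi> (snd z)) - l * (w z * \<Phi> (snd z)))"
        by (auto simp: algebra_simps)
      ultimately show ?thesis by simp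
    qed
    also have "\<dots> = 0"
      unfolding l_def \<Phi>_def by (rule weak_derivative_on_boxes[OF S w orth])
    finally show ?thesis .
  qed
  have "AE x in P S. f x = 0"
  proof (rule AE_zero_if_integral_zero_on_generator[OF fi])
    let ?G = "range (\<lambda>b. PiE S (\<lambda>i. {..<b i} \<inter> I))"
    have sp: "space (P S) = PiE S (\<lambda>_. I)" by (simp add: space_PiM space_restrict_space)
    show "Int_stable ?G"
    proof (rule Int_stableI, clarify)
      fix a b :: "nat \<Rightarrow> real"
      have "PiE S (\<lambda>i. {..<a i} \<inter> I) \<inter> PiE S (\<lambda>i. {..<b i} \<inter> I) = PiE S (\<lambda>i. {..<min (a i) (b i)} \<inter> I)"
        by (auto simp: PiE_iff)
      also have "\<dots> \<in> ?G" by (rule range_eqI[of _ _ "\<lambda>i. min (a i) (b i)"]) simp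
      finally show "PiE S (\<lambda>i. {..<a i} \<inter> I) \<inter> PiE S (\<lambda>i. {..<b i} \<inter> I) \<in> ?G" .
    qed
    show "?G \<subseteq> Pow (space (P S))" unfolding sp by (auto intro!: PiE_mono)
    show "sets (P S) = sigma_sets (space (P S)) ?G" by (rule sets_cube_generator[OF S(1)])
    have "PiE S (\<lambda>_. I) = PiE S (\<lambda>i. {..<c + 2} \<inter> I)"
      by (rule PiE_cong) (use side_closed in force)
    then show "space (P S) \<in> ?G" unfolding sp by (rule range_eqI[of _ _ "\<lambda>_. c + 2"])
  qed (use box in auto)
  then have "AE y in ?N. AE t in J. f (y(k := t)) = 0" by (rule AE_slice[OF S])
  moreover have "AE y in ?N. integrable J (\<lambda>s. V (s, y))"
    using JN.AE_integrable_snd[of "\<lambda>s y. V (s, y)"] V by simp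
  ultimately show ?thesis
    using AE_space
  proof eventually_elim
    case (elim y)
    have "AE t in J. u (y(k := t)) = \<kappa> y + (\<integral>s. indicator {..t} s * g (y(k := s)) \<partial>J)"
      using elim(1) by eventually_elim (simp add: f_upd[OF elim(3)] w_def U_def V_def lower_integral_def)
    then show ?case using elim(2) by (auto simp: V_def)
  qed
qed

end

section \<open>Product test functions and distributional gradients\<close>

lemma prod_upd:
  fixes \<phi> :: "nat \<Rightarrow> real \<Rightarrow> real"
  assumes "i < n"
  shows "(\<Prod>j<n. \<phi> j ((x(i := t)) j)) = \<phi> i t * (\<Prod>j\<in>{..<n} - {i}. \<phi> j (x j))"
proof -
  have "(\<Prod>j<n. \<phi> j ((x(i := t)) j)) = \<phi> i ((x(i := t)) i) * (\<Prod>j\<in>{..<n} - {i}. \<phi> j ((x(i := t)) j))"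
    by (rule prod.remove) (use assms in auto)
  also have "(\<Prod>j\<in>{..<n} - {i}. \<phi> j ((x(i := t)) j)) = (\<Prod>j\<in>{..<n} - {i}. \<phi> j (x j))"
    by (intro prod.cong) auto
  finally show ?thesis by simp
qed

lemma partial_prod:
  assumes "i < n" "smooth (\<phi> i)"
  shows "((\<lambda>t. \<Prod>j<n. \<phi> j ((x(i := t)) j)) has_real_derivative
      deriv (\<phi> i) t * (\<Prod>j\<in>{..<n} - {i}. \<phi> j (x j))) (at t)"
    and "partial i (\<lambda>x. \<Prod>j<n. \<phi> j (x j)) x = deriv (\<phi> i) (x i) * (\<Prod>j\<in>{..<n} - {i}. \<phi> j (x j))"
proof -
  show d: "((\<lambda>t. \<Prod>j<n. \<phi> j ((x(i := t)) j)) has_real_derivative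
      deriv (\<phi> i) t * (\<Prod>j\<in>{..<n} - {i}. \<phi> j (x j))) (at t)" for t
    unfolding prod_upd[OF assms(1)] by (rule DERIV_cmult_right[OF smooth_has_deriv[OF assms(2)]])
  show "partial i (\<lambda>x. \<Prod>j<n. \<phi> j (x j)) x = deriv (\<phi> i) (x i) * (\<Prod>j\<in>{..<n} - {i}. \<phi> j (x j))"
    unfolding partial_def by (rule DERIV_imp_deriv[OF d])
qed

lemma continuous_on_prod_coordinates:
  assumes "\<And>i. i < n \<Longrightarrow> smooth (\<phi> i)"
  shows "continuous_on (euclid n) (\<lambda>x. \<Prod>j<n. \<phi> j (x j))"
proof (intro continuous_on_prod)
  fix i assume i: "i \<in> {..<n}"
  have "continuous_on UNIV (\<phi> i)"
    using assms i by (intro continuous_at_imp_continuous_on ballI smooth_continuous) auto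
  moreover have "continuous_on (euclid n) (\<lambda>x. x i)"
    by (rule continuous_on_subset[OF continuous_on_product_coordinates]) auto
  ultimately show "continuous_on (euclid n) (\<lambda>x. \<phi> i (x i))"
    by (rule continuous_on_compose2) auto
qed

text \<open>A partial derivative of a product is a product of the same form with one factor differentiated, so the
  class of such products is closed under all partial derivatives.\<close>
lemma Ck_prod:
  assumes "\<And>i. i < n \<Longrightarrow> smooth (\<phi> i)"
  shows "Ck n m (\<lambda>x. \<Prod>j<n. \<phi> j (x j))"
  using assms
proof (induction m arbitrary: \<phi>)
  case (0 \<phi>)
  then show ?case by (simp add: continuous_on_prod_coordinates)
next
  case (Suc m \<phi>)
  have cont: "continuous_on (euclid n) (\<lambda>x. \<Prod>j<n. \<phi> j (x j))"
    by (rule continuous_on_prod_coordinates[OF Suc.prems])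
  have "Ck n m (partial i (\<lambda>x. \<Prod>j<n. \<phi> j (x j)))" if i: "i < n" for i
  proof -
    have "partial i (\<lambda>x. \<Prod>j<n. \<phi> j (x j)) = (\<lambda>x. \<Prod>j<n. (\<phi>(i := deriv (\<phi> i))) j (x j))"
    proof
      fix x
      have "(\<Prod>j<n. (\<phi>(i := deriv (\<phi> i))) j (x j)) = deriv (\<phi> i) (x i) * (\<Prod>j\<in>{..<n} - {i}. \<phi> j (x j))"
        using prod_upd[OF i, of "\<phi>(i := deriv (\<phi> i))" x "x i"] by simp
      then show "partial i (\<lambda>x. \<Prod>j<n. \<phi> j (x j)) x = (\<Prod>j<n. (\<phi>(i := deriv (\<phi> i))) j (x j))"
        using partial_prod(2)[OF i, of \<phi>] Suc.prems[OF i] by simp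
    qed
    moreover have "Ck n m (\<lambda>x. \<Prod>j<n. (\<phi>(i := deriv (\<phi> i))) j (x j))"
      by (rule Suc.IH) (use Suc.prems in \<open>auto intro: smooth_deriv\<close>)
    ultimately show ?thesis by simp
  qed
  moreover have "(\<lambda>t. \<Prod>j<n. \<phi> j ((x(i := t)) j)) differentiable (at (x i))" if "i < n" for i x
    using partial_prod(1)[of i n \<phi> x "x i"] Suc.prems that real_differentiable_def by blast
  ultimately show ?case using cont by simp
qed

lemma compact_box: "compact (PiE {..<n} (\<lambda>i. {l i..r i :: real}))"
proof -
  let ?B = "\<lambda>i. if i < n then {l i..r i} else {undefined}"
  have "PiE {..<n} (\<lambda>i. {l i..r i}) = PiE UNIV ?B"
    by (auto simp: PiE_def Pi_def extensional_def split: if_splits)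
  moreover have "compactin (product_topology (\<lambda>_. euclidean) UNIV) (PiE UNIV ?B)"
    unfolding compactin_PiE by auto
  ultimately show ?thesis by (simp add: euclidean_product_topology)
qed

context unit_side
begin

lemma interior_eq: "interior I = {c<..<c + 1}"
proof (rule antisym)
  show "interior I \<subseteq> {c<..<c + 1}"
    using interior_mono[OF side_closed] by simp
  show "{c<..<c + 1} \<subseteq> interior I"
    by (rule interior_maximal[OF interior_side]) simp
qed

lemma test_fun_prod:
  assumes \<phi>: "\<And>i. i < n \<Longrightarrow> \<phi> i \<in> tests c"
  shows "test_fun n I (\<lambda>x. \<Prod>i<n. \<phi> i (x i))"
proof -
  have "\<forall>i\<in>{..<n}. \<exists>d>0. \<forall>t. \<not> (c + d \<le> t \<and> t \<le> c + 1 - d) \<longrightarrow> \<phi> i t = 0"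
    using \<phi> by (auto simp: tests_def)
  then obtain d where d: "\<And>i. i < n \<Longrightarrow> d i > 0"
    "\<And>i t. i < n \<Longrightarrow> \<not> (c + d i \<le> t \<and> t \<le> c + 1 - d i) \<Longrightarrow> \<phi> i t = 0"
    by (metis lessThan_iff)
  let ?K = "PiE {..<n} (\<lambda>i. {c + d i..c + 1 - d i})"
  have "?K \<subseteq> open_cube n I"
    unfolding interior_eq by (rule PiE_mono) (use d(1) in force)
  moreover have "(\<Prod>i<n. \<phi> i (x i)) = 0" if "x \<in> euclid n - ?K" for x
  proof -
    have "\<exists>i<n. \<not> (c + d i \<le> x i \<and> x i \<le> c + 1 - d i)"
      using that by (auto simp: PiE_iff)
    then show ?thesis using d(2) by (auto simp: prod_zero_iff)
  qed
  moreover have "Ck n m (\<lambda>x. \<Prod>i<n. \<phi> i (x i))" for m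
    using \<phi> by (intro Ck_prod) (auto simp: tests_def)
  ultimately show ?thesis
    unfolding test_fun_def using compact_box[of n "\<lambda>i. c + d i" "\<lambda>i. c + 1 - d i"]
    by (intro conjI allI exI[of _ ?K] ballI)
qed

lemma cube_eq: "cube S I = completion (P S)"
  by (simp add: cube_def)

text \<open>The passage from functions measurable with respect to the completed measure to Borel versions, which
  have measurable slices.\<close>
lemma gradient_line_antiderivative:
  assumes grad: "is_gradient n I u G" and k: "k < n"
    and u': "integrable (P {..<n}) u'" "AE x in P {..<n}. u x = u' x"
    and g': "integrable (P {..<n}) g'" "AE x in P {..<n}. G k x = g' x"
  shows "AE y in P ({..<n} - {k}). integrable J (\<lambda>s. g' (y(k := s))) \<and>
    (\<exists>\<kappa>. AE t in J. u' (y(k := t)) = \<kappa> + (\<integral>s. indicator {..t} s * g' (y(k := s)) \<partial>J))"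
proof (rule AE_line_antiderivative[OF finite_lessThan _ u'(1) g'(1)])
  show "k \<in> {..<n}" using k by simp
next
  fix \<eta> :: "real \<Rightarrow> real" and \<theta> :: "nat \<Rightarrow> real \<Rightarrow> real"
  assume \<eta>: "\<eta> \<in> tests c" and \<theta>: "\<And>i. i \<in> {..<n} - {k} \<Longrightarrow> \<theta> i \<in> tests c"
  let ?C = "cube {..<n} I"
  let ?Q = "\<lambda>x :: nat \<Rightarrow> real. \<Prod>i\<in>{..<n} - {k}. \<theta> i (x i)"
  define \<phi> where "\<phi> = (\<lambda>i. if i = k then \<eta> else \<theta> i)"
  have \<phi>: "\<phi> i \<in> tests c" if "i < n" for i using \<eta> \<theta> that by (auto simp: \<phi>_def)
  have Q: "(\<Prod>i\<in>{..<n} - {k}. \<phi> i (x i)) = ?Q x" for x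
    by (intro prod.cong) (auto simp: \<phi>_def)
  have val: "(\<Prod>i<n. \<phi> i (x i)) = \<eta> (x k) * ?Q x" for x
    using prod_upd[OF k, of \<phi> x "x k"] by (simp add: Q) (simp add: \<phi>_def)
  have par: "partial k (\<lambda>x. \<Prod>i<n. \<phi> i (x i)) x = deriv \<eta> (x k) * ?Q x" for x
    using partial_prod(2)[OF k, of \<phi> x] \<phi>[OF k] by (simp add: Q tests_def) (simp add: \<phi>_def)
  have weak: "(\<integral>x. u x * (deriv \<eta> (x k) * ?Q x) \<partial>?C) = - (\<integral>x. G k x * (\<eta> (x k) * ?Q x) \<partial>?C)"
  proof -
    have "(\<integral>x. u x * partial k (\<lambda>x. \<Prod>i<n. \<phi> i (x i)) x \<partial>?C) = - (\<integral>x. G k x * (\<Prod>i<n. \<phi> i (x i)) \<partial>?C)"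
      using grad k test_fun_prod[of n \<phi>, OF \<phi>] unfolding is_gradient_def by blast
    then show ?thesis unfolding par unfolding val .
  qed
  have comp: "(\<lambda>x. x i) \<in> P {..<n} \<rightarrow>\<^sub>M J" if "i < n" for i
    by (rule measurable_component_singleton) (use that in simp)
  have tm: "(\<lambda>x. f (x i)) \<in> borel_measurable (P {..<n})" if "smooth f" "i < n" for f i
  proof -
    have "f \<in> borel_measurable borel"
      using that(1) by (intro borel_measurable_continuous_onI continuous_at_imp_continuous_on ballI smooth_continuous)
    from measurable_compose[OF comp[OF that(2)] borel_measurable_side[OF this]] show ?thesis .
  qed
  have Qm: "?Q \<in> borel_measurable (P {..<n})"
  proof (rule borel_measurable_prod)
    fix i assume "i \<in> {..<n} - {k}"
    then show "(\<lambda>x. \<theta> i (x i)) \<in> borel_measurable (P {..<n})"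
      using \<theta>[of i] by (intro tm[of "\<theta> i" i]) (auto simp: tests_def)
  qed
  have replace: "(\<integral>x. f x * h x \<partial>?C) = (\<integral>x. f' x * h x \<partial>P {..<n})"
    if f: "f \<in> borel_measurable ?C" "integrable (P {..<n}) f'" "AE x in P {..<n}. f x = f' x"
      and h: "h \<in> borel_measurable (P {..<n})" for f f' h :: "(nat \<Rightarrow> real) \<Rightarrow> real"
  proof -
    have f': "f' \<in> borel_measurable (P {..<n})" using f(2) by auto
    have "(\<integral>x. f x * h x \<partial>?C) = (\<integral>x. f' x * h x \<partial>?C)"
    proof (rule integral_cong_AE)
      show "(\<lambda>x. f x * h x) \<in> borel_measurable ?C"
        using f(1) measurable_completion[OF h] by (simp add: cube_eq)
      show "(\<lambda>x. f' x * h x) \<in> borel_measurable ?C"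
        using f' h unfolding cube_eq by (intro measurable_completion borel_measurable_times)
      show "AE x in ?C. f x * h x = f' x * h x"
        using AE_completion[OF f(3)] unfolding cube_eq by eventually_elim simp
    qed
    also have "\<dots> = (\<integral>x. f' x * h x \<partial>P {..<n})"
      unfolding cube_eq using f' h by (intro integral_completion borel_measurable_times)
    finally show ?thesis .
  qed
  have um: "u \<in> borel_measurable ?C" and gm: "G k \<in> borel_measurable ?C"
    using grad k by (auto simp: is_gradient_def loc_integrable_def)
  have h1: "(\<lambda>x. deriv \<eta> (x k) * ?Q x) \<in> borel_measurable (P {..<n})"
    by (rule borel_measurable_times[OF tm[of "deriv \<eta>" k] Qm])
      (use \<eta> k in \<open>auto simp: tests_def intro: smooth_deriv\<close>)
  have h2: "(\<lambda>x. \<eta> (x k) * ?Q x) \<in> borel_measurable (P {..<n})"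
    by (rule borel_measurable_times[OF tm[of \<eta> k] Qm]) (use \<eta> k in \<open>auto simp: tests_def\<close>)
  show "(\<integral>x. u' x * (deriv \<eta> (x k) * ?Q x) \<partial>P {..<n})
      = - (\<integral>x. g' x * (\<eta> (x k) * ?Q x) \<partial>P {..<n})"
    using weak unfolding replace[OF um u' h1] replace[OF gm g' h2] .
qed

end

section \<open>Level crossings on a line\<close>

text \<open>The point \<open>x'\<close> is the last one with value at most \<open>a\<close>, and \<open>y'\<close> is the first one after it with value at
  least \<open>b\<close>.\<close>
lemma level_crossing_left_right:
  fixes h :: "real \<Rightarrow> real"
  assumes h: "continuous_on UNIV h" and "x \<le> y" "h x \<le> a" "b \<le> h y" "a < b"
  shows "\<exists>x' y'. x \<le> x' \<and> x' < y' \<and> y' \<le> y \<and> h x' = a \<and> h y' = b \<and> (\<forall>z. x' < z \<and> z < y' \<longrightarrow> a < h z \<and> h z < b)"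
proof -
  have hc: "continuous_on A h" for A using h by (rule continuous_on_subset) simp
  define A where "A = {z \<in> {x..y}. h z \<le> a}"
  have "A = {x..y} \<inter> {z. h z \<le> a}" by (auto simp: A_def)
  then have "compact A"
    using compact_Int_closed[OF compact_Icc closed_Collect_le[OF h continuous_on_const]] by simp
  moreover have "x \<in> A" using assms(2,3) by (simp add: A_def)
  ultimately obtain x' where x': "x' \<in> A" "\<And>z. z \<in> A \<Longrightarrow> z \<le> x'"
    using compact_attains_sup[of A] by blast
  have x'y: "x \<le> x'" "x' \<le> y" "h x' \<le> a" using x'(1) by (auto simp: A_def)
  have after: "a < h z" if "x' < z" "z \<le> y" for z
    using x'(2)[of z] that x'y by (force simp: A_def)
  have "\<exists>z\<ge>x'. z \<le> y \<and> h z = a"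
    using assms(4,5) x'y by (intro IVT' hc) auto
  then obtain z where "x' \<le> z" "z \<le> y" "h z = a" by auto
  then have hx': "h x' = a" using after[of z] by (cases "z = x'") auto
  define B where "B = {z \<in> {x'..y}. b \<le> h z}"
  have "B = {x'..y} \<inter> {z. b \<le> h z}" by (auto simp: B_def)
  then have "compact B"
    using compact_Int_closed[OF compact_Icc closed_Collect_le[OF continuous_on_const h]] by simp
  moreover have "y \<in> B" using assms(4) x'y by (simp add: B_def)
  ultimately obtain y' where y': "y' \<in> B" "\<And>z. z \<in> B \<Longrightarrow> y' \<le> z"
    using compact_attains_inf[of B] by blast
  have y'y: "x' \<le> y'" "y' \<le> y" "b \<le> h y'" using y'(1) by (auto simp: B_def)
  have before: "h z < b" if "x' \<le> z" "z < y'" for z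
    using y'(2)[of z] that y'y by (force simp: B_def)
  have "\<exists>z\<ge>x'. z \<le> y' \<and> h z = b"
    using assms(5) hx' y'y by (intro IVT' hc) auto
  then obtain z where "x' \<le> z" "z \<le> y'" "h z = b" by auto
  then have hy': "h y' = b" using before[of z] by (cases "z = y'") auto
  have "x' \<noteq> y'" using hx' hy' assms(5) by auto
  then show ?thesis
    using x'y y'y hx' hy' after before by (intro exI[of _ x'] exI[of _ y']) auto
qed

lemma level_crossing:
  fixes h :: "real \<Rightarrow> real"
  assumes h: "continuous_on UNIV h" and "h x \<le> a" "b \<le> h y" "a < b"
  obtains s t where "min x y \<le> s" "s < t" "t \<le> max x y" "{h s, h t} = {a, b}"
    "\<And>z. s < z \<Longrightarrow> z < t \<Longrightarrow> a < h z \<and> h z < b"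
proof (cases "x \<le> y")
  case True
  from level_crossing_left_right[OF h True assms(2-4)] show thesis
    using True by (auto intro: that)
next
  case False
  have "continuous_on UNIV (\<lambda>z. h (- z))"
    by (rule continuous_on_compose2[OF h]) (auto intro: continuous_intros)
  from level_crossing_left_right[OF this, of "- x" "- y" a b] False assms
  obtain x' y' where *: "- x \<le> x'" "x' < y'" "y' \<le> - y" "h (- x') = a" "h (- y') = b"
    "\<And>z. x' < z \<Longrightarrow> z < y' \<Longrightarrow> a < h (- z) \<and> h (- z) < b" by auto
  show thesis
  proof (rule that[of "- y'" "- x'"])
    show "a < h z \<and> h z < b" if "- y' < z" "z < - x'" for z
      using *(6)[of "- z"] that by simp
  qed (use * False in auto)
qed

context unit_side
begin

lemma continuous_lower_segment_integral:
  fixes g :: "real \<Rightarrow> real"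
  assumes g: "integrable J g"
  shows "continuous_on UNIV (\<lambda>t. \<integral>s. indicator {..t} s * g s \<partial>J)"
proof (rule continuous_at_imp_continuous_on, rule ballI, unfold continuous_at_sequentially comp_def, intro allI impI)
  fix t :: real and X :: "nat \<Rightarrow> real" assume X: "X \<longlonglongrightarrow> t"
  have [measurable]: "g \<in> borel_measurable J" using g by auto
  show "(\<lambda>n. \<integral>s. indicator {..X n} s * g s \<partial>J) \<longlonglongrightarrow> (\<integral>s. indicator {..t} s * g s \<partial>J)"
  proof (rule integral_dominated_convergence[where w = "\<lambda>s. \<bar>g s\<bar>"])
    show "(\<lambda>s. indicator {..t} s * g s) \<in> borel_measurable J"
      and "\<And>n. (\<lambda>s. indicator {..X n} s * g s) \<in> borel_measurable J"
      using integrable_segment[OF g] by auto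
    show "integrable J (\<lambda>s. \<bar>g s\<bar>)" using g by simp
    show "AE s in J. norm (indicator {..X n} s * g s) \<le> \<bar>g s\<bar>" for n
      by (auto simp: indicator_def)
    have "AE s in J. s \<noteq> t"
      unfolding AE_side_iff using AE_lborel_singleton[of t] by eventually_elim auto
    then show "AE s in J. (\<lambda>n. indicator {..X n} s * g s) \<longlonglongrightarrow> indicator {..t} s * g s"
    proof eventually_elim
      case (elim s)
      have "eventually (\<lambda>n. indicator {..X n} s = (indicator {..t} s :: real)) sequentially"
      proof (cases "s < t")
        case True
        from order_tendstoD(1)[OF X this] show ?thesis
          by eventually_elim (use True in \<open>auto simp: indicator_def\<close>)
      next
        case False
        with elim have "t < s" by simp
        from order_tendstoD(2)[OF X this] show ?thesis
          by eventually_elim (use \<open>t < s\<close> in \<open>auto simp: indicator_def\<close>)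
      qed
      then have "eventually (\<lambda>n. indicator {..t} s * g s = indicator {..X n} s * g s) sequentially"
        by eventually_elim simp
      then show ?case by (rule Lim_transform_eventually[OF tendsto_const])
    qed
  qed
qed

text \<open>The truncation step on one line. Either \<open>\<bar>v\<bar> > a\<close> on the whole line, and the first term integrates
  to \<open>a\<close> since the side has length \<open>1\<close>; or \<open>\<bar>v\<bar>\<close> runs from \<open>a\<close> to \<open>2a\<close> inside the shell \<open>a < \<bar>v\<bar> < 2a\<close>, and the
  increment \<open>a\<close> is at most the integral of \<open>\<bar>g\<bar>\<close> over this part.\<close>
lemma level_le_slice_integral:
  assumes g: "integrable J g" and v: "v \<in> borel_measurable J"
    and eq: "AE t in J. v t = \<kappa> + (\<integral>s. indicator {..t} s * g s \<partial>J)"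
    and a: "0 < a" and large: "\<not> (AE t in J. \<bar>v t\<bar> \<le> 2 * a)"
  shows "ennreal a \<le> (\<integral>\<^sup>+t. ennreal a * indicator {t. a < \<bar>v t\<bar>} t
    + ennreal \<bar>g t\<bar> * indicator {t. a < \<bar>v t\<bar> \<and> \<bar>v t\<bar> < 2 * a} t \<partial>J)"
proof -
  define W where "W t = \<kappa> + (\<integral>s. indicator {..t} s * g s \<partial>J)" for t
  have vW: "AE t in J. v t = W t" using eq by (simp add: W_def)
  have "continuous_on UNIV W"
    unfolding W_def by (intro continuous_intros continuous_lower_segment_integral g)
  then have hc: "continuous_on UNIV (\<lambda>t. \<bar>W t\<bar>)" by (intro continuous_intros)
  have [measurable]: "g \<in> borel_measurable J" using g by auto
  note [measurable] = v
  obtain t0 where t0: "c < t0" "t0 < c + 1" "2 * a < \<bar>W t0\<bar>"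
  proof -
    have False if "\<And>t. c < t \<Longrightarrow> t < c + 1 \<Longrightarrow> \<bar>W t\<bar> \<le> 2 * a"
    proof -
      have "AE t in J. \<bar>v t\<bar> \<le> 2 * a"
        using AE_side_interior vW by eventually_elim (use that in auto)
      then show False using large by simp
    qed
    then show thesis using that by (meson not_le)
  qed
  show ?thesis
  proof (cases "\<forall>s. c < s \<and> s < c + 1 \<longrightarrow> a < \<bar>W s\<bar>")
    case True
    have "ennreal a = (\<integral>\<^sup>+t. ennreal a \<partial>J)" using emeasure_space_1 by simp
    also have "\<dots> \<le> (\<integral>\<^sup>+t. ennreal a * indicator {t. a < \<bar>v t\<bar>} t
      + ennreal \<bar>g t\<bar> * indicator {t. a < \<bar>v t\<bar> \<and> \<bar>v t\<bar> < 2 * a} t \<partial>J)"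
    proof (rule nn_integral_mono_AE)
      show "AE t in J. ennreal a \<le> ennreal a * indicator {t. a < \<bar>v t\<bar>} t
          + ennreal \<bar>g t\<bar> * indicator {t. a < \<bar>v t\<bar> \<and> \<bar>v t\<bar> < 2 * a} t"
        using vW AE_side_interior
        by eventually_elim (use True in \<open>simp add: indicator_def\<close>)
    qed
    finally show ?thesis .
  next
    case False
    then obtain s0 where s0: "c < s0" "s0 < c + 1" "\<bar>W s0\<bar> \<le> a" by (auto simp: not_less)
    obtain s t where st: "min s0 t0 \<le> s" "s < t" "t \<le> max s0 t0" "{\<bar>W s\<bar>, \<bar>W t\<bar>} = {a, 2 * a}"
      "\<And>z. s < z \<Longrightarrow> z < t \<Longrightarrow> a < \<bar>W z\<bar> \<and> \<bar>W z\<bar> < 2 * a"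
      using level_crossing[OF hc, of s0 a "2 * a" t0] s0 t0 a by (smt (verit, ccfv_threshold))
    have diff: "W t - W s = (\<integral>z. indicator {s<..t} z * g z \<partial>J)"
    proof -
      have "(\<integral>z. indicator {s<..t} z * g z \<partial>J) = (\<integral>z. indicator {..t} z * g z - indicator {..s} z * g z \<partial>J)"
        using st(2) by (intro Bochner_Integration.integral_cong) (auto simp: indicator_def)
      also have "\<dots> = W t - W s"
        by (subst Bochner_Integration.integral_diff) (auto intro!: integrable_segment g simp: W_def)
      finally show ?thesis by simp
    qed
    have "a \<le> \<bar>W t - W s\<bar>" using st(4) a by (auto simp: doubleton_eq_iff)
    then have "ennreal a \<le> ennreal (norm (W t - W s))" by (auto intro: ennreal_leI)
    also have "\<dots> \<le> (\<integral>\<^sup>+z. ennreal (norm (indicator {s<..t} z * g z)) \<partial>J)"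
      unfolding diff by (intro integral_norm_bound_ennreal integrable_segment g) simp
    also have "\<dots> \<le> (\<integral>\<^sup>+t. ennreal a * indicator {t. a < \<bar>v t\<bar>} t
      + ennreal \<bar>g t\<bar> * indicator {t. a < \<bar>v t\<bar> \<and> \<bar>v t\<bar> < 2 * a} t \<partial>J)"
    proof (rule nn_integral_mono_AE)
      have "AE z in J. z \<noteq> t"
        unfolding AE_side_iff using AE_lborel_singleton[of t] by eventually_elim auto
      then show "AE z in J. ennreal (norm (indicator {s<..t} z * g z)) \<le> ennreal a * indicator {t. a < \<bar>v t\<bar>} z
          + ennreal \<bar>g z\<bar> * indicator {t. a < \<bar>v t\<bar> \<and> \<bar>v t\<bar> < 2 * a} z"
        using vW
      proof eventually_elim
        case (elim z)
        then show ?case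
          using st(5)[of z] by (cases "s < z \<and> z < t") (auto simp: indicator_def)
      qed
    qed
    finally show ?thesis .
  qed
qed

end

section \<open>Dyadic sums\<close>

text \<open>A geometric sum with ratio \<open>2\<^sup>p \<ge> 2\<close>, bounded by twice its last term. The induction also carries the
  bound by the first term that is not summed.\<close>
lemma sum_dyadic_levels_le:
  fixes N p x :: real
  assumes "1 \<le> p" "0 < N" "0 \<le> x"
  shows "(\<Sum>j<m. if 2 ^ j * N < x then (2 ^ j * N) powr p else 0) \<le> 2 * x powr p"
proof -
  let ?T = "\<lambda>m. \<Sum>j<m. if 2 ^ j * N < x then (2 ^ j * N) powr p else 0"
  have "?T m \<le> (2 ^ m * N) powr p \<and> ?T m \<le> 2 * x powr p"
  proof (induction m)
    case 0 show ?case by simp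
  next
    case (Suc m)
    have "2 * (2 ^ m * N) powr p \<le> 2 powr p * (2 ^ m * N) powr p"
      using powr_mono[of 1 p 2] assms by (intro mult_right_mono) auto
    also have "\<dots> = (2 ^ Suc m * N) powr p" using assms by (simp add: powr_mult mult.assoc)
    finally have d: "2 * (2 ^ m * N) powr p \<le> (2 ^ Suc m * N) powr p" .
    show ?case
    proof (cases "2 ^ m * N < x")
      case True
      then have "(2 ^ m * N) powr p \<le> x powr p" using assms by (intro powr_mono2) auto
      then show ?thesis using Suc d True by simp
    next
      case False
      then show ?thesis using Suc d by (smt (verit) sum.lessThan_Suc powr_ge_zero)
    qed
  qed
  then show ?thesis by simp
qed

lemma sum_dyadic_shells_le:
  fixes N h x :: real
  assumes "0 < N" "0 \<le> h"
  shows "(\<Sum>j<m. if 2 ^ j * N < x \<and> x < 2 ^ Suc j * N then h else 0) \<le> h"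
proof -
  let ?T = "\<lambda>m. \<Sum>j<m. if 2 ^ j * N < x \<and> x < 2 ^ Suc j * N then h else 0"
  have "?T m \<le> (if x < 2 ^ m * N then h else 0)"
  proof (induction m)
    case 0 show ?case using assms by simp
  next
    case (Suc m)
    have lt: "2 ^ m * N < 2 ^ Suc m * N" using assms by simp
    show ?case
    proof (cases "x < 2 ^ m * N")
      case True
      moreover from this lt have "x < 2 ^ Suc m * N" by linarith
      ultimately show ?thesis using Suc by simp
    next
      case False
      then show ?thesis using Suc assms by simp
    qed
  qed
  then show ?thesis using assms by (auto split: if_splits)
qed

text \<open>With \<open>\<sigma> = p/r\<close> for the first exponent \<open>r = p(n - 1)/(n - p)\<close>, the number \<open>q\<close> solves
  \<open>2\<^sup>p q\<^sup>\<sigma> = 1/2\<close>: if a shadow shrinks by the factor \<open>q\<close> from one level to the next, then its term in the dyadic sum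
  is halved.\<close>
definition dyadic_const :: "nat \<Rightarrow> real \<Rightarrow> real" where
  "dyadic_const n p = (let \<sigma> = (n - p) / (real n - 1); q = 2 powr (- (p + 1) / \<sigma>); \<nu> = n / (real n - 1)
    in 2 + 6 * (2 powr (p + 1) * (q powr \<nu> / 4) powr (1 - p)))"

lemma dyadic_const_nonneg: "0 \<le> dyadic_const n p"
  by (simp add: dyadic_const_def Let_def)

text \<open>Here \<open>A j\<close> is the measure of \<open>{\<bar>u\<bar> > a}\<close> and \<open>b j\<close> the largest measure of its shadows, for \<open>a = 2\<^sup>j N\<close>, and
  \<open>G j\<close> collects the \<open>p\<close>th powers of \<open>a\<close> and \<open>\<bar>\<nabla>u\<bar>\<close> over \<open>{\<bar>u\<bar> > a}\<close> and its shell. If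
  \<open>b (Suc j) < q b j\<close>, the term \<open>D (Suc j)\<close> of the sum is at most half of \<open>D j\<close>. Otherwise \<open>A j\<close> is controlled
  by a power of \<open>b (Suc j)\<close>, so \<open>\<delta>\<close> can be chosen such that \<open>2\<delta>A j\<close> is absorbed in the left-hand side of
  the recursion, and \<open>D (Suc j)\<close> is at most a multiple of \<open>G j\<close>. Summing absorbs half of the sum
  in itself.\<close>
lemma dyadic_recursion_bound:
  fixes n m :: nat and p N :: real and b A G :: "nat \<Rightarrow> real"
  assumes n: "2 \<le> n" and p: "1 \<le> p" "p < n"
    and N: "0 < N" and b: "\<And>j. 0 \<le> b j" "\<And>j. b j \<le> 1" and A: "\<And>j. 0 \<le> A j"
    and lw: "\<And>j. A j ^ (n - 1) \<le> b j ^ n"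
    and rec: "\<And>j \<delta>. 0 < \<delta> \<Longrightarrow> (2 ^ j * N) * b (Suc j) \<le> 2 * \<delta> * A j + \<delta> powr (1 - p) * G j"
    and G: "\<And>j. 0 \<le> G j" "\<And>m. (\<Sum>j<m. G j) \<le> 3 * N powr p"
  shows "(\<Sum>j<m. (2 ^ j * N) powr p * b j powr ((n - p) / (real n - 1))) \<le> dyadic_const n p * N powr p"
proof -
  define \<sigma> where "\<sigma> = (n - p) / (real n - 1)"
  define \<nu> where "\<nu> = n / (real n - 1)"
  have n1: "0 < real n - 1" using n by simp
  have \<sigma>: "0 < \<sigma>" using n1 p by (simp add: \<sigma>_def)
  define q where "q = 2 powr (- (p + 1) / \<sigma>)"
  have q: "0 < q" "2 powr p * q powr \<sigma> = 1 / 2"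
    using \<sigma> by (simp_all add: q_def powr_powr powr_add[symmetric] powr_minus_divide)
  define K where "K = 2 powr (p + 1) * (q powr \<nu> / 4) powr (1 - p)"
  have K: "0 \<le> K" by (simp add: K_def)
  have const: "dyadic_const n p = 2 + 6 * K"
    by (simp add: dyadic_const_def Let_def K_def q_def \<sigma>_def \<nu>_def)
  define D where "D j = (2 ^ j * N) powr p * b j powr \<sigma>" for j
  have D0: "0 \<le> D j" for j by (simp add: D_def)
  have step: "D (Suc j) \<le> D j / 2 + K * G j" for j
  proof -
    define a where "a = 2 ^ j * N"
    have a: "0 < a" using N by (simp add: a_def)
    have DS: "D (Suc j) = 2 powr p * (a powr p * b (Suc j) powr \<sigma>)"
      using a by (simp add: D_def a_def powr_mult mult.assoc)
    show ?thesis
    proof (cases "b (Suc j) < q * b j")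
      case True
      then have "b (Suc j) powr \<sigma> \<le> (q * b j) powr \<sigma>" using b \<sigma> by (intro powr_mono2) auto
      also have "\<dots> = q powr \<sigma> * b j powr \<sigma>" using q b by (simp add: powr_mult)
      finally have "D (Suc j) \<le> 2 powr p * (a powr p * (q powr \<sigma> * b j powr \<sigma>))"
        unfolding DS by (intro mult_left_mono) auto
      also have "\<dots> = (2 powr p * q powr \<sigma>) * D j" by (simp add: D_def a_def mult_ac)
      also have "\<dots> = D j / 2" by (simp add: q)
      finally show ?thesis using K G(1)[of j] by (smt (verit) mult_nonneg_nonneg)
    next
      case False
      show ?thesis
      proof (cases "b (Suc j) = 0")
        case True
        then show ?thesis using K G(1)[of j] D0[of j] by (simp add: DS)
      next
        case nz: False
        define \<beta> where "\<beta> = b (Suc j)"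
        have \<beta>: "0 < \<beta>" using nz b(1)[of "Suc j"] by (simp add: \<beta>_def)
        have bj: "b j \<le> \<beta> / q" using False q by (simp add: \<beta>_def field_simps not_less)
        have Aj: "A j \<le> (\<beta> / q) powr \<nu>"
        proof -
          have m: "real n - 1 = real (n - 1)" "n - 1 \<noteq> 0" using n by auto
          have "A j = (A j ^ (n - 1)) powr (1 / (real n - 1))"
          proof (cases "A j = 0")
            case True then show ?thesis using n by (simp add: zero_power)
          next
            case False
            then have "0 < A j" using A[of j] by simp
            then have "(A j ^ (n - 1)) powr (1 / real (n - 1)) = A j"
              using m(2) by (subst powr_realpow[symmetric]) (simp_all add: powr_powr)
            then show ?thesis unfolding m(1) by simp
          qed
          also have "\<dots> \<le> ((\<beta> / q) ^ n) powr (1 / (real n - 1))"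
            using lw[of j] power_mono[OF bj b(1), of n] A n1 by (intro powr_mono2) auto
          also have "\<dots> = (\<beta> / q) powr \<nu>"
            using \<beta> q by (subst powr_realpow[symmetric]) (simp_all add: powr_powr \<nu>_def)
          finally show ?thesis .
        qed
        \<comment> \<open>chosen such that 2 * \<delta> * A j \<le> a * \<beta> / 2\<close>
        define \<delta> where "\<delta> = a * (q powr \<nu> / 4) * \<beta> powr (- 1 / (real n - 1))"
        have \<delta>: "0 < \<delta>" using a q \<beta> by (simp add: \<delta>_def)
        have \<nu>1: "\<nu> + - 1 / (real n - 1) = 1" 
        proof -
          have "\<nu> + - 1 / (real n - 1) = (real n - 1) / (real n - 1)"
            unfolding \<nu>_def by (subst diff_divide_distrib) simp
          then show ?thesis using n1 by simp
        qed
        have "2 * \<delta> * A j \<le> 2 * \<delta> * (\<beta> / q) powr \<nu>"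
          using \<delta> Aj by (intro mult_left_mono) auto
        also have "\<dots> = a / 2 * (\<beta> powr \<nu> * \<beta> powr (- 1 / (real n - 1)))"
          using \<beta> q by (simp add: \<delta>_def powr_divide)
        also have "\<dots> = a / 2 * \<beta>"
          using \<beta> by (subst powr_add[symmetric], subst \<nu>1) simp
        finally have "a * \<beta> / 2 \<le> \<delta> powr (1 - p) * G j"
          using rec[OF \<delta>, of j] by (simp add: a_def \<beta>_def)
        also have "\<delta> powr (1 - p) = a powr (1 - p) * (q powr \<nu> / 4) powr (1 - p) * \<beta> powr ((p - 1) / (real n - 1))"
        proof -
          have "- 1 / (real n - 1) * (1 - p) = (p - 1) / (real n - 1)" using n1 by (simp add: field_simps)
          moreover have "\<delta> powr (1 - p) = (a * (q powr \<nu> / 4)) powr (1 - p) * (\<beta> powr (- 1 / (real n - 1))) powr (1 - p)"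
            unfolding \<delta>_def by (rule powr_mult)
          moreover have "(a * (q powr \<nu> / 4)) powr (1 - p) = a powr (1 - p) * (q powr \<nu> / 4) powr (1 - p)"
            by (rule powr_mult)
          ultimately show ?thesis by (simp only: powr_powr)
        qed
        finally have "a powr (p - 1) * \<beta> powr (- ((p - 1) / (real n - 1))) * (a * \<beta> / 2)
          \<le> a powr (p - 1) * \<beta> powr (- ((p - 1) / (real n - 1))) * (a powr (1 - p) * (q powr \<nu> / 4) powr (1 - p) * \<beta> powr ((p - 1) / (real n - 1)) * G j)"
          by (intro mult_left_mono) auto
        also have "\<dots> = (a powr (p - 1) * a powr (1 - p)) * (\<beta> powr (- ((p - 1) / (real n - 1))) * \<beta> powr ((p - 1) / (real n - 1))) * ((q powr \<nu> / 4) powr (1 - p) * G j)"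
          by (simp only: mult_ac)
        also have "\<dots> = (q powr \<nu> / 4) powr (1 - p) * G j"
          using a \<beta> by (simp add: powr_add[symmetric])
        finally have "(a powr (p - 1) * a) * (\<beta> powr (- ((p - 1) / (real n - 1))) * \<beta>) / 2 \<le> (q powr \<nu> / 4) powr (1 - p) * G j"
          by (simp add: mult_ac)
        moreover have "a powr (p - 1) * a = a powr p" using a by (simp add: powr_mult_base mult.commute)
        moreover have "\<beta> powr (- ((p - 1) / (real n - 1))) * \<beta> = \<beta> powr \<sigma>"
        proof -
          have "1 + - ((p - 1) / (real n - 1)) = \<sigma>" using n1 by (simp add: \<sigma>_def field_simps)
          then show ?thesis using \<beta> by (simp add: powr_mult_base mult.commute)
        qed
        ultimately have "a powr p * \<beta> powr \<sigma> \<le> 2 * ((q powr \<nu> / 4) powr (1 - p) * G j)" by simp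
        then have "D (Suc j) \<le> 2 powr p * (2 * ((q powr \<nu> / 4) powr (1 - p) * G j))"
          unfolding DS \<beta>_def[symmetric] by (intro mult_left_mono) auto
        also have "\<dots> = K * G j" by (simp add: K_def powr_add mult_ac)
        finally show ?thesis using D0[of j] by simp
      qed
    qed
  qed
  have Dz: "D 0 \<le> N powr p"
  proof -
    have "b 0 powr \<sigma> \<le> 1" using b \<sigma> by (intro powr_le1) auto
    then show ?thesis by (simp add: D_def mult_left_le)
  qed
  have "(\<Sum>j<Suc m. D j) \<le> (2 + 6 * K) * N powr p"
  proof -
    have "(\<Sum>j<Suc m. D j) = D 0 + (\<Sum>j<m. D (Suc j))" by (rule sum.lessThan_Suc_shift)
    also have "(\<Sum>j<m. D (Suc j)) \<le> (\<Sum>j<m. D j / 2 + K * G j)" by (intro sum_mono step)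
    also have "\<dots> = (\<Sum>j<m. D j) / 2 + K * (\<Sum>j<m. G j)"
      by (simp add: sum.distrib sum_divide_distrib sum_distrib_left)
    also have "K * (\<Sum>j<m. G j) \<le> K * (3 * N powr p)" using K G(2) by (intro mult_left_mono)
    finally have "(\<Sum>j<Suc m. D j) \<le> N powr p + (\<Sum>j<m. D j) / 2 + K * (3 * N powr p)" using Dz by simp
    moreover have "(\<Sum>j<m. D j) \<le> (\<Sum>j<Suc m. D j)" using D0 by simp
    ultimately show ?thesis by (simp add: algebra_simps)
  qed
  moreover have "(\<Sum>j<m. D j) \<le> (\<Sum>j<Suc m. D j)" using D0[of m] by simp
  ultimately have "(\<Sum>j<m. D j) \<le> (2 + 6 * K) * N powr p" by linarith
  then show ?thesis
    by (simp add: D_def \<sigma>_def const)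
qed

text \<open>On \<open>2\<^sup>j N \<le> s < 2\<^sup>j\<^sup>+\<^sup>1 N\<close> the distribution function is at most \<open>b j\<close>, and on \<open>s < N\<close> it is at most \<open>1\<close>.\<close>
lemma (in prob_space) lorentz_norm_le_dyadic:
  assumes f: "f \<in> borel_measurable M" and p: "1 \<le> p" and r: "0 < r" and N: "0 < N" and C: "0 \<le> C"
    and b: "\<And>j. distr_fun M f (2 ^ j * N) \<le> ennreal (b j)" "\<And>j. 0 \<le> b j"
    and sum: "\<And>m. (\<Sum>j<m. (2 ^ j * N) powr p * b j powr (p / r)) \<le> C * N powr p"
  shows "lorentz_norm (ennreal r) (ennreal p) M f \<le> ennreal ((r / p + r * 2 powr p * C) powr (1 / p) * N)"
proof -
  define \<sigma> where "\<sigma> = p / r"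
  have \<sigma>: "0 < \<sigma>" using p r by (simp add: \<sigma>_def)
  define t where "t j = r * (2 ^ Suc j * N) powr (p - 1) * b j powr \<sigma>" for j
  have t0: "0 \<le> t j" for j using r by (simp add: t_def)
  have pt: "ennreal (r * s powr (p - 1)) * epow (distr_fun M f s) \<sigma> * indicator {0<..} s
      \<le> ennreal (r / p) * (ennreal (p * s powr (p - 1)) * indicator {0<..<N} s)
        + (\<Sum>j. ennreal (t j) * indicator {2 ^ j * N..<2 ^ Suc j * N} s)" for s
  proof (cases "0 < s")
    case False then show ?thesis by simp
  next
    case s: True
    show ?thesis
    proof (cases "s < N")
      case True
      have "epow (distr_fun M f s) \<sigma> \<le> epow 1 \<sigma>"
        using \<sigma> by (intro epow_mono) (simp_all add: distr_fun_def emeasure_le_1)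
      also have "epow 1 \<sigma> = 1" using epow_ennreal[of 1 \<sigma>] by simp
      finally have "ennreal (r * s powr (p - 1)) * epow (distr_fun M f s) \<sigma> \<le> ennreal (r * s powr (p - 1)) * 1"
        by (intro mult_left_mono) auto
      also have "\<dots> = ennreal (r / p) * ennreal (p * s powr (p - 1))"
        using r p by (simp add: ennreal_mult[symmetric])
      finally show ?thesis using True s by (simp add: add_increasing2)
    next
      case False
      define k where "k = (LEAST j. s < 2 ^ Suc j * N)"
      have "\<exists>j. s < 2 ^ Suc j * N"
      proof -
        obtain j where "s / N < 2 ^ j" using real_arch_pow[of 2 "s / N"] by auto
        then have "s < 2 ^ j * N" using N by (simp add: field_simps)
        also have "\<dots> \<le> 2 ^ Suc j * N" using N by simp
        finally show ?thesis by blast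
      qed
      then have k1: "s < 2 ^ Suc k * N" unfolding k_def by (rule LeastI_ex)
      have k2: "2 ^ k * N \<le> s"
      proof (cases k)
        case 0 then show ?thesis using False by simp
      next
        case (Suc i)
        then have "i < k" by simp
        then have "\<not> s < 2 ^ Suc i * N" unfolding k_def by (rule not_less_Least)
        then show ?thesis using Suc by simp
      qed
      have "epow (distr_fun M f s) \<sigma> \<le> epow (ennreal (b k)) \<sigma>"
        using order_trans[OF distr_fun_antimono[OF f k2] b(1)] \<sigma> by (intro epow_mono) auto
      moreover have "r * s powr (p - 1) \<le> r * (2 ^ Suc k * N) powr (p - 1)"
        using r k1 s p by (intro mult_left_mono powr_mono2) auto
      ultimately have "ennreal (r * s powr (p - 1)) * epow (distr_fun M f s) \<sigma>
          \<le> ennreal (r * (2 ^ Suc k * N) powr (p - 1)) * epow (ennreal (b k)) \<sigma>"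
        by (intro mult_mono) (simp_all only: ennreal_leI zero_le)
      also have "\<dots> = ennreal (t k)"
        using r b(2)[of k] by (simp add: t_def epow_ennreal ennreal_mult[symmetric])
      also have "\<dots> = (\<Sum>j\<in>{k}. ennreal (t j) * indicator {2 ^ j * N..<2 ^ Suc j * N} s)"
        using k1 k2 by simp
      also have "\<dots> \<le> (\<Sum>j. ennreal (t j) * indicator {2 ^ j * N..<2 ^ Suc j * N} s)"
        by (rule sum_le_suminf) auto
      finally show ?thesis using s by (simp add: add_increasing)
    qed
  qed
  have "(\<integral>\<^sup>+s. ennreal (r * s powr (p - 1)) * epow (distr_fun M f s) \<sigma> * indicator {0<..} s \<partial>lborel)
      \<le> (\<integral>\<^sup>+s. ennreal (r / p) * (ennreal (p * s powr (p - 1)) * indicator {0<..<N} s)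
        + (\<Sum>j. ennreal (t j) * indicator {2 ^ j * N..<2 ^ Suc j * N} s) \<partial>lborel)"
    by (intro nn_integral_mono pt)
  also have "\<dots> = ennreal (r / p) * ennreal (N powr p)
      + (\<integral>\<^sup>+s. (\<Sum>j. ennreal (t j) * indicator {2 ^ j * N..<2 ^ Suc j * N} s) \<partial>lborel)"
    using p N by (subst nn_integral_add) (simp_all add: nn_integral_cmult nn_integral_powr_from_0)
  also have "(\<integral>\<^sup>+s. (\<Sum>j. ennreal (t j) * indicator {2 ^ j * N..<2 ^ Suc j * N} s) \<partial>lborel)
      = (\<Sum>j. ennreal (t j * (2 ^ j * N)))"
  proof (subst nn_integral_suminf)
    have "(\<integral>\<^sup>+s. ennreal (t j) * indicator {2 ^ j * N..<2 ^ Suc j * N} s \<partial>lborel) = ennreal (t j * (2 ^ j * N))" for j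
      using N t0[of j] by (simp add: nn_integral_cmult_indicator ennreal_mult[symmetric])
    then show "(\<Sum>j. \<integral>\<^sup>+s. ennreal (t j) * indicator {2 ^ j * N..<2 ^ Suc j * N} s \<partial>lborel)
      = (\<Sum>j. ennreal (t j * (2 ^ j * N)))" by simp
  qed simp
  also have "\<dots> \<le> ennreal (r * 2 powr p * (C * N powr p))"
  proof (rule suminf_le_const)
    fix m
    have tj: "t j * (2 ^ j * N) \<le> r * 2 powr p * ((2 ^ j * N) powr p * b j powr \<sigma>)" for j
    proof -
      have "(2 ^ Suc j * N) powr (p - 1) * (2 ^ j * N) \<le> (2 ^ Suc j * N) powr (p - 1) * (2 ^ Suc j * N)"
        using N by (intro mult_left_mono) auto
      also have "\<dots> = (2 ^ Suc j * N) powr p" using N by (simp add: powr_mult_base mult.commute)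
      also have "\<dots> = 2 powr p * (2 ^ j * N) powr p" using N by (simp add: powr_mult mult.assoc)
      finally have "(r * b j powr \<sigma>) * ((2 ^ Suc j * N) powr (p - 1) * (2 ^ j * N)) \<le> (r * b j powr \<sigma>) * (2 powr p * (2 ^ j * N) powr p)"
        using r by (intro mult_left_mono) auto
      then show ?thesis by (simp add: t_def mult_ac)
    qed
    have "(\<Sum>j<m. ennreal (t j * (2 ^ j * N))) = ennreal (\<Sum>j<m. t j * (2 ^ j * N))"
      using t0 N by (intro sum_ennreal) auto
    also have "\<dots> \<le> ennreal (\<Sum>j<m. r * 2 powr p * ((2 ^ j * N) powr p * b j powr \<sigma>))"
      by (intro ennreal_leI sum_mono tj)
    also have "\<dots> \<le> ennreal (r * 2 powr p * (C * N powr p))"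
      unfolding sum_distrib_left[symmetric] using sum[of m] r
      by (intro ennreal_leI mult_left_mono) (auto simp: \<sigma>_def)
    finally show "(\<Sum>j<m. ennreal (t j * (2 ^ j * N))) \<le> ennreal (r * 2 powr p * (C * N powr p))" .
  qed simp
  finally have le: "(\<integral>\<^sup>+s. ennreal (r * s powr (p - 1)) * epow (distr_fun M f s) \<sigma> * indicator {0<..} s \<partial>lborel)
      \<le> ennreal ((r / p + r * 2 powr p * C) * N powr p)"
    using r p C by (simp add: ennreal_mult[symmetric] ennreal_plus[symmetric] algebra_simps del: ennreal_plus)
  have "lorentz_norm (ennreal r) (ennreal p) M f \<le> epow (ennreal ((r / p + r * 2 powr p * C) * N powr p)) (1 / p)"
    unfolding lorentz_norm_distribution[OF f less_le_trans[OF zero_less_one p] r]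
    using le p by (intro epow_mono) (auto simp: \<sigma>_def)
  also have "\<dots> = ennreal ((r / p + r * 2 powr p * C) powr (1 / p) * N)"
    using r p C N by (simp add: epow_ennreal powr_mult powr_powr)
  finally show ?thesis .
qed

section \<open>Essential suprema along lines\<close>

lemma borel_measurable_completion_AE:
  fixes f g :: "'a \<Rightarrow> ennreal"
  assumes f: "f \<in> borel_measurable (completion N)" and eq: "AE x in N. f x = g x"
  shows "g \<in> borel_measurable (completion N)"
proof (rule measurableI)
  fix A :: "ennreal set" assume A: "A \<in> sets borel"
  have "AE x in completion N. x \<in> f -` A \<inter> space (completion N) \<longleftrightarrow> x \<in> g -` A \<inter> space (completion N)"
    using AE_completion[OF eq] by eventually_elim auto
  then show "g -` A \<inter> space (completion N) \<in> sets (completion N)"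
    by (rule completion.in_sets_AE[OF _ measurable_sets[OF f A]]) auto
qed auto

lemma distr_fun_completion:
  assumes f: "f \<in> borel_measurable N" and eq: "AE x in N. f x = g x"
  shows "distr_fun (completion N) g s = emeasure N {x \<in> space N. f x > ennreal s}"
proof -
  have g: "g \<in> borel_measurable (completion N)"
    by (rule borel_measurable_completion_AE[OF measurable_completion[OF f] eq])
  have A: "{x \<in> space N. f x > ennreal s} \<in> sets N" using f by measurable
  have B: "{x \<in> space (completion N). g x > ennreal s} \<in> sets (completion N)" using g by measurable
  have "emeasure (completion N) {x \<in> space (completion N). g x > ennreal s}
      = emeasure (completion N) {x \<in> space N. f x > ennreal s}"
    by (rule emeasure_eq_AE) (use AE_completion[OF eq] A B in \<open>auto elim!: eventually_mono\<close>)
  also have "\<dots> = emeasure N {x \<in> space N. f x > ennreal s}"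
    using A by simp
  finally show ?thesis by (simp add: distr_fun_def)
qed

context unit_side
begin

lemma AE_lebesgue_on_iff: "(AE t in lebesgue_on I. Q t) \<longleftrightarrow> (AE t in J. Q t)"
  using side_borel by (simp add: AE_restrict_space_iff AE_completion_iff)

text \<open>The essential supremum is \<open>\<infinity>\<close> for nonmeasurable functions, so the line has to carry a measurable version
  \<open>v\<close> of the function.\<close>
lemma less_psi_iff:
  assumes v: "v \<in> borel_measurable J" and eq: "AE t in J. f (y(k := t)) = v t" and s: "0 \<le> s"
  shows "ennreal s < psi I (Lp_norm \<infinity>) k f y \<longleftrightarrow> \<not> (AE t in J. \<bar>v t\<bar> \<le> s)"
proof -
  let ?h = "eabs (\<lambda>t. f (y(k := t)))"
  have m: "?h \<in> borel_measurable (lebesgue_on I)"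
  proof (subst borel_measurable_restrict_space_iff_ennreal)
    show "I \<inter> space lebesgue \<in> sets lebesgue" using side_borel by auto
    have "(\<lambda>t. ennreal \<bar>v t\<bar>) \<in> borel_measurable J" using v by measurable
    then have "(\<lambda>t. ennreal \<bar>v t\<bar> * indicator I t) \<in> borel_measurable lborel"
      by (subst (asm) borel_measurable_restrict_space_iff_ennreal[OF side_inter])
    then have m: "(\<lambda>t. ennreal \<bar>v t\<bar> * indicator I t) \<in> borel_measurable lebesgue"
      by (rule measurable_completion)
    have "AE t in lborel. t \<in> I \<longrightarrow> f (y(k := t)) = v t"
      using eq unfolding AE_restrict_space_iff[OF side_inter] .
    then have "AE t in lborel. ennreal \<bar>v t\<bar> * indicator I t = ?h t * indicator I t"
      by eventually_elim (auto simp: eabs_def indicator_def)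
    then show "(\<lambda>t. ?h t * indicator I t) \<in> borel_measurable lebesgue"
      by (rule borel_measurable_completion_AE[OF m])
  qed
  have "(AE t in J. \<bar>v t\<bar> \<le> s) \<longleftrightarrow> (AE t in lebesgue_on I. ?h t \<le> ennreal s)"
    unfolding AE_lebesgue_on_iff
    by (rule eventually_cong[OF eq]) (use s in \<open>simp add: eabs_def ennreal_le_iff\<close>)
  also have "\<dots> \<longleftrightarrow> esssup (lebesgue_on I) ?h \<le> ennreal s"
  proof
    assume "esssup (lebesgue_on I) ?h \<le> ennreal s"
    moreover have "AE t in lebesgue_on I. ?h t \<le> esssup (lebesgue_on I) ?h" by (rule esssup_AE)
    ultimately show "AE t in lebesgue_on I. ?h t \<le> ennreal s" by (auto elim!: eventually_mono)
  qed (rule esssup_I[OF m])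
  finally show ?thesis by (simp add: psi_def Lp_norm_def not_le)
qed

text \<open>The base points over which the line in direction \<open>k\<close> meets \<open>{s < \<bar>f\<bar>}\<close> in positive measure; up to a null
  set this is \<open>{s < \<psi>\<^sub>k f}\<close>.\<close>
definition shadow :: "nat set \<Rightarrow> ((nat \<Rightarrow> real) \<Rightarrow> real) \<Rightarrow> nat \<Rightarrow> real \<Rightarrow> (nat \<Rightarrow> real) set" where
  "shadow S f k s = {y \<in> space (P (S - {k})). \<not> (AE t in J. \<bar>f (y(k := t))\<bar> \<le> s)}"

lemma line_measurable:
  assumes f: "f \<in> borel_measurable (P S)" and k: "k \<in> S" and y: "y \<in> space (P (S - {k}))"
  shows "(\<lambda>t. f (y(k := t))) \<in> borel_measurable J"
  using measurable_compose[OF measurable_Pair1'[OF y] measurable_slice[OF f k]] by simp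

lemma shadow_sets:
  fixes f :: "(nat \<Rightarrow> real) \<Rightarrow> real"
  assumes f: "f \<in> borel_measurable (P S)" and k: "k \<in> S"
  shows "shadow S f k s \<in> sets (P (S - {k}))"
proof -
  interpret N: prob_space "P (S - {k})" by (rule prob_P)
  define h where "h x = (if s < \<bar>f x\<bar> then 1 else 0 :: ennreal)" for x
  have hm: "h \<in> borel_measurable (P S)" unfolding h_def using f by measurable
  define H where "H y = (\<integral>\<^sup>+t. h (y(k := t)) \<partial>J)" for y
  have "H \<in> borel_measurable (P (S - {k}))"
    unfolding H_def[abs_def] using measurable_slice[OF hm k] by (intro borel_measurable_nn_integral)
  then have "{y \<in> space (P (S - {k})). H y \<noteq> 0} \<in> sets (P (S - {k}))" by measurable
  moreover have "H y = 0 \<longleftrightarrow> (AE t in J. \<bar>f (y(k := t))\<bar> \<le> s)" if y: "y \<in> space (P (S - {k}))" for y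
  proof -
    have "H y = 0 \<longleftrightarrow> (AE t in J. h (y(k := t)) = 0)"
      unfolding H_def
      by (rule nn_integral_0_iff_AE) (use measurable_compose[OF measurable_Pair1'[OF y] measurable_slice[OF hm k]] in simp)
    also have "\<dots> \<longleftrightarrow> (AE t in J. \<bar>f (y(k := t))\<bar> \<le> s)"
      by (intro eventually_cong AE_I2) (auto simp: h_def)
    finally show ?thesis .
  qed
  ultimately show ?thesis unfolding shadow_def by (smt (verit, best) Collect_cong)
qed

text \<open>The superlevel sets of \<open>\<psi>\<^sub>k f\<close> agree with the shadows up to null sets, because the line over almost every
  base point carries the Borel version of \<open>f\<close>; they are measurable as the cube is complete.\<close>
lemma psi_measurable_distr:
  assumes S: "finite S" "k \<in> S" and f': "f' \<in> borel_measurable (P S)" and eq: "AE x in P S. f x = f' x"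
  shows "psi I (Lp_norm \<infinity>) k f \<in> borel_measurable (cube (S - {k}) I)"
    and "0 \<le> s \<Longrightarrow> distr_fun (cube (S - {k}) I) (psi I (Lp_norm \<infinity>) k f) s = emeasure (P (S - {k})) (shadow S f' k s)"
proof -
  let ?N = "P (S - {k})" and ?\<psi> = "psi I (Lp_norm \<infinity>) k f"
  have C: "cube (S - {k}) I = completion ?N" by (simp add: cube_def)
  have "AE y in ?N. AE t in J. f (y(k := t)) = f' (y(k := t))"
    by (rule AE_slice[OF S eq])
  then have iff: "AE y in ?N. \<forall>s\<ge>0. ennreal s < ?\<psi> y \<longleftrightarrow> y \<in> shadow S f' k s"
    using AE_space
  proof eventually_elim
    case (elim y)
    show ?case
    proof (intro allI impI)
      fix s :: real assume "0 \<le> s"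
      from less_psi_iff[OF line_measurable[OF f' S(2) elim(2)] elim(1) this]
      show "ennreal s < ?\<psi> y \<longleftrightarrow> y \<in> shadow S f' k s" using elim(2) by (simp add: shadow_def)
    qed
  qed
  have sets: "{y \<in> space ?N. ennreal s < ?\<psi> y} \<in> sets (completion ?N)" if s: "0 \<le> s" for s
  proof -
    have "AE y in completion ?N. y \<in> shadow S f' k s \<longleftrightarrow> y \<in> {y \<in> space ?N. ennreal s < ?\<psi> y}"
      using AE_completion[OF iff] AE_space[of "completion ?N"] by eventually_elim (use s in auto)
    then show ?thesis
      by (rule completion.in_sets_AE) (use shadow_sets[OF f' S(2)] in auto)
  qed
  show m: "?\<psi> \<in> borel_measurable (cube (S - {k}) I)"
    unfolding C
  proof (rule borel_measurableI_greater)
    fix a :: ennreal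
    show "{y \<in> space (completion ?N). a < ?\<psi> y} \<in> sets (completion ?N)"
      using sets by (cases a) auto
  qed
  show "distr_fun (cube (S - {k}) I) ?\<psi> s = emeasure ?N (shadow S f' k s)" if s: "0 \<le> s"
  proof -
    have "emeasure (completion ?N) {y \<in> space ?N. ennreal s < ?\<psi> y} = emeasure (completion ?N) (shadow S f' k s)"
    proof (rule emeasure_eq_AE)
      show "AE y in completion ?N. y \<in> {y \<in> space ?N. ennreal s < ?\<psi> y} \<longleftrightarrow> y \<in> shadow S f' k s"
        using AE_completion[OF iff] AE_space[of "completion ?N"] by eventually_elim (use s in auto)
    qed (use sets[OF s] shadow_sets[OF f' S(2)] in auto)
    then show ?thesis using shadow_sets[OF f' S(2)] by (simp add: distr_fun_def C)
  qed
qed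

text \<open>After removal of the points that do not lie over their shadows, which form a null set by Fubini's
  theorem, this is the Loomis-Whitney inequality.\<close>
lemma superlevel_measure_le_shadows:
  fixes f :: "(nat \<Rightarrow> real) \<Rightarrow> real"
  assumes S: "finite S" "2 \<le> card S" and f: "f \<in> borel_measurable (P S)"
  shows "measure (P S) {x \<in> space (P S). s < \<bar>f x\<bar>} ^ (card S - 1) \<le> (\<Prod>k\<in>S. measure (P (S - {k})) (shadow S f k s))"
proof -
  let ?E = "{x \<in> space (P S). s < \<bar>f x\<bar>}"
  interpret PS: prob_space "P S" by (rule prob_P)
  have E: "?E \<in> sets (P S)" using f by measurable
  have pre: "{x \<in> space (P S). x(k := undefined) \<in> shadow S f k s} \<in> sets (P S)" if "k \<in> S" for k
    using measurable_sets[OF measurable_drop[OF that] shadow_sets[OF f that]]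
    by (simp add: vimage_def Int_def conj_commute)
  define A where "A = {x \<in> ?E. \<forall>k\<in>S. x(k := undefined) \<in> shadow S f k s}"
  have "A = ?E \<inter> {x \<in> space (P S). \<forall>k\<in>S. x(k := undefined) \<in> shadow S f k s}" by (auto simp: A_def)
  also have "\<dots> \<in> sets (P S)"
    using E S(1) pre by (intro sets.Int sets.sets_Collect_finite_All) auto
  finally have A: "A \<in> sets (P S)" .
  have "AE x in P S. x \<in> ?E \<longrightarrow> x(k := undefined) \<in> shadow S f k s" if k: "k \<in> S" for k
  proof -
    let ?N = "P (S - {k})"
    define h where "h x = (indicator ?E x * indicator (- shadow S f k s) (x(k := undefined)) :: ennreal)" for x
    have hm: "h \<in> borel_measurable (P S)"
    proof -
      have "(\<lambda>x. indicator ?E x * indicator (space (P S) - {x \<in> space (P S). x(k := undefined) \<in> shadow S f k s}) x :: ennreal)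
          \<in> borel_measurable (P S)"
        using E pre[OF k] by measurable
      then show ?thesis
        by (rule measurable_cong[THEN iffD1, rotated]) (auto simp: h_def indicator_def)
    qed
    have "(\<integral>\<^sup>+x. h x \<partial>P S) = (\<integral>\<^sup>+y. \<integral>\<^sup>+t. h (y(k := t)) \<partial>J \<partial>?N)"
      by (rule nn_integral_slice(1)[OF S(1) k hm])
    also have "\<dots> = (\<integral>\<^sup>+y. 0 \<partial>?N)"
    proof (rule nn_integral_cong)
      fix y assume y: "y \<in> space ?N"
      then have yk: "y(k := undefined) = y" by (auto simp: space_PiM PiE_iff extensional_def)
      have hy: "h (y(k := t)) = indicator ?E (y(k := t)) * indicator (- shadow S f k s) y" for t
        using yk by (simp add: h_def)
      show "(\<integral>\<^sup>+t. h (y(k := t)) \<partial>J) = 0"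
      proof (cases "y \<in> shadow S f k s")
        case True then show ?thesis by (simp add: hy)
      next
        case False
        then have "AE t in J. \<bar>f (y(k := t))\<bar> \<le> s" using y by (simp add: shadow_def)
        then have "AE t in J. h (y(k := t)) = 0"
          by eventually_elim (simp add: hy)
        then have "(\<integral>\<^sup>+t. h (y(k := t)) \<partial>J) = (\<integral>\<^sup>+t. 0 \<partial>J)" by (rule nn_integral_cong_AE)
        then show ?thesis by simp
      qed
    qed
    finally have "AE x in P S. h x = 0" using nn_integral_0_iff_AE[OF hm] by simp
    then show ?thesis by eventually_elim (auto simp: h_def indicator_def split: if_splits)
  qed
  then have ae: "AE x in P S. \<forall>k\<in>S. x \<in> ?E \<longrightarrow> x(k := undefined) \<in> shadow S f k s"
    using S(1) by (intro AE_finite_allI) auto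
  have "measure (P S) ?E = measure (P S) A"
    by (rule PS.finite_measure_eq_AE[OF _ E A]) (use ae in eventually_elim, auto simp: A_def)
  moreover have "measure (P S) A ^ (card S - 1) \<le> (\<Prod>k\<in>S. measure (P (S - {k})) (shadow S f k s))"
  proof (cases "A = {}")
    case True
    have "0 \<le> (\<Prod>k\<in>S. measure (P (S - {k})) (shadow S f k s))" by (intro prod_nonneg) simp
    then show ?thesis using True S(2) by (simp add: power_0_left)
  next
    case False
    have "S \<noteq> {}" using S(2) by auto
    then show ?thesis
      by (rule loomis_whitney[OF S(1) _ A shadow_sets[OF f] _ False]) (auto simp: A_def)
  qed
  ultimately show ?thesis by simp
qed

lemma prob_space_cube: "prob_space (cube T I)"
  unfolding cube_def by (rule prob_space.prob_space_completion[OF prob_P])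

end

section \<open>The embedding of the Sobolev space\<close>

text \<open>Young's inequality without its constants: if \<open>x > \<delta>\<close> then \<open>x\<^sup>1\<^sup>-\<^sup>p \<le> \<delta>\<^sup>1\<^sup>-\<^sup>p\<close>. Used with
  a free \<open>\<delta>\<close>, it plays the role of Hoelder's inequality on superlevel sets.\<close>
lemma young_level:
  fixes x \<delta> p :: real
  assumes "0 \<le> x" "0 < \<delta>" "1 \<le> p"
  shows "x \<le> \<delta> + \<delta> powr (1 - p) * x powr p"
proof (cases "x \<le> \<delta>")
  case True
  then show ?thesis by (simp add: add_increasing2)
next
  case False
  then have "x = x powr (1 - p) * x powr p"
    using assms by (simp add: powr_add[symmetric])
  also have "\<dots> \<le> \<delta> powr (1 - p) * x powr p"
    using False assms by (intro mult_right_mono powr_mono2') auto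
  finally show ?thesis using assms by simp
qed

context unit_side
begin

lemma level_shadow_le:
  assumes S: "finite S" "k \<in> S" and u: "u \<in> borel_measurable (P S)" and g: "g \<in> borel_measurable (P S)"
    and acl: "AE y in P (S - {k}). integrable J (\<lambda>s. g (y(k := s))) \<and>
      (\<exists>\<kappa>. AE t in J. u (y(k := t)) = \<kappa> + (\<integral>s. indicator {..t} s * g (y(k := s)) \<partial>J))"
    and a: "0 < a"
  shows "ennreal a * emeasure (P (S - {k})) (shadow S u k (2 * a))
    \<le> (\<integral>\<^sup>+x. ennreal a * indicator {x. a < \<bar>u x\<bar>} x + ennreal \<bar>g x\<bar> * indicator {x. a < \<bar>u x\<bar> \<and> \<bar>u x\<bar> < 2 * a} x \<partial>P S)"
    (is "_ \<le> (\<integral>\<^sup>+x. ?F x \<partial>P S)")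
proof -
  have ind1: "(\<lambda>x. ennreal a * indicator {x. a < \<bar>u x\<bar>} x) = (\<lambda>x. if a < \<bar>u x\<bar> then ennreal a else 0)"
    by (auto simp: indicator_def)
  have ind2: "(\<lambda>x. ennreal \<bar>g x\<bar> * indicator {x. a < \<bar>u x\<bar> \<and> \<bar>u x\<bar> < 2 * a} x)
      = (\<lambda>x. if a < \<bar>u x\<bar> \<and> \<bar>u x\<bar> < 2 * a then ennreal \<bar>g x\<bar> else 0)"
    by (auto simp: indicator_def)
  have Fm: "?F \<in> borel_measurable (P S)"
  proof (rule borel_measurable_add)
    show "(\<lambda>x. ennreal a * indicator {x. a < \<bar>u x\<bar>} x) \<in> borel_measurable (P S)"
      unfolding ind1 using u by measurable
    show "(\<lambda>x. ennreal \<bar>g x\<bar> * indicator {x. a < \<bar>u x\<bar> \<and> \<bar>u x\<bar> < 2 * a} x) \<in> borel_measurable (P S)"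
      unfolding ind2 using u g by measurable
  qed
  have "ennreal a * emeasure (P (S - {k})) (shadow S u k (2 * a))
      = (\<integral>\<^sup>+y. ennreal a * indicator (shadow S u k (2 * a)) y \<partial>P (S - {k}))"
    using shadow_sets[OF u S(2)] by (simp add: nn_integral_cmult_indicator)
  also have "\<dots> \<le> (\<integral>\<^sup>+y. \<integral>\<^sup>+t. ?F (y(k := t)) \<partial>J \<partial>P (S - {k}))"
  proof (rule nn_integral_mono_AE)
    show "AE y in P (S - {k}). ennreal a * indicator (shadow S u k (2 * a)) y \<le> (\<integral>\<^sup>+t. ?F (y(k := t)) \<partial>J)"
      using acl AE_space
    proof eventually_elim
      case (elim y)
      show ?case
      proof (cases "y \<in> shadow S u k (2 * a)")
        case True
        then have large: "\<not> (AE t in J. \<bar>u (y(k := t))\<bar> \<le> 2 * a)" by (simp add: shadow_def)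
        obtain \<kappa> where \<kappa>: "AE t in J. u (y(k := t)) = \<kappa> + (\<integral>s. indicator {..t} s * g (y(k := s)) \<partial>J)"
          using elim(1) by blast
        from level_le_slice_integral[OF conjunct1[OF elim(1)] line_measurable[OF u S(2) elim(2)] \<kappa> a large]
        show ?thesis using True by (simp add: indicator_def)
      qed simp
    qed
  qed
  also have "\<dots> = (\<integral>\<^sup>+x. ?F x \<partial>P S)" by (rule nn_integral_slice(1)[OF S Fm, symmetric])
  finally show ?thesis .
qed

lemma Lp_norm_le_imp_integral:
  assumes p: "1 \<le> p" and N: "0 < N" and f': "f' \<in> borel_measurable (P S)" and eq: "AE x in P S. f x = f' x"
    and le: "Lp_norm (ennreal p) (cube S I) (eabs f) \<le> ennreal N"
  shows "integrable (P S) (\<lambda>x. \<bar>f' x\<bar> powr p)" "(\<integral>x. \<bar>f' x\<bar> powr p \<partial>P S) \<le> N powr p"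
proof -
  have "(\<integral>\<^sup>+x. epow (eabs f x) p \<partial>cube S I) = (\<integral>\<^sup>+x. epow (eabs f x) p \<partial>P S)"
    by (simp add: cube_def nn_integral_completion)
  also have "\<dots> = (\<integral>\<^sup>+x. ennreal (\<bar>f' x\<bar> powr p) \<partial>P S)"
    by (rule nn_integral_cong_AE) (use eq in eventually_elim, simp add: eabs_def epow_ennreal)
  finally have "epow (\<integral>\<^sup>+x. ennreal (\<bar>f' x\<bar> powr p) \<partial>P S) (1 / p) \<le> ennreal N"
    using le p by (simp add: Lp_norm_ennreal)
  from epow_mono[OF this, of p] have *: "(\<integral>\<^sup>+x. ennreal (\<bar>f' x\<bar> powr p) \<partial>P S) \<le> ennreal (N powr p)"
    using p N by (simp add: epow_epow' epow_ennreal)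
  show i: "integrable (P S) (\<lambda>x. \<bar>f' x\<bar> powr p)"
  proof (rule integrableI_nonneg)
    show "(\<integral>\<^sup>+x. ennreal (\<bar>f' x\<bar> powr p) \<partial>P S) < \<infinity>" using * by (simp add: le_less_trans)
  qed (use f' in auto)
  have "ennreal (\<integral>x. \<bar>f' x\<bar> powr p \<partial>P S) \<le> ennreal (N powr p)"
    using * nn_integral_eq_integral[OF i] by simp
  then show "(\<integral>x. \<bar>f' x\<bar> powr p \<partial>P S) \<le> N powr p" by (simp add: ennreal_le_iff)
qed

lemma integrable_of_powr:
  fixes f :: "(nat \<Rightarrow> real) \<Rightarrow> real"
  assumes p: "1 \<le> p" and f: "f \<in> borel_measurable (P S)" and i: "integrable (P S) (\<lambda>x. \<bar>f x\<bar> powr p)"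
  shows "integrable (P S) f"
proof -
  interpret PS: prob_space "P S" by (rule prob_P)
  have i1: "integrable (P S) (\<lambda>x. 1 + \<bar>f x\<bar> powr p)"
    using i by (intro Bochner_Integration.integrable_add) simp_all
  show ?thesis
  proof (rule Bochner_Integration.integrable_bound[OF i1 f], rule AE_I2)
    fix x
    show "norm (f x) \<le> norm (1 + \<bar>f x\<bar> powr p)"
      using young_level[of "\<bar>f x\<bar>" 1 p] p by simp
  qed
qed

text \<open>Here \<open>h\<close> is the length of the gradient and \<open>N\<close> bounds the Sobolev norm. The recursion on the
  shadows is the integrated truncation estimate, after Young's inequality for \<open>a\<close> and \<open>\<bar>g\<bar>\<close>. The terms \<open>G j\<close>
  sum to at most \<open>\<integral> 2\<bar>u\<bar>\<^sup>p + h\<^sup>p\<close>.\<close>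
lemma dyadic_shadow_sum:
  fixes n m :: nat and p N :: real and u h :: "(nat \<Rightarrow> real) \<Rightarrow> real" and g :: "nat \<Rightarrow> (nat \<Rightarrow> real) \<Rightarrow> real"
  assumes n: "2 \<le> n" and p: "1 \<le> p" "p < n" and N: "0 < N"
    and u: "u \<in> borel_measurable (P {..<n})" and h: "h \<in> borel_measurable (P {..<n})"
    and g: "\<And>k. k < n \<Longrightarrow> g k \<in> borel_measurable (P {..<n})"
    and iu: "integrable (P {..<n}) (\<lambda>x. \<bar>u x\<bar> powr p)" "(\<integral>x. \<bar>u x\<bar> powr p \<partial>P {..<n}) \<le> N powr p"
    and ih: "integrable (P {..<n}) (\<lambda>x. \<bar>h x\<bar> powr p)" "(\<integral>x. \<bar>h x\<bar> powr p \<partial>P {..<n}) \<le> N powr p"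
    and gh: "\<And>k. k < n \<Longrightarrow> AE x in P {..<n}. \<bar>g k x\<bar> \<le> \<bar>h x\<bar>"
    and acl: "\<And>k. k < n \<Longrightarrow> AE y in P ({..<n} - {k}). integrable J (\<lambda>s. g k (y(k := s))) \<and>
      (\<exists>\<kappa>. AE t in J. u (y(k := t)) = \<kappa> + (\<integral>s. indicator {..t} s * g k (y(k := s)) \<partial>J))"
  shows "(\<Sum>j<m. (2 ^ j * N) powr p
      * Max ((\<lambda>k. measure (P ({..<n} - {k})) (shadow {..<n} u k (2 ^ j * N))) ` {..<n}) powr ((n - p) / (real n - 1)))
    \<le> dyadic_const n p * N powr p"
proof -
  let ?S = "{..<n}"
  interpret PS: prob_space "P T" for T by (rule prob_P)
  define a where "a j = 2 ^ j * N" for j :: nat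
  have a: "0 < a j" "a (Suc j) = 2 * a j" for j using N by (simp_all add: a_def)
  define B where "B k j = measure (P (?S - {k})) (shadow ?S u k (a j))" for k j
  define b where "b j = Max ((\<lambda>k. B k j) ` ?S)" for j
  have ne: "?S \<noteq> {}" using n by (auto simp: lessThan_empty_iff)
  have Bb: "B k j \<le> b j" if "k < n" for k j
    unfolding b_def using that by (intro Max_ge) auto
  have b01: "0 \<le> b j" "b j \<le> 1" for j
  proof -
    show "0 \<le> b j" using Bb[of 0 j] n by (auto simp: B_def intro: order_trans[OF measure_nonneg])
    show "b j \<le> 1" unfolding b_def using ne by (subst Max_le_iff) (auto simp: B_def)
  qed
  define E where "E j = {x \<in> space (P ?S). a j < \<bar>u x\<bar>}" for j
  have E: "E j \<in> sets (P ?S)" for j unfolding E_def using u by measurable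
  define A where "A j = measure (P ?S) (E j)" for j
  have lw: "A j ^ (n - 1) \<le> b j ^ n" for j
  proof -
    have "A j ^ (n - 1) \<le> (\<Prod>k<n. B k j)"
      using superlevel_measure_le_shadows[OF finite_lessThan _ u, of "a j"] n
      by (simp add: A_def E_def B_def)
    also have "\<dots> \<le> (\<Prod>k<n. b j)" by (intro prod_mono) (use Bb in \<open>auto simp: B_def\<close>)
    finally show ?thesis by simp
  qed
  define F where "F j x = (if a j < \<bar>u x\<bar> then a j powr p else 0)
    + (if a j < \<bar>u x\<bar> \<and> \<bar>u x\<bar> < a (Suc j) then \<bar>h x\<bar> powr p else 0)" for j x
  have F0: "0 \<le> F j x" for j x by (simp add: F_def)
  have Fm: "F j \<in> borel_measurable (P ?S)" for j
    unfolding F_def using u h by measurable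
  have Fsum: "(\<Sum>j<m. F j x) \<le> 2 * \<bar>u x\<bar> powr p + \<bar>h x\<bar> powr p" for m x
    unfolding F_def sum.distrib a_def
    by (intro add_mono sum_dyadic_levels_le sum_dyadic_shells_le p N) auto
  have iuh: "integrable (P ?S) (\<lambda>x. 2 * \<bar>u x\<bar> powr p + \<bar>h x\<bar> powr p)" using iu ih by simp
  have Fi: "integrable (P ?S) (F j)" for j
  proof (rule Bochner_Integration.integrable_bound[OF iuh Fm], rule AE_I2)
    fix x
    have "F j x \<le> (\<Sum>j<Suc j. F j x)" using F0 by (simp add: sum_nonneg)
    also have "\<dots> \<le> 2 * \<bar>u x\<bar> powr p + \<bar>h x\<bar> powr p" by (rule Fsum)
    finally show "norm (F j x) \<le> norm (2 * \<bar>u x\<bar> powr p + \<bar>h x\<bar> powr p)" using F0[of j x] by simp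
  qed
  define G where "G j = (\<integral>x. F j x \<partial>P ?S)" for j
  have G0: "0 \<le> G j" for j unfolding G_def using F0 by simp
  have Gsum: "(\<Sum>j<m. G j) \<le> 3 * N powr p" for m
  proof -
    have "(\<Sum>j<m. G j) = (\<integral>x. (\<Sum>j<m. F j x) \<partial>P ?S)"
      unfolding G_def using Fi by (subst Bochner_Integration.integral_sum) auto
    also have "\<dots> \<le> (\<integral>x. 2 * \<bar>u x\<bar> powr p + \<bar>h x\<bar> powr p \<partial>P ?S)"
      using Fi by (intro integral_mono iuh Fsum Bochner_Integration.integrable_sum)
    also have "\<dots> = 2 * (\<integral>x. \<bar>u x\<bar> powr p \<partial>P ?S) + (\<integral>x. \<bar>h x\<bar> powr p \<partial>P ?S)"
      using iu ih by simp
    also have "\<dots> \<le> 3 * N powr p" using iu ih by simp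
    finally show ?thesis .
  qed
  have level: "a j * b (Suc j) \<le> 2 * \<delta> * A j + \<delta> powr (1 - p) * G j" if \<delta>: "0 < \<delta>" for j \<delta>
  proof -
    have "b (Suc j) \<in> (\<lambda>k. B k (Suc j)) ` ?S"
      unfolding b_def using ne by (intro Max_in) auto
    then obtain k where k: "k < n" "b (Suc j) = B k (Suc j)" by auto
    have iE: "integrable (P ?S) (\<lambda>x. 2 * \<delta> * indicator (E j) x)"
      using E by (intro integrable_mult_right integrable_real_indicator) (auto simp: PS.emeasure_eq_measure)
    have "ennreal (a j * b (Suc j)) = ennreal (a j) * emeasure (P (?S - {k})) (shadow ?S u k (2 * a j))"
      using a[of j] by (simp add: k B_def PS.emeasure_eq_measure ennreal_mult)
    also have "\<dots> \<le> (\<integral>\<^sup>+x. ennreal (a j) * indicator {x. a j < \<bar>u x\<bar>} x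
        + ennreal \<bar>g k x\<bar> * indicator {x. a j < \<bar>u x\<bar> \<and> \<bar>u x\<bar> < 2 * a j} x \<partial>P ?S)"
      using k(1) by (intro level_shadow_le u g acl a) auto
    also have "\<dots> \<le> (\<integral>\<^sup>+x. ennreal (2 * \<delta> * indicator (E j) x + \<delta> powr (1 - p) * F j x) \<partial>P ?S)"
    proof (rule nn_integral_mono_AE)
      show "AE x in P ?S. ennreal (a j) * indicator {x. a j < \<bar>u x\<bar>} x
          + ennreal \<bar>g k x\<bar> * indicator {x. a j < \<bar>u x\<bar> \<and> \<bar>u x\<bar> < 2 * a j} x
        \<le> ennreal (2 * \<delta> * indicator (E j) x + \<delta> powr (1 - p) * F j x)"
        using gh[OF k(1)] AE_space
      proof eventually_elim
        case (elim x)
        have yA: "a j \<le> \<delta> + \<delta> powr (1 - p) * a j powr p" using a[of j] \<delta> p by (intro young_level) auto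
        have yG: "\<bar>g k x\<bar> \<le> \<delta> + \<delta> powr (1 - p) * \<bar>h x\<bar> powr p"
          using young_level[of "\<bar>h x\<bar>" \<delta> p] elim(1) \<delta> p by linarith
        consider "\<bar>u x\<bar> \<le> a j" | "a j < \<bar>u x\<bar>" "\<not> \<bar>u x\<bar> < 2 * a j" | "a j < \<bar>u x\<bar>" "\<bar>u x\<bar> < 2 * a j" by linarith
        then show ?case
        proof cases
          case 1
          then show ?thesis by simp
        next
          case 2
          have "ennreal (a j) \<le> ennreal (2 * \<delta> + \<delta> powr (1 - p) * a j powr p)"
            using yA \<delta> by (intro ennreal_leI) simp
          then show ?thesis using 2 elim(2) by (simp add: F_def E_def a(2))
        next
          case 3
          have "ennreal (a j) + ennreal \<bar>g k x\<bar> = ennreal (a j + \<bar>g k x\<bar>)" using a[of j] by simp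
          also have "\<dots> \<le> ennreal (2 * \<delta> + \<delta> powr (1 - p) * (a j powr p + \<bar>h x\<bar> powr p))"
            using yA yG by (intro ennreal_leI) (simp add: distrib_left)
          finally show ?thesis using 3 elim(2) by (simp add: F_def E_def a(2))
        qed
      qed
    qed
    also have "\<dots> = ennreal (\<integral>x. 2 * \<delta> * indicator (E j) x + \<delta> powr (1 - p) * F j x \<partial>P ?S)"
    proof (rule nn_integral_eq_integral)
      show "integrable (P ?S) (\<lambda>x. 2 * \<delta> * indicator (E j) x + \<delta> powr (1 - p) * F j x)"
        using iE Fi by (intro Bochner_Integration.integrable_add integrable_mult_right) auto
      show "AE x in P ?S. 0 \<le> 2 * \<delta> * indicator (E j) x + \<delta> powr (1 - p) * F j x"
        using F0 \<delta> by (intro AE_I2 add_nonneg_nonneg mult_nonneg_nonneg) auto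
    qed
    also have "(\<integral>x. 2 * \<delta> * indicator (E j) x + \<delta> powr (1 - p) * F j x \<partial>P ?S) = 2 * \<delta> * A j + \<delta> powr (1 - p) * G j"
      using iE Fi E by (subst Bochner_Integration.integral_add) (auto simp: A_def G_def)
    finally have "ennreal (a j * b (Suc j)) \<le> ennreal (2 * \<delta> * A j + \<delta> powr (1 - p) * G j)" .
    moreover have "0 \<le> 2 * \<delta> * A j + \<delta> powr (1 - p) * G j"
      using \<delta> G0[of j] by (simp add: A_def)
    ultimately show ?thesis by (simp add: ennreal_le_iff)
  qed
  have "(\<Sum>j<m. (2 ^ j * N) powr p * b j powr ((n - p) / (real n - 1))) \<le> dyadic_const n p * N powr p"
  proof (rule dyadic_recursion_bound[OF n p N b01 _ lw _ G0 Gsum])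
    show "0 \<le> A j" for j by (simp add: A_def)
    show "(2 ^ j * N) * b (Suc j) \<le> 2 * \<delta> * A j + \<delta> powr (1 - p) * G j" if "0 < \<delta>" for j \<delta>
      using level[OF that] by (simp add: a_def)
  qed
  then show ?thesis by (simp add: b_def B_def a_def)
qed

end

context unit_side
begin

text \<open>The bound is stated for every positive \<open>N\<close> above the Sobolev norm, since the dyadic levels \<open>2\<^sup>j N\<close> need
  \<open>N > 0\<close> even if the norm vanishes.\<close>
lemma sobolev_mixed_bound:
  fixes n :: nat and p :: real
  assumes n: "2 \<le> n" and p: "1 \<le> p" "p < n"
  obtains C where "0 \<le> C"
    and "\<And>u N k. u \<in> sobolev_space n I (ennreal p) \<Longrightarrow> 0 < N \<Longrightarrow> sobolev_norm n I (ennreal p) u \<le> ennreal N \<Longrightarrow> k < n \<Longrightarrow>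
      mixed_norm_k n I k (lorentz_norm (ennreal (p * (real n - 1) / (real n - p))) (ennreal p)) (Lp_norm \<infinity>) u \<le> ennreal (C * N)"
proof -
  define r where "r = p * (real n - 1) / (real n - p)"
  have r: "0 < r" using n p by (simp add: r_def)
  have pr: "p / r = (n - p) / (real n - 1)" using n p by (simp add: r_def)
  define C where "C = dyadic_const n p"
  have C: "0 \<le> C" by (simp add: C_def dyadic_const_nonneg)
  define D where "D = (r / p + r * 2 powr p * C) powr (1 / p)"
  show thesis
  proof (rule that[of D])
    show "0 \<le> D" by (simp add: D_def)
    fix u :: "(nat \<Rightarrow> real) \<Rightarrow> real" and N :: real and k :: nat
    let ?S = "{..<n}"
    interpret PS: prob_space "P T" for T by (rule prob_P)
    assume u: "u \<in> sobolev_space n I (ennreal p)" and N: "0 < N"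
      and norm: "sobolev_norm n I (ennreal p) u \<le> ennreal N" and k: "k < n"
    define G where "G = gradient n I u"
    have G: "is_gradient n I u G"
    proof -
      have "\<exists>G. is_gradient n I u G" using u by (simp add: sobolev_space_def)
      then show ?thesis unfolding G_def gradient_def by (rule someI_ex)
    qed
    define h where "h = gradient_length n I u"
    have um: "u \<in> borel_measurable (completion (P ?S))" and hm: "h \<in> borel_measurable (completion (P ?S))"
      using u by (auto simp: sobolev_space_def Lp_space_def cube_def h_def)
    have Gm: "G i \<in> borel_measurable (completion (P ?S))" if "i < n" for i
      using G that by (auto simp: is_gradient_def loc_integrable_def cube_def)
    obtain u' where u': "u' \<in> borel_measurable (P ?S)" "AE x in P ?S. u x = u' x"
      using completion_ex_borel_measurable_real[OF um] by blast
    obtain h' where h': "h' \<in> borel_measurable (P ?S)" "AE x in P ?S. h x = h' x"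
      using completion_ex_borel_measurable_real[OF hm] by blast
    have "\<forall>i\<in>?S. \<exists>g. g \<in> borel_measurable (P ?S) \<and> (AE x in P ?S. G i x = g x)"
      using completion_ex_borel_measurable_real[OF Gm] by blast
    then obtain g where g: "\<And>i. i < n \<Longrightarrow> g i \<in> borel_measurable (P ?S)"
      "\<And>i. i < n \<Longrightarrow> AE x in P ?S. G i x = g i x"
      by (metis lessThan_iff)
    have "Lp_norm (ennreal p) (cube ?S I) (eabs u) \<le> ennreal N"
      "Lp_norm (ennreal p) (cube ?S I) (eabs h) \<le> ennreal N"
      using norm unfolding sobolev_norm_def h_def[symmetric]
      by (meson add_increasing add_increasing2 order_trans order_refl zero_le)+
    note iu = Lp_norm_le_imp_integral[OF p(1) N u' this(1)] and ih = Lp_norm_le_imp_integral[OF p(1) N h' this(2)]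
    have gh: "AE x in P ?S. \<bar>g i x\<bar> \<le> \<bar>h' x\<bar>" if i: "i < n" for i
      using g(2)[OF i] h'(2)
    proof eventually_elim
      case (elim x)
      have "\<bar>G i x\<bar> \<le> L2_set (\<lambda>i. \<bar>G i x\<bar>) ?S" by (rule member_le_L2_set) (use i in auto)
      also have "\<dots> = h x" by (simp add: h_def gradient_length_def G_def L2_set_def)
      finally show ?case using elim by simp
    qed
    have iu': "integrable (P ?S) u'" by (rule integrable_of_powr[OF p(1) u'(1) iu(1)])
    have ih': "integrable (P ?S) h'" by (rule integrable_of_powr[OF p(1) h'(1) ih(1)])
    have ig: "integrable (P ?S) (g i)" if i: "i < n" for i
      by (rule Bochner_Integration.integrable_bound[OF ih' g(1)[OF i]]) (use gh[OF i] in simp)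
    define b where "b j = Max ((\<lambda>k. measure (P (?S - {k})) (shadow ?S u' k (2 ^ j * N))) ` ?S)" for j :: nat
    have bk: "measure (P (?S - {k})) (shadow ?S u' k (2 ^ j * N)) \<le> b j" for j
      unfolding b_def using k by (intro Max_ge) auto
    have sum: "(\<Sum>j<m. (2 ^ j * N) powr p * b j powr (p / r)) \<le> C * N powr p" for m
      using dyadic_shadow_sum[OF n p N u'(1) h'(1) g(1) iu ih gh gradient_line_antiderivative[OF G _ iu' u'(2) ig g(2)], of m]
      by (simp add: b_def pr C_def)
    let ?\<psi> = "psi I (Lp_norm \<infinity>) k u"
    have \<psi>: "?\<psi> \<in> borel_measurable (cube (?S - {k}) I)"
      using psi_measurable_distr(1)[OF finite_lessThan _ u'] k by simp
    have "lorentz_norm (ennreal r) (ennreal p) (cube (?S - {k}) I) ?\<psi> \<le> ennreal (D * N)"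
      unfolding D_def
    proof (rule prob_space.lorentz_norm_le_dyadic[OF prob_space_cube \<psi> p(1) r N C _ _ sum])
      show "distr_fun (cube (?S - {k}) I) ?\<psi> (2 ^ j * N) \<le> ennreal (b j)" for j
        using psi_measurable_distr(2)[OF finite_lessThan _ u', of k "2 ^ j * N"] k N bk[of j]
        by (simp add: PS.emeasure_eq_measure ennreal_leI)
      show "0 \<le> b j" for j using bk[of j] by (rule order_trans[OF measure_nonneg])
    qed
    then show "mixed_norm_k n I k (lorentz_norm (ennreal (p * (real n - 1) / (real n - p))) (ennreal p)) (Lp_norm \<infinity>) u \<le> ennreal (D * N)"
      by (simp add: mixed_norm_k_def r_def)
  qed
qed

lemma sobolev_embeds_mixed:
  fixes n :: nat and p :: real
  assumes n: "2 \<le> n" and p: "1 \<le> p" "p < n"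
  defines "X \<equiv> lorentz_norm (ennreal (p * (real n - 1) / (real n - p))) (ennreal p)"
  shows "embeds (sobolev_space n I (ennreal p)) (sobolev_norm n I (ennreal p))
    (mixed_space n I X (Lp_norm \<infinity>)) (mixed_norm n I X (Lp_norm \<infinity>))"
proof -
  obtain C where C: "0 \<le> C" and bound: "\<And>u N k. u \<in> sobolev_space n I (ennreal p) \<Longrightarrow> 0 < N \<Longrightarrow>
      sobolev_norm n I (ennreal p) u \<le> ennreal N \<Longrightarrow> k < n \<Longrightarrow> mixed_norm_k n I k X (Lp_norm \<infinity>) u \<le> ennreal (C * N)"
    unfolding X_def by (rule sobolev_mixed_bound[OF n p]) blast
  define D where "D = real n * C"
  have D: "0 \<le> D" using C by (simp add: D_def)
  have fin: "\<exists>w\<ge>0. sobolev_norm n I (ennreal p) u = ennreal w" if "u \<in> sobolev_space n I (ennreal p)" for u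
  proof -
    have "sobolev_norm n I (ennreal p) u < top"
      using that by (simp add: sobolev_space_def sobolev_norm_def Lp_space_def)
    then show ?thesis by (cases "sobolev_norm n I (ennreal p) u") auto
  qed
  have norm: "mixed_norm n I X (Lp_norm \<infinity>) u \<le> ennreal D * sobolev_norm n I (ennreal p) u"
    if u: "u \<in> sobolev_space n I (ennreal p)" for u
  proof -
    obtain w where w: "0 \<le> w" "sobolev_norm n I (ennreal p) u = ennreal w" using fin[OF u] by blast
    have "mixed_norm n I X (Lp_norm \<infinity>) u \<le> ennreal (D * w)"
    proof (rule ennreal_le_epsilon)
      fix e :: real assume e: "0 < e"
      \<comment> \<open>strictly positive, since w may be 0, and D * N \<le> D * w + e\<close>
      define N where "N = w + e / (D + 1)"
      have N: "0 < N" "w \<le> N" using w e D by (auto simp: N_def add_nonneg_pos)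
      have "mixed_norm n I X (Lp_norm \<infinity>) u \<le> (\<Sum>k<n. ennreal (C * N))"
        unfolding mixed_norm_def using bound[OF u N(1)] N(2) w by (intro sum_mono) (simp add: ennreal_leI)
      also have "\<dots> = ennreal (D * N)"
        using C N by (simp add: D_def ennreal_of_nat_eq_real_of_nat ennreal_mult[symmetric] mult.assoc)
      also have "D * N \<le> D * w + e"
      proof -
        have "D * (e / (D + 1)) \<le> (D + 1) * (e / (D + 1))" using D e by (intro mult_right_mono) auto
        then show ?thesis using D by (simp add: N_def distrib_left)
      qed
      finally show "mixed_norm n I X (Lp_norm \<infinity>) u \<le> ennreal (D * w) + ennreal e"
        using D w e by (simp add: ennreal_plus[symmetric] ennreal_leI del: ennreal_plus)
    qed
    then show ?thesis using D w by (simp add: ennreal_mult)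
  qed
  have "sobolev_space n I (ennreal p) \<subseteq> mixed_space n I X (Lp_norm \<infinity>)"
  proof
    fix u assume u: "u \<in> sobolev_space n I (ennreal p)"
    obtain w where w: "0 \<le> w" "sobolev_norm n I (ennreal p) u = ennreal w" using fin[OF u] by blast
    have "mixed_norm_k n I k X (Lp_norm \<infinity>) u < \<infinity>" if "k < n" for k
      using bound[OF u, of "w + 1" k] w that by (simp add: ennreal_leI le_less_trans)
    moreover have "u \<in> borel_measurable (cube {..<n} I)" using u by (simp add: sobolev_space_def Lp_space_def)
    ultimately show "u \<in> mixed_space n I X (Lp_norm \<infinity>)" by (simp add: mixed_space_def mixed_space_k_def)
  qed
  then show ?thesis unfolding embeds_def using norm by blast
qed

end

section \<open>The embedding into the Lorentz space and its strictness\<close>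

text \<open>The measure of the superlevel set is at most the \<open>n/(n - 1)\<close>th power of that of its largest shadow, and
  the largest term is at most the sum.\<close>
lemma root_le_sum_powr:
  fixes n :: nat and e p :: real
  assumes n: "2 \<le> n" and p: "p < n" and e: "0 \<le> e" and B: "\<And>k. k < n \<Longrightarrow> 0 \<le> B k"
    and le: "e ^ (n - 1) \<le> (\<Prod>k<n. B k)"
  shows "e powr ((n - p) / n) \<le> (\<Sum>k<n. B k powr ((n - p) / (real n - 1)))"
proof -
  define b where "b = Max (B ` {..<n})"
  have ne: "{..<n} \<noteq> {}" using n by (auto simp: lessThan_empty_iff)
  have Bb: "B k \<le> b" if "k < n" for k unfolding b_def using that by (intro Max_ge) auto
  have "b \<in> B ` {..<n}" unfolding b_def using ne by (intro Max_in) auto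
  then obtain k where k: "k < n" "b = B k" by auto
  have pw: "(x ^ m) powr a = x powr (real m * a)" if "0 \<le> x" "0 < m" for x a :: real and m
    using that by (cases "x = 0") (auto simp: powr_realpow[symmetric] powr_powr zero_power)
  define q where "q = (n - p) / (n * (real n - 1))"
  have q: "0 < q" using n p by (simp add: q_def)
  have "e powr ((n - p) / n) = (e ^ (n - 1)) powr q"
    using n e by (simp add: pw q_def of_nat_diff)
  also have "\<dots> \<le> (b ^ n) powr q"
  proof (rule powr_mono2)
    have "(\<Prod>k<n. B k) \<le> (\<Prod>k<n. b)" using B Bb by (intro prod_mono) auto
    then show "e ^ (n - 1) \<le> b ^ n" using le by simp
  qed (use q e in auto)
  also have "\<dots> = b powr ((n - p) / (real n - 1))"
    using n B[OF k(1)] by (simp add: pw q_def k(2))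
  also have "\<dots> \<le> (\<Sum>k<n. B k powr ((n - p) / (real n - 1)))"
    unfolding k(2) using k(1) by (intro member_le_sum) auto
  finally show ?thesis .
qed

context unit_side
begin

text \<open>The exponents satisfy \<open>(p/r') (n/(n - 1)) = p/r\<close>, so the integrand \<open>\<lambda>(s)\<^sup>p\<^sup>/\<^sup>r\<^sup>'\<close> of the Lorentz norm of \<open>f\<close> is at
  most the sum of the integrands for the \<open>\<psi>\<^sub>k f\<close>.\<close>
lemma mixed_embeds_lorentz:
  fixes n :: nat and p :: real
  assumes n: "2 \<le> n" and p: "1 \<le> p" "p < n"
  defines "X \<equiv> lorentz_norm (ennreal (p * (real n - 1) / (real n - p))) (ennreal p)"
    and "q \<equiv> ennreal (p * real n / (real n - p))"
  shows "embeds (mixed_space n I X (Lp_norm \<infinity>)) (mixed_norm n I X (Lp_norm \<infinity>))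
    (lorentz_space q (ennreal p) (cube {..<n} I)) (\<lambda>f. lorentz_norm q (ennreal p) (cube {..<n} I) (eabs f))"
proof -
  let ?S = "{..<n}"
  define r where "r = p * (real n - 1) / (real n - p)"
  define r' where "r' = p * real n / (real n - p)"
  have r: "0 < r" "0 < r'" using n p by (simp_all add: r_def r'_def)
  have pr: "p / r = (n - p) / (real n - 1)" "p / r' = (n - p) / real n"
    using n p by (simp_all add: r_def r'_def)
  have p0: "0 < p" using p by simp
  define D where "D = ((r' / r) * n) powr (1 / p)"
  interpret PS: prob_space "P T" for T by (rule prob_P)
  interpret C: prob_space "cube T I" for T by (rule prob_space_cube)
  have fm: "f \<in> borel_measurable (cube ?S I)" and fk: "\<And>k. k < n \<Longrightarrow> mixed_norm_k n I k X (Lp_norm \<infinity>) f < \<infinity>"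
    if "f \<in> mixed_space n I X (Lp_norm \<infinity>)" for f
    using that n by (auto simp: mixed_space_def mixed_space_k_def dest: bspec[of _ _ 0])
  have norm: "lorentz_norm q (ennreal p) (cube ?S I) (eabs f) \<le> ennreal D * mixed_norm n I X (Lp_norm \<infinity>) f"
    if f: "f \<in> mixed_space n I X (Lp_norm \<infinity>)" for f
  proof -
    obtain f' where f': "f' \<in> borel_measurable (P ?S)" "AE x in P ?S. f x = f' x"
      using completion_ex_borel_measurable_real[OF fm[OF f, unfolded cube_def]] by blast
    define \<psi> where "\<psi> k = psi I (Lp_norm \<infinity>) k f" for k
    define l where "l k = distr_fun (cube (?S - {k}) I) (\<psi> k)" for k
    have \<psi>m: "\<psi> k \<in> borel_measurable (cube (?S - {k}) I)" if "k < n" for k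
      unfolding \<psi>_def using psi_measurable_distr(1)[OF finite_lessThan _ f'] that by simp
    have lm: "l k \<in> borel_measurable borel" if "k < n" for k
      unfolding l_def by (rule C.measurable_distr_fun[OF \<psi>m[OF that]])
    have em: "eabs f \<in> borel_measurable (cube ?S I)"
      unfolding eabs_def[abs_def] using fm[OF f] by measurable
    have lev: "epow (distr_fun (cube ?S I) (eabs f) s) (p / r') \<le> (\<Sum>k<n. epow (l k s) (p / r))" if s: "0 < s" for s
    proof -
      define e where "e = measure (P ?S) {x \<in> space (P ?S). s < \<bar>f' x\<bar>}"
      define B where "B k = measure (P (?S - {k})) (shadow ?S f' k s)" for k
      have "distr_fun (cube ?S I) (eabs f) s = emeasure (P ?S) {x \<in> space (P ?S). ennreal s < eabs f' x}"
        unfolding cube_def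
      proof (rule distr_fun_completion)
        show "eabs f' \<in> borel_measurable (P ?S)" unfolding eabs_def[abs_def] using f'(1) by measurable
        show "AE x in P ?S. eabs f' x = eabs f x" using f'(2) by eventually_elim (simp add: eabs_def)
      qed
      also have "{x \<in> space (P ?S). ennreal s < eabs f' x} = {x \<in> space (P ?S). s < \<bar>f' x\<bar>}"
        using s by (simp add: eabs_def ennreal_less_iff)
      finally have e: "distr_fun (cube ?S I) (eabs f) s = ennreal e" by (simp add: e_def PS.emeasure_eq_measure)
      have B: "l k s = ennreal (B k)" if "k < n" for k
        using psi_measurable_distr(2)[OF finite_lessThan _ f', of k s] that s
        by (simp add: l_def \<psi>_def B_def PS.emeasure_eq_measure)
      have "e ^ (n - 1) \<le> (\<Prod>k<n. B k)"
        using superlevel_measure_le_shadows[OF finite_lessThan _ f'(1), of s] n by (simp add: e_def B_def)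
      then have "e powr ((n - p) / n) \<le> (\<Sum>k<n. B k powr ((n - p) / (real n - 1)))"
        by (intro root_le_sum_powr n p) (auto simp: e_def B_def)
      then have "ennreal (e powr (p / r')) \<le> ennreal (\<Sum>k<n. B k powr (p / r))"
        unfolding pr by (rule ennreal_leI)
      also have "\<dots> = (\<Sum>k<n. ennreal (B k powr (p / r)))" by (rule sum_ennreal[symmetric]) simp
      also have "\<dots> = (\<Sum>k<n. epow (l k s) (p / r))"
        by (intro sum.cong) (auto simp: B epow_ennreal B_def)
      finally show ?thesis by (simp add: e epow_ennreal e_def)
    qed
    define Z where "Z k = (\<integral>\<^sup>+s. ennreal (r * s powr (p - 1)) * epow (l k s) (p / r) * indicator {0<..} s \<partial>lborel)" for k
    have mk: "mixed_norm_k n I k X (Lp_norm \<infinity>) f = epow (Z k) (1 / p)" if "k < n" for k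
      unfolding mixed_norm_k_def X_def Z_def l_def \<psi>_def[symmetric] r_def[symmetric]
      by (rule C.lorentz_norm_distribution[OF \<psi>m[OF that] p0 r(1)])
    have "(\<integral>\<^sup>+s. ennreal (r' * s powr (p - 1)) * epow (distr_fun (cube ?S I) (eabs f) s) (p / r') * indicator {0<..} s \<partial>lborel)
        \<le> (\<integral>\<^sup>+s. (\<Sum>k<n. ennreal (r' / r) * (ennreal (r * s powr (p - 1)) * epow (l k s) (p / r) * indicator {0<..} s)) \<partial>lborel)"
    proof (rule nn_integral_mono)
      fix s :: real
      show "ennreal (r' * s powr (p - 1)) * epow (distr_fun (cube ?S I) (eabs f) s) (p / r') * indicator {0<..} s
          \<le> (\<Sum>k<n. ennreal (r' / r) * (ennreal (r * s powr (p - 1)) * epow (l k s) (p / r) * indicator {0<..} s))"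
      proof (cases "0 < s")
        case True
        have c: "ennreal (r' / r) * (ennreal (r * s powr (p - 1)) * x) = ennreal (r' * s powr (p - 1)) * x" for x
          using r by (simp add: mult.assoc[symmetric] ennreal_mult[symmetric])
        show ?thesis
          using mult_left_mono[OF lev[OF True], of "ennreal (r' * s powr (p - 1))"] True
          by (simp add: c sum_distrib_left)
      qed simp
    qed
    also have "\<dots> = (\<Sum>k<n. ennreal (r' / r) * Z k)"
    proof -
      have "(\<integral>\<^sup>+s. ennreal (r' / r) * (ennreal (r * s powr (p - 1)) * epow (l k s) (p / r) * indicator {0<..} s) \<partial>lborel)
          = ennreal (r' / r) * Z k" if "k < n" for k
      proof -
        note [measurable] = lm[OF that]
        show ?thesis unfolding Z_def by (rule nn_integral_cmult) measurable
      qed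
      moreover have "(\<lambda>s. ennreal (r' / r) * (ennreal (r * s powr (p - 1)) * epow (l k s) (p / r) * indicator {0<..} s)) \<in> borel_measurable lborel"
        if "k < n" for k using lm[OF that] by measurable
      ultimately show ?thesis by (subst nn_integral_sum) auto
    qed
    also have "\<dots> \<le> (\<Sum>k<n. ennreal (r' / r) * epow (mixed_norm n I X (Lp_norm \<infinity>) f) p)"
    proof (intro sum_mono mult_left_mono)
      fix k assume k: "k \<in> {..<n}"
      have "Z k = epow (mixed_norm_k n I k X (Lp_norm \<infinity>) f) p" using mk k p0 by (simp add: epow_epow')
      also have "\<dots> \<le> epow (mixed_norm n I X (Lp_norm \<infinity>) f) p"
        unfolding mixed_norm_def using k p0 by (intro epow_mono member_le_sum) auto
      finally show "Z k \<le> epow (mixed_norm n I X (Lp_norm \<infinity>) f) p" .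
    qed simp
    also have "\<dots> = ennreal ((r' / r) * n) * epow (mixed_norm n I X (Lp_norm \<infinity>) f) p"
    proof -
      have "ennreal ((r' / r) * n) = ennreal (r' / r) * of_nat n"
        using r by (subst ennreal_mult) (simp_all add: ennreal_of_nat_eq_real_of_nat)
      then show ?thesis by (simp only: sum_constant card_lessThan mult_ac)
    qed
    finally have "lorentz_norm (ennreal r') (ennreal p) (cube ?S I) (eabs f)
        \<le> epow (ennreal ((r' / r) * n) * epow (mixed_norm n I X (Lp_norm \<infinity>) f) p) (1 / p)"
      unfolding C.lorentz_norm_distribution[OF em p0 r(2)] using p0 by (intro epow_mono) auto
    also have "\<dots> = ennreal D * mixed_norm n I X (Lp_norm \<infinity>) f"
      using r p0 by (simp add: epow_mult epow_epow D_def)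
    finally show ?thesis by (simp add: q_def r'_def)
  qed
  have "mixed_space n I X (Lp_norm \<infinity>) \<subseteq> lorentz_space q (ennreal p) (cube ?S I)"
  proof
    fix f assume f: "f \<in> mixed_space n I X (Lp_norm \<infinity>)"
    have "ennreal D * mixed_norm n I X (Lp_norm \<infinity>) f < \<infinity>"
      using fk[OF f] by (simp add: mixed_norm_def ennreal_mult_less_top)
    then show "f \<in> lorentz_space q (ennreal p) (cube ?S I)"
      using norm[OF f] fm[OF f] by (simp add: lorentz_space_def le_less_trans)
  qed
  then show ?thesis unfolding embeds_def using norm by blast
qed

text \<open>The function \<open>\<bar>x\<^sub>0 - c\<bar>\<^sup>-\<^sup>\<epsilon>\<close>. Its distribution function is at most \<open>s\<^sup>-\<^sup>1\<^sup>/\<^sup>\<epsilon>\<close>, and \<open>\<epsilon> = 1/(2r')\<close> makes the dyadic sum of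
  the Lorentz norm converge. It is essentially unbounded on every line in direction \<open>0\<close>.\<close>
lemma mixed_ne_lorentz:
  fixes n :: nat and p :: real
  assumes n: "2 \<le> n" and p: "1 \<le> p" "p < n"
  shows "\<exists>f \<in> lorentz_space (ennreal (p * real n / (real n - p))) (ennreal p) (cube {..<n} I).
    f \<notin> mixed_space n I (lorentz_norm (ennreal (p * (real n - 1) / (real n - p))) (ennreal p)) (Lp_norm \<infinity>)"
proof -
  let ?S = "{..<n}"
  define r where "r = p * (real n - 1) / (real n - p)"
  define r' where "r' = p * real n / (real n - p)"
  have r: "0 < r" "0 < r'" using n p by (simp_all add: r_def r'_def)
  have p0: "0 < p" using p by simp
  define \<epsilon> where "\<epsilon> = 1 / (2 * r')"
  have \<epsilon>: "0 < \<epsilon>" using r by (simp add: \<epsilon>_def)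
  interpret PS: prob_space "P T" for T by (rule prob_P)
  interpret C: prob_space "cube T I" for T by (rule prob_space_cube)
  define \<gamma> where "\<gamma> t = \<bar>t - c\<bar> powr (- \<epsilon>)" for t
  define f where "f = (\<lambda>x :: nat \<Rightarrow> real. \<gamma> (x 0))"
  have \<gamma>m: "\<gamma> \<in> borel_measurable borel" unfolding \<gamma>_def by measurable
  have S0: "0 \<in> ?S" using n by simp
  have fP: "f \<in> borel_measurable (P ?S)"
    unfolding f_def
    by (rule measurable_compose[OF measurable_component_singleton[OF S0] borel_measurable_side[OF \<gamma>m]])
  have fC: "f \<in> borel_measurable (cube ?S I)" unfolding cube_def by (rule measurable_completion[OF fP])
  have \<gamma>_gt: "s < \<gamma> t \<longleftrightarrow> t \<noteq> c \<and> \<bar>t - c\<bar> < s powr (- 1 / \<epsilon>)" if s: "0 < s" for s t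
  proof (cases "t = c")
    case True then show ?thesis using s by (simp add: \<gamma>_def)
  next
    case False
    then have t: "0 < \<bar>t - c\<bar>" by simp
    have "s < \<gamma> t \<longleftrightarrow> (\<gamma> t) powr (- 1 / \<epsilon>) < s powr (- 1 / \<epsilon>)"
    proof
      assume "s < \<gamma> t"
      then show "(\<gamma> t) powr (- 1 / \<epsilon>) < s powr (- 1 / \<epsilon>)" using s \<epsilon> by (intro powr_less_mono2_neg) auto
    next
      assume less: "(\<gamma> t) powr (- 1 / \<epsilon>) < s powr (- 1 / \<epsilon>)"
      have "0 < \<gamma> t" using t by (simp add: \<gamma>_def)
      then have "\<gamma> t \<le> s \<Longrightarrow> s powr (- 1 / \<epsilon>) \<le> (\<gamma> t) powr (- 1 / \<epsilon>)" using \<epsilon> by (intro powr_mono2') auto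
      then show "s < \<gamma> t" using less by linarith
    qed
    also have "(\<gamma> t) powr (- 1 / \<epsilon>) = \<bar>t - c\<bar>" using \<epsilon> t by (simp add: \<gamma>_def powr_powr)
    finally show ?thesis using False by simp
  qed
  have level: "distr_fun (cube ?S I) (eabs f) s \<le> ennreal (s powr (- 1 / \<epsilon>))" if s: "0 < s" for s
  proof -
    define T where "T = {t. s < \<gamma> t}"
    have T: "T \<in> sets borel" unfolding T_def using \<gamma>m by measurable
    have indm: "(\<lambda>x. indicator T (x 0) :: ennreal) \<in> borel_measurable (P ?S)"
      using measurable_compose[OF measurable_component_singleton[OF S0] borel_measurable_side[of "indicator T"]] T by simp
    have "distr_fun (cube ?S I) (eabs f) s = emeasure (P ?S) {x \<in> space (P ?S). ennreal s < eabs f x}"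
      unfolding cube_def by (rule distr_fun_completion) (use fP in \<open>auto simp: eabs_def[abs_def]\<close>)
    also have "{x \<in> space (P ?S). ennreal s < eabs f x} = {x \<in> space (P ?S). x 0 \<in> T}"
      using s by (simp add: eabs_def ennreal_less_iff T_def f_def \<gamma>_def)
    also have "emeasure (P ?S) \<dots> = (\<integral>\<^sup>+x. indicator T (x 0) \<partial>P ?S)"
    proof -
      have "{x \<in> space (P ?S). x 0 \<in> T} \<in> sets (P ?S)"
        using measurable_sets[OF indm, of "{1}"] by (simp add: vimage_def Int_def conj_commute indicator_eq_1_iff)
      then have "emeasure (P ?S) {x \<in> space (P ?S). x 0 \<in> T} = (\<integral>\<^sup>+x. indicator {x \<in> space (P ?S). x 0 \<in> T} x \<partial>P ?S)"
        by simp
      also have "\<dots> = (\<integral>\<^sup>+x. indicator T (x 0) \<partial>P ?S)"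
        by (rule nn_integral_cong) (simp add: indicator_def)
      finally show ?thesis .
    qed
    also have "\<dots> = (\<integral>\<^sup>+t. indicator T t \<partial>J)"
      using nn_integral_slice(1)[OF finite_lessThan S0 indm] PS.emeasure_space_1 by simp
    also have "\<dots> = (\<integral>\<^sup>+t. indicator T t * indicator {c<..<c + 1} t \<partial>lborel)" by (rule nn_integral_side)
    also have "\<dots> \<le> (\<integral>\<^sup>+t. indicator {c..c + s powr (- 1 / \<epsilon>)} t \<partial>lborel)"
      by (intro nn_integral_mono) (auto simp: indicator_def T_def \<gamma>_gt[OF s])
    also have "\<dots> = ennreal (s powr (- 1 / \<epsilon>))" by simp
    finally show ?thesis .
  qed
  have em: "eabs f \<in> borel_measurable (cube ?S I)" unfolding eabs_def[abs_def] using fC by measurable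
  have "lorentz_norm (ennreal r') (ennreal p) (cube ?S I) (eabs f)
      \<le> ennreal ((r' / p + r' * 2 powr p * 2) powr (1 / p) * 1)"
  proof (rule C.lorentz_norm_le_dyadic[OF em p(1) r(2), where b = "\<lambda>j. (2 ^ j) powr (- 1 / \<epsilon>)"])
    show "distr_fun (cube ?S I) (eabs f) (2 ^ j * 1) \<le> ennreal ((2 ^ j) powr (- 1 / \<epsilon>))" for j
      using level[of "2 ^ j"] by simp
    have summand: "(2 ^ j * 1) powr p * ((2 ^ j) powr (- 1 / \<epsilon>)) powr (p / r') \<le> (1 / 2) ^ j" for j :: nat
    proof -
      have "- 1 / \<epsilon> * (p / r') = - 2 * p" using r by (simp add: \<epsilon>_def)
      then have "(2 ^ j * 1) powr p * ((2 ^ j) powr (- 1 / \<epsilon>)) powr (p / r') = (2 ^ j) powr (- p)"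
        by (simp add: powr_powr powr_add[symmetric])
      also have "\<dots> \<le> (2 ^ j) powr (- 1)" using p by (intro powr_mono) auto
      also have "\<dots> = (1 / 2) ^ j" by (simp add: powr_minus power_one_over inverse_eq_divide)
      finally show ?thesis .
    qed
    show "(\<Sum>j<m. (2 ^ j * 1) powr p * ((2 ^ j) powr (- 1 / \<epsilon>)) powr (p / r')) \<le> 2 * 1 powr p" for m
    proof -
      have "(\<Sum>j<m. (2 ^ j * 1) powr p * ((2 ^ j) powr (- 1 / \<epsilon>)) powr (p / r')) \<le> (\<Sum>j<m. (1 / 2) ^ j)"
        by (intro sum_mono summand)
      also have "\<dots> = 2 * (1 - (1 / 2) ^ m)" by (subst sum_gp_strict) auto
      finally show ?thesis by (simp add: order_trans)
    qed
  qed auto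
  then have inL: "f \<in> lorentz_space (ennreal r') (ennreal p) (cube ?S I)"
    using fC by (simp add: lorentz_space_def le_less_trans)
  have sh: "shadow ?S f 0 s = space (P (?S - {0}))" if s: "0 < s" for s
  proof -
    have "\<not> (AE t in J. \<bar>\<gamma> t\<bar> \<le> s)"
    proof
      assume "AE t in J. \<bar>\<gamma> t\<bar> \<le> s"
      define d where "d = min 1 (s powr (- 1 / \<epsilon>))"
      have d: "0 < d" "d \<le> 1" "d \<le> s powr (- 1 / \<epsilon>)" using s by (auto simp: d_def)
      have "AE t in lborel. c < t \<and> t < c + 1 \<longrightarrow> \<bar>\<gamma> t\<bar> \<le> s"
        using \<open>AE t in J. \<bar>\<gamma> t\<bar> \<le> s\<close> unfolding AE_side_iff .
      then have "AE t in lborel. t \<notin> {c<..<c + d}"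
      proof eventually_elim
        case (elim t)
        show ?case
        proof
          assume "t \<in> {c<..<c + d}"
          then have t: "c < t" "t < c + 1" "\<bar>t - c\<bar> < s powr (- 1 / \<epsilon>)" using d by auto
          then have "s < \<gamma> t" using \<gamma>_gt[OF s, of t] by simp
          then show False using elim t by auto
        qed
      qed
      then have "{c<..<c + d} \<in> null_sets lborel"
        by (subst (asm) AE_iff_null_sets[symmetric]) auto
      then have "emeasure lborel {c<..<c + d} = 0" by auto
      then show False using d by simp
    qed
    then show ?thesis by (simp add: shadow_def f_def)
  qed
  let ?\<psi> = "psi I (Lp_norm \<infinity>) 0 f"
  have \<psi>m: "?\<psi> \<in> borel_measurable (cube (?S - {0}) I)"
    by (rule psi_measurable_distr(1)[OF finite_lessThan S0 fP]) simp
  have \<psi>d: "distr_fun (cube (?S - {0}) I) ?\<psi> s = 1" if s: "0 < s" for s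
    using psi_measurable_distr(2)[OF finite_lessThan S0 fP, of f s] s PS.emeasure_space_1
    by (simp add: sh)
  have "lorentz_norm (ennreal r) (ennreal p) (cube (?S - {0}) I) ?\<psi> = \<infinity>"
  proof -
    have one: "epow 1 a = 1" for a using epow_ennreal[of 1 a] by simp
    have "(\<integral>\<^sup>+s. ennreal (r * s powr (p - 1)) * epow (distr_fun (cube (?S - {0}) I) ?\<psi> s) (p / r) * indicator {0<..} s \<partial>lborel)
        = (\<integral>\<^sup>+s. ennreal (r / p) * (ennreal (p * s powr (p - 1)) * indicator {s. 0 < s \<and> ennreal s < \<infinity>} s) \<partial>lborel)"
    proof (rule nn_integral_cong)
      fix s :: real
      have "ennreal (r / p) * ennreal (p * s powr (p - 1)) = ennreal (r * s powr (p - 1))"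
        using r p0 by (simp add: ennreal_mult[symmetric])
      then show "ennreal (r * s powr (p - 1)) * epow (distr_fun (cube (?S - {0}) I) ?\<psi> s) (p / r) * indicator {0<..} s
          = ennreal (r / p) * (ennreal (p * s powr (p - 1)) * indicator {s. 0 < s \<and> ennreal s < \<infinity>} s)"
        using \<psi>d[of s] by (cases "0 < s") (auto simp: one mult.assoc[symmetric])
    qed
    also have "\<dots> = ennreal (r / p) * epow \<infinity> p"
      unfolding epow_eq_nn_integral[OF p0] by (rule nn_integral_cmult) measurable
    also have "\<dots> = \<infinity>" using r p0 by (simp add: ennreal_mult_top)
    finally show ?thesis
      unfolding C.lorentz_norm_distribution[OF \<psi>m p0 r(1)] by simp
  qed
  then have "mixed_norm_k n I 0 (lorentz_norm (ennreal r) (ennreal p)) (Lp_norm \<infinity>) f = \<infinity>"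
    by (simp add: mixed_norm_k_def)
  then have "f \<notin> mixed_space n I (lorentz_norm (ennreal r) (ennreal p)) (Lp_norm \<infinity>)"
    using S0 by (auto simp: mixed_space_def mixed_space_k_def intro!: bexI[of _ 0])
  then show ?thesis using inL unfolding r_def r'_def by blast
qed

end

theorem corollary5p4:
  fixes n :: nat and I :: "real set" and p :: real
  assumes "n \<ge> 2"
    and "is_interval I" and "emeasure lborel I = 1"
    and "1 \<le> p" and "p < real n"
  defines "X \<equiv> lorentz_norm (ennreal (p * (real n - 1) / (real n - p))) (ennreal p)"
    and "Y \<equiv> Lp_norm \<infinity>"
    and "L \<equiv> lorentz_space (ennreal (p * real n / (real n - p))) (ennreal p) (cube {..<n} I)"
    and "NL \<equiv> (\<lambda>f. lorentz_norm (ennreal (p * real n / (real n - p))) (ennreal p)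
                       (cube {..<n} I) (eabs f))"
  shows "embeds (sobolev_space n I (ennreal p)) (sobolev_norm n I (ennreal p))
                (mixed_space n I X Y) (mixed_norm n I X Y)
       \<and> embeds (mixed_space n I X Y) (mixed_norm n I X Y) L NL
       \<and> mixed_space n I X Y \<noteq> L"
proof -
  obtain c where "unit_side I c" by (rule unit_interval_obtain[OF assms(2,3)])
  then interpret unit_side I c .
  show ?thesis
    unfolding X_def Y_def L_def NL_def
    using sobolev_embeds_mixed[OF assms(1,4,5)] mixed_embeds_lorentz[OF assms(1,4,5)]
      mixed_ne_lorentz[OF assms(1,4,5)] by blast
qed

end
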